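(* Assume $\mathrm{char}(\mathbb F)=p>0$ and $0\ne h\in R=\mathbb F[x]$. Let $\mathsf{Res}:\mathrm{Der}_{\mathbb F}(A_h)\to\mathrm{Der}_{\mathbb F}(\mathsf Z(A_h))$ be the restriction map and $\overline{\mathsf{Res}}:\mathsf{HH}^1(A_h)\to\mathrm{Der}_{\mathbb F}(\mathsf Z(A_h))$ the induced map. Then: (a) $\mathrm{im}\,\mathsf{Res}=\mathrm{im}\,\overline{\mathsf{Res}}$ is a free $\mathsf Z(A_h)$-submodule of $\mathrm{Der}_{\mathbb F}(\mathsf Z(A_h))$ of rank $2$ generated over $\mathsf Z(A_h)$ by $\frac{h^p}{\varrho_h}\frac{d}{d(x^p)}$ and $\overline h\,\frac{d}{d\mathsf z_h}$. (b) If $t_1=x^p$, $t_2=\mathsf z_h$, and $\mathsf Z(A_h)$ is identified with $\mathbb F[t_1,t_2]$, then $\mathrm{im}\,\mathsf{Res}$ is isomorphic to the subalgebra of the Witt algebra $\mathrm{Der}_{\mathbb F}(\mathbb F[t_1,t_2])$ generated over $\mathbb F[t_1,t_2]$ by $\mathsf d_1=\frac{h^p}{\varrho_h}\frac{d}{dt_1}$ and $\mathsf d_2=\overline h\,\frac{d}{dt_2}$, where $$[\mathsf d_1,\mathsf d_2]=\frac{d}{dt_1}\big(\overline h\big)\,\frac{h^p}{\varrho_h\overline h}\,\mathsf d_2.$$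
   Context: $\mathbb F$ is a field of characteristic $p>0$, $R=\mathbb F[x]$, $0\ne h\in R$. The Weyl algebra $A_1$ is the unital associative $\mathbb F$-algebra with generators $x,y$ and relation $yx-xy=1$. $A_h$ is the unital associative $\mathbb F$-algebra with generators $x,\hat y$ and relation $\hat yx-x\hat y=h$; it is identified with the subalgebra of $A_1$ generated by $x$ and $\hat y=yh$. The center of $A_h$ is the polynomial algebra $\mathsf Z(A_h)=\mathbb F[x^p,\mathsf z_h]$ in $x^p$ and $\mathsf z_h=h^py^p$; $\frac{d}{d(x^p)}$ and $\frac{d}{d\mathsf z_h}$ are the corresponding partial derivatives. $\mathsf{HH}^1(A_h)=\mathrm{Der}_{\mathbb F}(A_h)/\mathrm{Inder}_{\mathbb F}(A_h)$; $\mathsf{Res}$ sends a derivation of $A_h$ to its restriction to $\mathsf Z(A_h)$, and it kills inner derivations. $\varrho_h$ is the unique monic polynomial of maximal degree in $\mathbb F[x^p]$ dividing $h$ (so $h^p/\varrho_h\in\mathbb F[x^p]$). Write $h^{p-1}=\sum_{i=0}^{p-1}\overline h_ix^i$ with $\overline h_i\in\mathbb F[x^p]$; $\overline h\in\mathbb F[x^p]$ is the greatest common divisor in $\mathbb F[x^p]$ of $\overline h_0,\dots,\overline h_{p-1}$. *)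

theory Defs
  imports "HOL-Library.Poly_Mapping" "HOL-Computational_Algebra.Polynomial"
begin

section \<open>The Weyl algebra by generators and relations\<close>

text \<open>The free algebra on two generators is the monoid algebra of the free monoid of words.
  The constructor \<open>Wd\<close> only serves to avoid a monoid instance on the type of all lists.\<close>

datatype gen = GX | GY

datatype word = Wd (letters: "gen list")

instantiation word :: monoid_add
begin
definition zero_word :: word where "0 = Wd []"
definition plus_word :: "word \<Rightarrow> word \<Rightarrow> word" where "u + v = Wd (letters u @ letters v)"
instance by standard (simp_all add: zero_word_def plus_word_def)
end

type_synonym 'k free_alg = "word \<Rightarrow>\<^sub>0 'k"

definition free_gen :: "gen \<Rightarrow> 'k::field free_alg" where
  "free_gen g = Poly_Mapping.single (Wd [g]) 1"

definition two_sided_ideal :: "'a::ring_1 set \<Rightarrow> bool" where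
  "two_sided_ideal I \<longleftrightarrow> 0 \<in> I \<and> (\<forall>a\<in>I. \<forall>b\<in>I. a + b \<in> I) \<and> (\<forall>a\<in>I. \<forall>r. r * a \<in> I \<and> a * r \<in> I)"

definition weyl_ideal :: "'k::field free_alg set" where
  "weyl_ideal = two_sided_ideal hull {free_gen GY * free_gen GX - free_gen GX * free_gen GY - 1}"

definition weyl_rel :: "'k::field free_alg \<Rightarrow> 'k free_alg \<Rightarrow> bool" where
  "weyl_rel a b \<longleftrightarrow> a - b \<in> weyl_ideal"

lemma two_sided_ideal_weyl_ideal: "two_sided_ideal weyl_ideal"
  unfolding weyl_ideal_def by (rule hull_in) (auto simp: two_sided_ideal_def)

lemma weyl_ideal_add: "a \<in> weyl_ideal \<Longrightarrow> b \<in> weyl_ideal \<Longrightarrow> a + b \<in> weyl_ideal"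
  and weyl_ideal_zero: "0 \<in> weyl_ideal"
  and weyl_ideal_mult_left: "a \<in> weyl_ideal \<Longrightarrow> r * a \<in> weyl_ideal"
  and weyl_ideal_mult_right: "a \<in> weyl_ideal \<Longrightarrow> a * r \<in> weyl_ideal"
  using two_sided_ideal_weyl_ideal unfolding two_sided_ideal_def by blast+

lemma weyl_ideal_uminus: "a \<in> weyl_ideal \<Longrightarrow> - a \<in> weyl_ideal"
  using weyl_ideal_mult_left[of a "-1"] by simp

text \<open>The action of the free algebra on \<open>\<F>[x]\<close> by multiplication by \<open>x\<close> and by \<open>d/dx\<close>
  shows that the ideal is proper.\<close>

definition gen_act :: "gen \<Rightarrow> 'k::field poly \<Rightarrow> 'k poly" where
  "gen_act g f = (case g of GX \<Rightarrow> pCons 0 f | GY \<Rightarrow> pderiv f)"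

definition free_act :: "'k::field free_alg \<Rightarrow> 'k poly \<Rightarrow> 'k poly" where
  "free_act a f = (\<Sum>w\<in>Poly_Mapping.keys a.
     smult (Poly_Mapping.lookup a w) (foldr gen_act (letters w) f))"

lemma free_act_superset:
  assumes "finite S" "Poly_Mapping.keys a \<subseteq> S"
  shows "free_act a f =
    (\<Sum>w\<in>S. smult (Poly_Mapping.lookup a w) (foldr gen_act (letters w) f))"
  unfolding free_act_def using assms
  by (intro sum.mono_neutral_left) (auto simp: in_keys_iff)

lemma free_act_add: "free_act (a + b) f = free_act a f + free_act b f"
proof -
  define S where "S = Poly_Mapping.keys a \<union> Poly_Mapping.keys b"
  have "finite S" "Poly_Mapping.keys a \<subseteq> S" "Poly_Mapping.keys b \<subseteq> S"
       "Poly_Mapping.keys (a + b) \<subseteq> S"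
    using Poly_Mapping.keys_add[of a b] by (auto simp: S_def)
  then show ?thesis
    by (simp add: free_act_superset lookup_add smult_add_left sum.distrib)
qed

lemma free_act_zero [simp]: "free_act 0 f = 0"
  by (simp add: free_act_def)

lemma free_act_uminus: "free_act (- a) f = - free_act a f"
  using free_act_add[of a "- a" f] by (simp add: eq_neg_iff_add_eq_0 add.commute)

lemma free_act_diff: "free_act (a - b) f = free_act a f - free_act b f"
  using free_act_add[of a "- b" f] by (simp add: free_act_uminus)

lemma free_act_single:
  "free_act (Poly_Mapping.single w c) f = smult c (foldr gen_act (letters w) f)"
  by (cases "c = 0") (auto simp: free_act_def)

lemma gen_act_add: "gen_act g (u + v) = gen_act g u + gen_act g v"
  by (cases g) (auto simp: gen_act_def pderiv_add)

lemma gen_act_smult: "gen_act g (smult c u) = smult c (gen_act g u)"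
  by (cases g) (auto simp: gen_act_def pderiv_smult)

lemma foldr_gen_act_add: "foldr gen_act ws (u + v) = foldr gen_act ws u + foldr gen_act ws v"
  by (induction ws) (auto simp: gen_act_add)

lemma foldr_gen_act_smult: "foldr gen_act ws (smult c u) = smult c (foldr gen_act ws u)"
  by (induction ws) (auto simp: gen_act_smult)

lemma free_act_arg_add: "free_act a (u + v) = free_act a u + free_act a v"
  by (simp add: free_act_def foldr_gen_act_add smult_add_right sum.distrib)

lemma free_act_arg_zero [simp]: "free_act (a :: 'a::field free_alg) 0 = 0"
proof -
  have "foldr gen_act ws 0 = (0 :: 'a poly)" for ws
    using foldr_gen_act_smult[of ws "0 :: 'a" 0] by simp
  then show ?thesis by (simp add: free_act_def)
qed

lemma free_alg_induct [case_names zero single add]: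
  fixes a :: "'k::field free_alg"
  assumes "P 0" and s: "\<And>w c. P (Poly_Mapping.single w c)"
    and p: "\<And>a b. P a \<Longrightarrow> P b \<Longrightarrow> P (a + b)"
  shows "P a"
proof (induction a rule: update_induct)
  case const
  then show ?case using assms(1) by simp
next
  case (update f w c)
  have "Poly_Mapping.update w c f = f + Poly_Mapping.single w c"
    using update by (intro poly_mapping_eqI)
      (auto simp: lookup_update lookup_add lookup_single in_keys_iff when_def)
  then show ?case using update p s by metis
qed

lemma free_act_mult: "free_act (a * b) f = free_act a (free_act b f)"
proof (induction a rule: free_alg_induct)
  case zero
  then show ?case by simp
next
  case (add a b)
  then show ?case by (simp add: distrib_right free_act_add)
next
  case (single w c)
  show ?case
  proof (induction b rule: free_alg_induct)
    case zero
    then show ?case by simp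
  next
    case (add a b)
    then show ?case by (simp add: distrib_left free_act_add free_act_arg_add)
  next
    case (single v d)
    then show ?case
      by (simp add: mult_single free_act_single plus_word_def foldr_gen_act_smult)
  qed
qed

lemma free_act_one: "free_act 1 f = f"
proof -
  have "letters 0 = []" by (simp add: zero_word_def)
  then show ?thesis using free_act_single[of 0 1 f] by simp
qed

lemma one_notin_weyl_ideal: "(1 :: 'k::field free_alg) \<notin> weyl_ideal"
proof
  define J where "J = {a :: 'k free_alg. \<forall>f. free_act a f = 0}"
  have "two_sided_ideal J"
    by (auto simp: two_sided_ideal_def J_def free_act_add free_act_mult)
  moreover have "free_gen GY * free_gen GX - free_gen GX * free_gen GY - 1 \<in> J"
    by (auto simp: J_def free_gen_def free_act_diff free_act_mult free_act_single free_act_one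
        gen_act_def pderiv_pCons)
  ultimately have "weyl_ideal \<subseteq> J"
    unfolding weyl_ideal_def by (intro hull_minimal) auto
  moreover assume "(1 :: 'k free_alg) \<in> weyl_ideal"
  ultimately have "(1 :: 'k poly) = 0"
    using free_act_one[of "1 :: 'k poly"] by (auto simp: J_def)
  then show False by simp
qed

lemma equivp_weyl_rel: "equivp (weyl_rel :: 'k::field free_alg \<Rightarrow> _)"
proof (rule equivpI)
  show "reflp (weyl_rel :: 'k free_alg \<Rightarrow> _)" by (auto simp: reflp_def weyl_rel_def weyl_ideal_zero)
  show "symp (weyl_rel :: 'k free_alg \<Rightarrow> _)"
  proof (rule sympI)
    fix a b :: "'k free_alg"
    assume "weyl_rel a b"
    then show "weyl_rel b a" using weyl_ideal_uminus[of "a - b"] by (simp add: weyl_rel_def)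
  qed
  show "transp (weyl_rel :: 'k free_alg \<Rightarrow> _)"
  proof (rule transpI)
    fix a b c :: "'k free_alg"
    assume "weyl_rel a b" "weyl_rel b c"
    then show "weyl_rel a c"
      using weyl_ideal_add[of "a - b" "b - c"] by (simp add: weyl_rel_def)
  qed
qed

quotient_type (overloaded) 'k weyl = "'k::field free_alg" / weyl_rel
  by (rule equivp_weyl_rel)

lemma weyl_rel_refl: "a = b \<Longrightarrow> weyl_rel a b"
  by (simp add: weyl_rel_def weyl_ideal_zero)

instantiation weyl :: (field) ring_1
begin

lift_definition zero_weyl :: "'a weyl" is 0 .
lift_definition one_weyl :: "'a weyl" is 1 .
lift_definition plus_weyl :: "'a weyl \<Rightarrow> 'a weyl \<Rightarrow> 'a weyl" is "(+)"
proof -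
  fix a a' b b' :: "'a free_alg"
  assume "weyl_rel a a'" "weyl_rel b b'"
  then have "(a - a') + (b - b') \<in> weyl_ideal"
    unfolding weyl_rel_def by (intro weyl_ideal_add)
  then show "weyl_rel (a + b) (a' + b')"
    unfolding weyl_rel_def by (simp add: algebra_simps)
qed
lift_definition uminus_weyl :: "'a weyl \<Rightarrow> 'a weyl" is uminus
proof -
  fix a a' :: "'a free_alg"
  assume "weyl_rel a a'"
  then have "- (a - a') \<in> weyl_ideal"
    unfolding weyl_rel_def by (rule weyl_ideal_uminus)
  then show "weyl_rel (- a) (- a')"
    unfolding weyl_rel_def by simp
qed
lift_definition minus_weyl :: "'a weyl \<Rightarrow> 'a weyl \<Rightarrow> 'a weyl" is "(-)"
proof -
  fix a a' b b' :: "'a free_alg"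
  assume "weyl_rel a a'" "weyl_rel b b'"
  then have "(a - a') + - (b - b') \<in> weyl_ideal"
    unfolding weyl_rel_def by (intro weyl_ideal_add weyl_ideal_uminus)
  then show "weyl_rel (a - b) (a' - b')"
    unfolding weyl_rel_def by (simp add: algebra_simps)
qed
lift_definition times_weyl :: "'a weyl \<Rightarrow> 'a weyl \<Rightarrow> 'a weyl" is "(*)"
proof -
  fix a a' b b' :: "'a free_alg"
  assume "weyl_rel a a'" "weyl_rel b b'"
  then have "(a - a') * b + a' * (b - b') \<in> weyl_ideal"
    unfolding weyl_rel_def by (intro weyl_ideal_add weyl_ideal_mult_left weyl_ideal_mult_right)
  then show "weyl_rel (a * b) (a' * b')"
    unfolding weyl_rel_def by (simp add: algebra_simps)
qed

instance
proof
  fix a b c :: "'a weyl"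
  show "a + b + c = a + (b + c)" by transfer (rule weyl_rel_refl, simp add: algebra_simps)
  show "a + b = b + a" by transfer (rule weyl_rel_refl, simp add: algebra_simps)
  show "0 + a = a" by transfer (rule weyl_rel_refl, simp)
  show "- a + a = 0" by transfer (rule weyl_rel_refl, simp)
  show "a - b = a + - b" by transfer (rule weyl_rel_refl, simp)
  show "a * b * c = a * (b * c)" by transfer (rule weyl_rel_refl, simp add: algebra_simps)
  show "1 * a = a" by transfer (rule weyl_rel_refl, simp)
  show "a * 1 = a" by transfer (rule weyl_rel_refl, simp)
  show "(a + b) * c = a * c + b * c" by transfer (rule weyl_rel_refl, simp add: algebra_simps)
  show "a * (b + c) = a * b + a * c" by transfer (rule weyl_rel_refl, simp add: algebra_simps)
  show "(0 :: 'a weyl) \<noteq> 1"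
  proof (transfer, rule notI)
    assume "weyl_rel (0 :: 'a free_alg) 1"
    then have "0 - 1 \<in> (weyl_ideal :: 'a free_alg set)" by (simp only: weyl_rel_def)
    from weyl_ideal_uminus[OF this] have "1 \<in> (weyl_ideal :: 'a free_alg set)"
      by (simp only: minus_diff_eq diff_zero)
    with one_notin_weyl_ideal show False ..
  qed
qed

end

lift_definition weyl_const :: "'k::field \<Rightarrow> 'k weyl" is "\<lambda>c. Poly_Mapping.single 0 c" .
lift_definition weyl_x :: "'k::field weyl" is "free_gen GX" .
lift_definition weyl_y :: "'k::field weyl" is "free_gen GY" .

lemma weyl_relation: "weyl_y * weyl_x - weyl_x * weyl_y = 1"
  by transfer (unfold weyl_rel_def weyl_ideal_def, rule hull_inc, rule singletonI)

definition weyl_poly :: "'k::field poly \<Rightarrow> 'k weyl" where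
  "weyl_poly f = (\<Sum>i\<le>degree f. weyl_const (coeff f i) * weyl_x ^ i)"


section \<open>Algebras, derivations and first Hochschild cohomology\<close>

text \<open>An \<open>\<F>\<close>-algebra is given here by a unital subring \<open>A\<close> of a type of class \<open>ring_1\<close> together
  with the structure map \<open>\<kappa> :: 'k \<Rightarrow> 'a\<close>, so that \<open>c\<close> acts on \<open>a\<close> as \<open>\<kappa> c * a\<close>.\<close>

definition subalgebra :: "('k::field \<Rightarrow> 'a::ring_1) \<Rightarrow> 'a set \<Rightarrow> bool" where
  "subalgebra \<kappa> A \<longleftrightarrow> range \<kappa> \<subseteq> A \<and> (\<forall>a\<in>A. \<forall>b\<in>A. a + b \<in> A \<and> a * b \<in> A)"

definition centre :: "'a::ring_1 set \<Rightarrow> 'a set" where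
  "centre A = {z\<in>A. \<forall>a\<in>A. z * a = a * z}"

text \<open>Maps defined on \<open>A\<close> only are extended by \<open>0\<close>, so that distinct functions are distinct maps.\<close>

definition restrict0 :: "'a set \<Rightarrow> ('a \<Rightarrow> 'b::zero) \<Rightarrow> 'a \<Rightarrow> 'b" where
  "restrict0 A f = (\<lambda>a. if a \<in> A then f a else 0)"

definition derivations :: "('k::field \<Rightarrow> 'a::ring_1) \<Rightarrow> 'a set \<Rightarrow> ('a \<Rightarrow> 'a) set" where
  "derivations \<kappa> A = {D. (\<forall>a\<in>A. D a \<in> A) \<and> (\<forall>a. a \<notin> A \<longrightarrow> D a = 0)
     \<and> (\<forall>a\<in>A. \<forall>b\<in>A. D (a + b) = D a + D b)
     \<and> (\<forall>c. \<forall>a\<in>A. D (\<kappa> c * a) = \<kappa> c * D a)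
     \<and> (\<forall>a\<in>A. \<forall>b\<in>A. D (a * b) = D a * b + a * D b)}"

definition inner_derivations :: "'a::ring_1 set \<Rightarrow> ('a \<Rightarrow> 'a) set" where
  "inner_derivations A = {restrict0 A (\<lambda>a. u * a - a * u) | u. u \<in> A}"

definition HH1 :: "('k::field \<Rightarrow> 'a::ring_1) \<Rightarrow> 'a set \<Rightarrow> ('a \<Rightarrow> 'a) set set" where
  "HH1 \<kappa> A = derivations \<kappa> A // {(D, E). D \<in> derivations \<kappa> A \<and> E \<in> derivations \<kappa> A
     \<and> (\<lambda>a. D a - E a) \<in> inner_derivations A}"

definition Res :: "'a::ring_1 set \<Rightarrow> ('a \<Rightarrow> 'a) \<Rightarrow> ('a \<Rightarrow> 'a)" where
  "Res A = restrict0 (centre A)"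

text \<open>The common value of \<open>Res\<close> on a coset; see \<open>Res_bar_class\<close> below.\<close>

definition Res_bar :: "'a::ring_1 set \<Rightarrow> ('a \<Rightarrow> 'a) set \<Rightarrow> ('a \<Rightarrow> 'a)" where
  "Res_bar A C = the_elem (Res A ` C)"

lemma Res_inner: "D \<in> inner_derivations A \<Longrightarrow> Res A D = (\<lambda>_. 0)"
  by (auto simp: inner_derivations_def Res_def restrict0_def centre_def fun_eq_iff)

lemma Res_bar_class:
  assumes "D \<in> derivations \<kappa> A" and "0 \<in> A"
  shows "Res_bar A ({(D, E). D \<in> derivations \<kappa> A \<and> E \<in> derivations \<kappa> A
     \<and> (\<lambda>a. D a - E a) \<in> inner_derivations A} `` {D}) = Res A D"
    (is "Res_bar A (?R `` {D}) = _")
proof -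
  have "(\<lambda>a. D a - D a) \<in> inner_derivations A"
    using assms(2) by (auto simp: inner_derivations_def restrict0_def intro!: exI[of _ 0])
  moreover have "Res A E = Res A D" if "(\<lambda>a. D a - E a) \<in> inner_derivations A" for E
  proof
    fix a
    have "Res A (\<lambda>a. D a - E a) a = 0" using Res_inner[OF that] by (rule fun_cong)
    then show "Res A E a = Res A D a"
      unfolding Res_def restrict0_def by (cases "a \<in> centre A") simp_all
  qed
  ultimately have "Res A D \<in> Res A ` (?R `` {D})" "Res A ` (?R `` {D}) \<subseteq> {Res A D}"
    using assms(1) by blast+
  then have "Res A ` (?R `` {D}) = {Res A D}" by blast
  then show ?thesis by (simp add: Res_bar_def)
qed

definition fsmult :: "'a::ring_1 \<Rightarrow> ('a \<Rightarrow> 'a) \<Rightarrow> ('a \<Rightarrow> 'a)" where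
  "fsmult z D = (\<lambda>a. z * D a)"

definition lie :: "('a \<Rightarrow> 'a::ring_1) \<Rightarrow> ('a \<Rightarrow> 'a) \<Rightarrow> ('a \<Rightarrow> 'a)" where
  "lie D E = (\<lambda>a. D (E a) - E (D a))"

definition submodule :: "'a::ring_1 set \<Rightarrow> ('a \<Rightarrow> 'a) set \<Rightarrow> ('a \<Rightarrow> 'a) set \<Rightarrow> bool" where
  "submodule Z M N \<longleftrightarrow> N \<subseteq> M \<and> (\<lambda>_. 0) \<in> N \<and> (\<forall>D\<in>N. \<forall>E\<in>N. (\<lambda>a. D a + E a) \<in> N)
     \<and> (\<forall>z\<in>Z. \<forall>D\<in>N. fsmult z D \<in> N)"

definition free_basis :: "'a::ring_1 set \<Rightarrow> ('a \<Rightarrow> 'a) set \<Rightarrow> ('a \<Rightarrow> 'a) set \<Rightarrow> bool" where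
  "free_basis Z N B \<longleftrightarrow> finite B \<and> B \<subseteq> N
     \<and> (\<forall>D\<in>N. \<exists>c. (\<forall>b\<in>B. c b \<in> Z) \<and> D = (\<lambda>a. \<Sum>b\<in>B. fsmult (c b) b a))
     \<and> (\<forall>c. (\<forall>b\<in>B. c b \<in> Z) \<and> (\<lambda>a. \<Sum>b\<in>B. fsmult (c b) b a) = (\<lambda>_. 0) \<longrightarrow> (\<forall>b\<in>B. c b = 0))"

definition algebra_iso ::
  "('k::field \<Rightarrow> 'a::ring_1) \<Rightarrow> 'a set \<Rightarrow> ('k \<Rightarrow> 'b::ring_1) \<Rightarrow> 'b set \<Rightarrow> ('a \<Rightarrow> 'b) \<Rightarrow> bool" where
  "algebra_iso \<kappa> A \<kappa>' B \<phi> \<longleftrightarrow> bij_betw \<phi> A B \<and> (\<forall>c. \<phi> (\<kappa> c) = \<kappa>' c)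
     \<and> (\<forall>a\<in>A. \<forall>b\<in>A. \<phi> (a + b) = \<phi> a + \<phi> b \<and> \<phi> (a * b) = \<phi> a * \<phi> b)"

definition lie_iso :: "('k::field \<Rightarrow> 'a::ring_1) \<Rightarrow> ('a \<Rightarrow> 'a) set \<Rightarrow> ('k \<Rightarrow> 'b::ring_1) \<Rightarrow>
    ('b \<Rightarrow> 'b) set \<Rightarrow> (('a \<Rightarrow> 'a) \<Rightarrow> ('b \<Rightarrow> 'b)) \<Rightarrow> bool" where
  "lie_iso \<kappa> L \<kappa>' M \<Phi> \<longleftrightarrow> bij_betw \<Phi> L M
     \<and> (\<forall>D\<in>L. \<forall>E\<in>L. \<Phi> (\<lambda>a. D a + E a) = (\<lambda>b. \<Phi> D b + \<Phi> E b) \<and> \<Phi> (lie D E) = lie (\<Phi> D) (\<Phi> E))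
     \<and> (\<forall>c. \<forall>D\<in>L. \<Phi> (fsmult (\<kappa> c) D) = fsmult (\<kappa>' c) (\<Phi> D))"


section \<open>The algebra \<open>A\<^sub>h\<close>, its centre and the polynomials attached to \<open>h\<close>\<close>

definition yhat :: "'k::field poly \<Rightarrow> 'k weyl" where
  "yhat h = weyl_y * weyl_poly h"

lemma weyl_poly_commutes_x: "weyl_poly h * weyl_x = weyl_x * weyl_poly h"
proof -
  have c: "weyl_const c * weyl_x = weyl_x * weyl_const c" for c :: 'a
    by transfer (rule weyl_rel_refl, simp add: free_gen_def mult_single plus_word_def zero_word_def)
  have "weyl_const c * weyl_x ^ i * weyl_x = weyl_x * (weyl_const c * weyl_x ^ i)"
    for c :: 'a and i
    by (simp only: mult.assoc power_commutes) (simp only: mult.assoc[symmetric] c)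
  then show ?thesis
    by (simp only: weyl_poly_def sum_distrib_left sum_distrib_right)
qed

lemma yhat_relation: "yhat h * weyl_x - weyl_x * yhat h = weyl_poly h"
proof -
  have "yhat h * weyl_x - weyl_x * yhat h = (weyl_y * weyl_x - weyl_x * weyl_y) * weyl_poly h"
    by (simp only: yhat_def mult.assoc weyl_poly_commutes_x left_diff_distrib)
  then show ?thesis by (simp only: weyl_relation mult_1_left)
qed

definition A_h :: "'k::field poly \<Rightarrow> 'k weyl set" where
  "A_h h = subalgebra weyl_const hull {weyl_x, yhat h}"

definition z_h :: "'k::field poly \<Rightarrow> 'k weyl" where
  "z_h h = weyl_poly h ^ CHAR('k) * weyl_y ^ CHAR('k)"

text \<open>\<open>\<F>[t\<^sub>1,t\<^sub>2]\<close> is the type \<open>'k poly poly\<close>, with \<open>t\<^sub>1\<close> the inner and \<open>t\<^sub>2\<close> the outer variable.\<close>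

definition const12 :: "'k::field \<Rightarrow> 'k poly poly" where
  "const12 c = [:[:c:]:]"

definition d_t1 :: "'k::field poly poly \<Rightarrow> 'k poly poly" where
  "d_t1 = map_poly pderiv"

definition d_t2 :: "'k::field poly poly \<Rightarrow> 'k poly poly" where
  "d_t2 = pderiv"

text \<open>The identification \<open>t\<^sub>1 \<mapsto> x\<^sup>p\<close>, \<open>t\<^sub>2 \<mapsto> z\<^sub>h\<close> of \<open>\<F>[t\<^sub>1,t\<^sub>2]\<close> with the centre of \<open>A\<^sub>h\<close>,
  and the resulting transport of maps.\<close>

definition ident :: "'k::field poly \<Rightarrow> 'k poly poly \<Rightarrow> 'k weyl" where
  "ident h P = (\<Sum>j\<le>degree P. \<Sum>i\<le>degree (coeff P j).
     weyl_const (coeff (coeff P j) i) * (weyl_x ^ CHAR('k)) ^ i * z_h h ^ j)"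

definition transport :: "'k::field poly \<Rightarrow> ('k poly poly \<Rightarrow> 'k poly poly) \<Rightarrow> ('k weyl \<Rightarrow> 'k weyl)" where
  "transport h D = restrict0 (centre (A_h h)) (\<lambda>a. ident h (D (inv (ident h) a)))"

definition d_xp :: "'k::field poly \<Rightarrow> 'k weyl \<Rightarrow> 'k weyl" where
  "d_xp h = transport h d_t1"

definition d_zh :: "'k::field poly \<Rightarrow> 'k weyl \<Rightarrow> 'k weyl" where
  "d_zh h = transport h d_t2"

definition xp_poly :: "'k::field poly \<Rightarrow> 'k poly" where
  "xp_poly q = pcompose q (monom 1 CHAR('k))"

definition xp_ring :: "'k::field poly set" where
  "xp_ring = range xp_poly"

text \<open>An element of \<open>\<F>[x\<^sup>p]\<close> as a polynomial in \<open>t\<^sub>1 = x\<^sup>p\<close>.\<close>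

definition in_t1 :: "'k::field poly \<Rightarrow> 'k poly poly" where
  "in_t1 f = [:the_inv xp_poly f:]"

definition rho :: "'k::field poly \<Rightarrow> 'k poly" where
  "rho h = (THE r. r \<in> xp_ring \<and> lead_coeff r = 1 \<and> r dvd h
     \<and> (\<forall>s\<in>xp_ring. lead_coeff s = 1 \<and> s dvd h \<longrightarrow> degree s \<le> degree r))"

definition hcomp :: "'k::field poly \<Rightarrow> nat \<Rightarrow> 'k poly" where
  "hcomp h = (THE c. (\<forall>i<CHAR('k). c i \<in> xp_ring) \<and> (\<forall>i\<ge>CHAR('k). c i = 0)
     \<and> h ^ (CHAR('k) - 1) = (\<Sum>i<CHAR('k). c i * monom 1 i))"

definition xp_dvd :: "'k::field poly \<Rightarrow> 'k poly \<Rightarrow> bool" where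
  "xp_dvd a b \<longleftrightarrow> (\<exists>c\<in>xp_ring. b = a * c)"

text \<open>Greatest common divisors are normalised to be monic.\<close>

definition hbar :: "'k::field poly \<Rightarrow> 'k poly" where
  "hbar h = (THE g. g \<in> xp_ring \<and> lead_coeff g = 1 \<and> (\<forall>i<CHAR('k). xp_dvd g (hcomp h i))
     \<and> (\<forall>d\<in>xp_ring. (\<forall>i<CHAR('k). xp_dvd d (hcomp h i)) \<longrightarrow> xp_dvd d g))"

text \<open>The subalgebra of the Witt algebra \<open>Der(\<F>[t\<^sub>1,t\<^sub>2])\<close> generated over \<open>\<F>[t\<^sub>1,t\<^sub>2]\<close> by a set:
  the smallest \<open>\<F>[t\<^sub>1,t\<^sub>2]\<close>-submodule containing it that is closed under the Lie bracket.\<close>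

definition witt_subalgebra_gen ::
  "('k::field poly poly \<Rightarrow> 'k poly poly) set \<Rightarrow> ('k poly poly \<Rightarrow> 'k poly poly) set" where
  "witt_subalgebra_gen B = (\<lambda>L. submodule UNIV (derivations const12 UNIV) L
     \<and> (\<forall>D\<in>L. \<forall>E\<in>L. lie D E \<in> L)) hull B"

definition d1 :: "'k::field poly \<Rightarrow> 'k poly poly \<Rightarrow> 'k poly poly" where
  "d1 h = fsmult (in_t1 (h ^ CHAR('k) div rho h)) d_t1"

definition d2 :: "'k::field poly \<Rightarrow> 'k poly poly \<Rightarrow> 'k poly poly" where
  "d2 h = fsmult (in_t1 (hbar h)) d_t2"

end

theory Submission
  imports Defs "HOL-Library.Product_Plus"
begin

text \<open>
  Write \<open>R = \<F>[x]\<close> and \<open>p\<close> for the characteristic. Since \<open>A\<^sub>1\<close> has the basis \<open>x\<^sup>i y\<^sup>j\<close>, every element has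
  unique left coefficients in \<open>R\<close> with respect to the powers of \<open>y\<close> (\<open>cf\<close>). On these coefficients
  \<open>[y,-]\<close> is \<open>d/dx\<close> and \<open>[-,x]\<close> is the formal derivative in \<open>y\<close>, and \<open>A\<^sub>h\<close> consists of the
  elements whose coefficient at \<open>y\<^sup>j\<close> is divisible by \<open>h\<^sup>j\<close> (\<open>A_h_iff\<close>). The centre
  \<open>\<F>[x\<^sup>p, z\<^sub>h]\<close> can be read off from this description (\<open>centre_eq_range\<close>). As \<open>\<F>[t\<^sub>1,t\<^sub>2]\<close> is
  free on \<open>t\<^sub>1, t\<^sub>2\<close>, a derivation of the centre is determined by its values on \<open>x\<^sup>p\<close> and \<open>z\<^sub>h\<close>, so
  the theorem says that the pairs \<open>(D(x\<^sup>p), D(z\<^sub>h))\<close>, for \<open>D\<close> a derivation of \<open>A\<^sub>h\<close>, are exactly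
  the pairs in \<open>Z h\<^sup>p/\<rho> \<times> Z hbar\<close>.

  The main tool is \<open>D(u\<^sup>p) = ad\<^sub>u\<^sup>p\<^sup>-\<^sup>1(D u)\<close>, valid in characteristic \<open>p\<close>
  (\<open>leibniz_power_char\<close>).

  For \<open>u = x\<close> it shows that the coefficients of the central element \<open>D(x\<^sup>p)\<close> are, up to units,
  coefficients of \<open>D x \<in> A\<^sub>h\<close> whose index is larger by \<open>p - 1\<close>. Hence the coefficient at \<open>y\<^sup>p\<^sup>m\<close> is
  \<open>h\<^sup>p\<^sup>m c\<close> with \<open>c\<close> in \<open>\<F>[x\<^sup>p]\<close> divisible by \<open>h\<^sup>p\<^sup>-\<^sup>1\<close>, and such a \<open>c\<close> is automatically divisible by
  \<open>h\<^sup>p/\<rho>\<close> (\<open>power_char_div_rho_dvd\<close>). The value \<open>h\<^sup>p/\<rho>\<close> is attained by a multiple of the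
  derivation \<open>x \<mapsto> y\<^sup>p\<^sup>-\<^sup>1\<close>, \<open>y \<mapsto> 0\<close> of \<open>A\<^sub>1\<close> (\<open>derivation_xp_exists\<close>); it preserves \<open>A\<^sub>h\<close> because
  \<open>h' = \<rho> (h/\<rho>)'\<close>.

  For \<open>u = y\<close> the tool brings in the operator \<open>(d/dx)\<^sup>p\<^sup>-\<^sup>1\<close>, which extracts from a polynomial its
  component at \<open>x\<^sup>p\<^sup>-\<^sup>1\<close> over \<open>\<F>[x\<^sup>p]\<close>. The derivation \<open>x \<mapsto> 0\<close>, \<open>yhat \<mapsto> g\<close> sends \<open>z\<^sub>h\<close> to
  \<open>(d/dx)\<^sup>p\<^sup>-\<^sup>1(h\<^sup>p\<^sup>-\<^sup>1 g)\<close>, and as \<open>g\<close> runs through \<open>R\<close> these values form the ideal of \<open>\<F>[x\<^sup>p]\<close>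
  generated by the components of \<open>h\<^sup>p\<^sup>-\<^sup>1\<close>, that is, by \<open>hbar\<close> (\<open>hbar_dvd_top_deriv\<close>,
  \<open>hbar_eq_top_deriv\<close>). Conversely, a derivation \<open>D\<close> with \<open>D(x\<^sup>p) = 0\<close> becomes of this kind after
  multiplication by \<open>h\<^sup>p\<close> and subtraction of an inner derivation, except that \<open>g\<close> now lies in
  \<open>R[z\<^sub>h]\<close>; the value \<open>g\<close> so obtained is still divisible by \<open>h\<^sup>p\<close> (\<open>derivations_zh_special\<close>). A general \<open>D\<close> is reduced to this case by
  subtracting a central multiple of the derivation with \<open>x\<^sup>p \<mapsto> h\<^sup>p/\<rho>\<close>. That one sends
  \<open>z\<^sub>h\<close> to \<open>((h')\<^sup>p/\<rho>) z\<^sub>h\<close>, which lies in \<open>Z hbar\<close> by the identity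
  \<open>(d/dx)\<^sup>p\<^sup>-\<^sup>1(h\<^sup>p\<^sup>-\<^sup>1 h') = (p-1)! (h')\<^sup>p\<close> (\<open>top_deriv_log\<close>).

  Part (b) follows by transport along \<open>\<F>[t\<^sub>1,t\<^sub>2] \<cong> Z\<close>. The \<open>\<F>[t\<^sub>1,t\<^sub>2]\<close>-span of \<open>d\<^sub>1\<close> and \<open>d\<^sub>2\<close> is
  closed under the bracket because \<open>hbar\<close> divides \<open>h\<^sup>p/\<rho>\<close>: \<open>hbar\<close> divides \<open>h\<^sup>p\<^sup>-\<^sup>1\<close> and \<open>\<rho>\<close> divides
  \<open>h\<close>.
\<close>

section \<open>The subring of polynomials in the \<open>p\<close>-th power of the variable\<close>

lemma coeff_xp_poly:
  assumes "CHAR('k::field) > 0"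
  shows "coeff (xp_poly (q :: 'k poly)) n = (if CHAR('k) dvd n then coeff q (n div CHAR('k)) else 0)"
proof (induction q arbitrary: n)
  case 0
  then show ?case by (simp add: xp_poly_def)
next
  case (pCons a q)
  have "coeff (xp_poly (pCons a q)) n = coeff [:a:] n + coeff (monom 1 CHAR('k) * xp_poly q) n"
    by (simp add: xp_poly_def pcompose_pCons)
  also have "\<dots> = (if CHAR('k) dvd n then coeff (pCons a q) (n div CHAR('k)) else 0)"
  proof (cases "n < CHAR('k)")
    case True
    then have "CHAR('k) dvd n \<longleftrightarrow> n = 0" by auto
    then show ?thesis using True by (auto simp: coeff_monom_mult coeff_pCons split: nat.splits)
  next
    case False
    then obtain m where m: "n = CHAR('k) + m" using le_Suc_ex not_less by blast
    have "n div CHAR('k) = Suc (m div CHAR('k))" using assms m by simp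
    then show ?thesis using m assms
      by (auto simp: coeff_monom_mult pCons.IH coeff_pCons split: nat.splits)
  qed
  finally show ?case .
qed

text \<open>In characteristic \<open>p\<close> the coefficient \<open>i\<close> of \<open>i x\<^sup>i\<^sup>-\<^sup>1\<close> vanishes exactly when \<open>p\<close> divides \<open>i\<close>. This
  turns membership in \<open>\<F>[x\<^sup>p]\<close>, and in particular closure under exact division, into a differential equation.\<close>

lemma xp_ring_iff_pderiv:
  assumes "CHAR('k::field) > 0"
  shows "(f :: 'k poly) \<in> xp_ring \<longleftrightarrow> pderiv f = 0"
proof
  assume "f \<in> xp_ring"
  then obtain q where "f = xp_poly q" by (auto simp: xp_ring_def)
  then show "pderiv f = 0"
    by (intro poly_eqI) (auto simp: coeff_pderiv coeff_xp_poly[OF assms] of_nat_eq_0_iff_char_dvd simp del: of_nat_Suc)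
next
  let ?p = "CHAR('k)"
  assume d: "pderiv f = 0"
  have z: "coeff f n = 0" if "\<not> ?p dvd n" for n
  proof (cases n)
    case 0
    with that show ?thesis by simp
  next
    case (Suc m)
    have "of_nat (Suc m) * coeff f (Suc m) = 0" using arg_cong[OF d, of "\<lambda>g. coeff g m"]
      by (simp add: coeff_pderiv)
    then show ?thesis using that Suc of_nat_eq_0_iff_char_dvd[where 'a='k, of "Suc m"] by (auto simp del: of_nat_Suc)
  qed
  define q where "q = (\<Sum>i\<le>degree f. monom (coeff f (?p * i)) i)"
  have q: "coeff q i = coeff f (?p * i)" for i
  proof (cases "i \<le> degree f")
    case True
    then show ?thesis by (simp add: q_def coeff_sum)
  next
    case False
    then have "degree f < ?p * i" using assms by (metis dual_order.strict_trans2 le_add1 less_eq_Suc_le linorder_not_less mult_eq_if add.commute not_gr_zero)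
    then show ?thesis using False by (simp add: q_def coeff_sum coeff_eq_0)
  qed
  have "f = xp_poly q"
    by (intro poly_eqI) (use z in \<open>auto simp: coeff_xp_poly[OF assms] q\<close>)
  then show "f \<in> xp_ring" by (auto simp: xp_ring_def)
qed

lemma xp_poly_add: "xp_poly (f + g) = xp_poly f + xp_poly g"
  by (simp add: xp_poly_def pcompose_add)

lemma xp_poly_mult: "xp_poly (f * g) = xp_poly f * xp_poly g"
  by (simp add: xp_poly_def pcompose_mult)

lemma xp_poly_0 [simp]: "xp_poly 0 = 0"
  by (simp add: xp_poly_def)

lemma xp_poly_1 [simp]: "xp_poly 1 = 1"
  by (simp add: xp_poly_def pcompose_1)

lemma xp_poly_const [simp]: "xp_poly [:c:] = [:c:]"
  by (simp add: xp_poly_def)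

lemma xp_poly_eq_iff:
  assumes "CHAR('k::field) > 0"
  shows "xp_poly (f :: 'k poly) = xp_poly g \<longleftrightarrow> f = g"
proof
  assume e: "xp_poly f = xp_poly g"
  show "f = g"
  proof (rule poly_eqI)
    fix n
    show "coeff f n = coeff g n"
      using arg_cong[OF e, of "\<lambda>u. coeff u (CHAR('k) * n)"] assms
      by (simp add: coeff_xp_poly[OF assms])
  qed
qed auto

lemma the_inv_xp_poly:
  assumes "CHAR('k::field) > 0"
  shows "the_inv xp_poly (xp_poly (f :: 'k poly)) = f"
  by (rule the_inv_f_f) (auto simp: inj_def xp_poly_eq_iff[OF assms])

lemma xp_poly_the_inv:
  assumes "CHAR('k::field) > 0" "(f :: 'k poly) \<in> xp_ring"
  shows "xp_poly (the_inv xp_poly f) = f"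
  using assms by (auto simp: xp_ring_def the_inv_xp_poly)

lemma xp_ring_0 [simp]: "0 \<in> xp_ring" and xp_ring_1 [simp]: "1 \<in> xp_ring"
  and xp_ring_const [simp]: "[:c:] \<in> xp_ring"
  unfolding xp_ring_def by (metis rangeI xp_poly_0 xp_poly_1 xp_poly_const)+

lemma xp_poly_in_xp_ring [simp]: "xp_poly q \<in> xp_ring"
  by (simp add: xp_ring_def)

lemma xp_ring_add: "f \<in> xp_ring \<Longrightarrow> g \<in> xp_ring \<Longrightarrow> f + g \<in> xp_ring"
  and xp_ring_mult: "f \<in> xp_ring \<Longrightarrow> g \<in> xp_ring \<Longrightarrow> f * g \<in> xp_ring"
  unfolding xp_ring_def by (auto simp: xp_poly_add[symmetric] xp_poly_mult[symmetric])

lemma xp_ring_smult: "f \<in> xp_ring \<Longrightarrow> smult c f \<in> xp_ring"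
  using xp_ring_mult[OF xp_ring_const, of f c] by simp

lemma xp_ring_power: "f \<in> xp_ring \<Longrightarrow> f ^ n \<in> xp_ring"
  by (induction n) (auto simp: xp_ring_mult)

lemma xp_ring_cancel:
  fixes f c :: "'k::field poly"
  assumes "CHAR('k) > 0" "c \<in> xp_ring" "c \<noteq> 0" "c * f \<in> xp_ring"
  shows "f \<in> xp_ring"
  using assms by (auto simp: xp_ring_iff_pderiv pderiv_mult)

lemma xp_dvd_iff:
  fixes a b :: "'k::field poly"
  assumes "CHAR('k) > 0" "a \<in> xp_ring" "b \<in> xp_ring"
  shows "xp_dvd a b \<longleftrightarrow> a dvd b"
proof
  assume "a dvd b"
  then obtain c where c: "b = a * c" by auto
  show "xp_dvd a b"
  proof (cases "a = 0")
    case True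
    then show ?thesis unfolding xp_dvd_def using c by (intro bexI[of _ 0]) auto
  next
    case False
    then have "c \<in> xp_ring" using assms c xp_ring_cancel by blast
    then show ?thesis using c by (auto simp: xp_dvd_def)
  qed
qed (auto simp: xp_dvd_def)

lemma power_char_xp_ring:
  fixes f :: "'k::field poly"
  assumes "CHAR('k) > 0"
  shows "f ^ CHAR('k) \<in> xp_ring"
  using assms by (simp add: xp_ring_iff_pderiv pderiv_power)

section \<open>Bezout identities\<close>

text \<open>A nonzero element of least degree generates, by division with remainder.\<close>

lemma poly_ideal_principal:
  fixes I :: "'k::field poly set"
  assumes "0 \<in> I" and add: "\<And>a b. a \<in> I \<Longrightarrow> b \<in> I \<Longrightarrow> a + b \<in> I"
    and mult: "\<And>a b. a \<in> I \<Longrightarrow> b * a \<in> I"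
  obtains g where "g \<in> I" "\<And>a. a \<in> I \<Longrightarrow> g dvd a"
proof (cases "I = {0}")
  case True
  then show ?thesis using that[of 0] by auto
next
  case False
  then obtain b where "b \<in> I \<and> b \<noteq> 0" using assms(1) by auto
  then obtain g where g: "g \<in> I" "g \<noteq> 0" and min: "\<And>a. a \<in> I \<Longrightarrow> a \<noteq> 0 \<Longrightarrow> degree g \<le> degree a"
    using ex_has_least_nat[of "\<lambda>b. b \<in> I \<and> b \<noteq> 0" b degree] by auto
  have "g dvd a" if a: "a \<in> I" for a
  proof -
    have "a mod g = a + (- (a div g)) * g" by (simp add: minus_div_mult_eq_mod[symmetric])
    then have m: "a mod g \<in> I" using a g add mult by metis
    have "degree (a mod g) < degree g \<or> a mod g = 0" using degree_mod_less[OF g(2), of a] by blast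
    then have "a mod g = 0" using min[OF m] by force
    then show ?thesis by (simp add: dvd_eq_mod_eq_0)
  qed
  then show ?thesis using that g by blast
qed

lemma poly_Bezout_family:
  fixes f :: "'i \<Rightarrow> 'k::field poly"
  assumes "finite S"
  obtains g a where "g = (\<Sum>i\<in>S. a i * f i)" "\<And>i. i \<in> S \<Longrightarrow> g dvd f i"
proof -
  define I where "I = {u. \<exists>a. u = (\<Sum>i\<in>S. a i * f i)}"
  have f: "f j \<in> I" if "j \<in> S" for j
    unfolding I_def mem_Collect_eq using assms that
    by (intro exI[of _ "\<lambda>i. if i = j then 1 else 0"]) (simp add: if_distrib[of "\<lambda>x. x * _"] cong: if_cong)
  have 0: "0 \<in> I" by (auto simp: I_def intro!: exI[of _ "\<lambda>_. 0"])
  have A: "a + b \<in> I" if "a \<in> I" "b \<in> I" for a b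
  proof -
    from that obtain u v where "a = (\<Sum>i\<in>S. u i * f i)" "b = (\<Sum>i\<in>S. v i * f i)" by (auto simp: I_def)
    then have "a + b = (\<Sum>i\<in>S. (u i + v i) * f i)" by (simp add: sum.distrib distrib_right)
    then show ?thesis unfolding I_def by (auto intro!: exI[of _ "\<lambda>i. u i + v i"])
  qed
  have M: "b * a \<in> I" if "a \<in> I" for a b
  proof -
    from that obtain u where "a = (\<Sum>i\<in>S. u i * f i)" by (auto simp: I_def)
    then have "b * a = (\<Sum>i\<in>S. (b * u i) * f i)" by (simp add: sum_distrib_left mult.assoc)
    then show ?thesis unfolding I_def by (auto intro!: exI[of _ "\<lambda>i. b * u i"])
  qed
  obtain g where g: "g \<in> I" "\<And>a. a \<in> I \<Longrightarrow> g dvd a" using poly_ideal_principal[OF 0 A M] by metis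
  then obtain a where "g = (\<Sum>i\<in>S. a i * f i)" by (auto simp: I_def)
  then show ?thesis using that g f by blast
qed

text \<open>Fractions over \<open>\<F>[x\<^sup>p]\<close> can be written in lowest terms with a Bezout identity inside
  \<open>\<F>[x\<^sup>p]\<close>, because this ring is itself a polynomial ring.\<close>

lemma xp_ring_lowest_terms:
  fixes a b :: "'k::field poly"
  assumes "CHAR('k) > 0" "a \<in> xp_ring" "b \<in> xp_ring" "b \<noteq> 0"
  obtains g r s u v where "g \<in> xp_ring" "r \<in> xp_ring" "s \<in> xp_ring" "u \<in> xp_ring" "v \<in> xp_ring"
    "a = g * s" "b = g * r" "u * r + v * s = 1" "g \<noteq> 0"
proof -
  obtain A B where AB: "a = xp_poly A" "b = xp_poly B" using assms by (auto simp: xp_ring_def)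
  obtain g0 c where g0: "g0 = (\<Sum>i\<in>{False,True}. c i * (if i then A else B))"
    "\<And>i. i \<in> {False,True} \<Longrightarrow> g0 dvd (if i then A else B)"
    using poly_Bezout_family[of "{False,True}" "\<lambda>i. if i then A else B"] by blast
  have "g0 dvd A" "g0 dvd B" using g0(2)[of True] g0(2)[of False] by auto
  then obtain S R where SR: "A = g0 * S" "B = g0 * R" by (metis dvdE)
  have B: "B \<noteq> 0" using AB assms(4) by auto
  then have "g0 \<noteq> 0" using SR by auto
  moreover have "g0 * (c False * R + c True * S) = g0 * 1" using g0(1) SR by (simp add: algebra_simps)
  ultimately have bz: "c False * R + c True * S = 1" by (metis mult_left_cancel)
  have "xp_poly (c False) * xp_poly R + xp_poly (c True) * xp_poly S = 1"
    unfolding xp_poly_mult[symmetric] xp_poly_add[symmetric] bz by simp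
  moreover have "xp_poly g0 \<noteq> 0" using \<open>g0 \<noteq> 0\<close> xp_poly_eq_iff[OF assms(1), of g0 0] by simp
  ultimately show ?thesis
    using that[of "xp_poly g0" "xp_poly R" "xp_poly S" "xp_poly (c False)" "xp_poly (c True)"] AB SR
    by (simp add: xp_ring_def xp_poly_mult)
qed

section \<open>The polynomials attached to \<open>h\<close>\<close>

lemma smult_sum_right: "smult c (sum F I) = (\<Sum>i\<in>I. smult c (F i))"
  by (induction I rule: infinite_finite_induct) (simp_all add: smult_add_right)

text \<open>A divisor \<open>r\<close> of maximal degree is divisible by any other one: the least common multiple of
  the two lies in \<open>\<F>[x\<^sup>p]\<close> and still divides \<open>h\<close>, so it cannot have larger degree than \<open>r\<close>.\<close>

lemma rho_exists:
  fixes h :: "'k::field poly"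
  assumes p: "CHAR('k) > 0" and h: "h \<noteq> 0"
  obtains r where "r \<in> xp_ring" "lead_coeff r = 1" "r dvd h"
    "\<And>s. s \<in> xp_ring \<Longrightarrow> s dvd h \<Longrightarrow> s dvd r"
proof -
  define P where "P = (\<lambda>r. r \<in> xp_ring \<and> lead_coeff r = 1 \<and> r dvd h)"
  have "P 1" by (simp add: P_def)
  moreover have "degree r < Suc (degree h)" if "P r" for r
    using that h dvd_imp_degree_le by (auto simp: P_def less_Suc_eq_le)
  ultimately obtain r where r: "P r" and max: "\<And>r'. P r' \<Longrightarrow> degree r' \<le> degree r"
    using ex_has_greatest_nat[of P 1 degree "Suc (degree h)"] by auto
  have "s dvd r" if s: "s \<in> xp_ring" "s dvd h" for s
  proof -
    have s0: "s \<noteq> 0" and r0: "r \<noteq> 0" using s r h by (auto simp: P_def)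
    \<comment> \<open>With \<open>r = g s1\<close> and \<open>s = g r1\<close>, the least common multiple is \<open>r r1\<close>.\<close>
    obtain g r1 s1 u v where g: "g \<in> xp_ring" "r1 \<in> xp_ring" "s1 \<in> xp_ring" "u \<in> xp_ring" "v \<in> xp_ring"
      "r = g * s1" "s = g * r1" "u * r1 + v * s1 = 1" "g \<noteq> 0"
      using xp_ring_lowest_terms[OF p, of r s] s s0 r by (metis P_def)
    obtain m where m: "h = r * m" using r by (auto simp: P_def)
    obtain n where n: "h = s * n" using s by auto
    note mn = m n
    have "h = (u * r1 + v * s1) * h" using g by simp
    also have "\<dots> = u * r1 * (r * m) + v * s1 * (s * n)"
      using mn by (simp add: distrib_right)
    also have "\<dots> = r * r1 * (u * m + v * n)" using g(6,7) by (simp add: algebra_simps)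
    finally have d: "r * r1 dvd h" by (rule dvdI)
    have n0: "r1 \<noteq> 0" using g s0 by auto
    define r' where "r' = smult (inverse (lead_coeff (r * r1))) (r * r1)"
    have "P r'" using d r g n0 r0 unfolding P_def r'_def
      by (auto intro!: xp_ring_smult xp_ring_mult smult_dvd)
    then have "degree (r * r1) \<le> degree r" using max[of r'] n0 r0 by (simp add: r'_def)
    then have "degree r1 = 0" using n0 r0 by (simp add: degree_mult_eq)
    then have "r1 dvd 1" using n0 by (simp add: is_unit_iff_degree)
    then have "r1 dvd s1" using unit_imp_dvd by blast
    then show ?thesis using g by simp
  qed
  then show ?thesis using that r by (auto simp: P_def)
qed

lemma monic_dvd_antisym:
  fixes a b :: "'k::field poly"
  assumes "a dvd b" "lead_coeff a = 1" "lead_coeff b = 1" "degree b \<le> degree a"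
  shows "a = b"
proof -
  from assms(1) obtain c where c: "b = a * c" by auto
  have "a \<noteq> 0" "c \<noteq> 0" using assms c by auto
  then have "degree c = 0" using c assms(4) by (simp add: degree_mult_eq)
  then obtain d where d: "c = [:d:]" by (auto elim: degree_eq_zeroE)
  have "lead_coeff b = lead_coeff a * lead_coeff c" unfolding c by (rule lead_coeff_mult)
  then have "d = 1" using assms d by simp
  then show ?thesis using c d by simp
qed

lemma rho_properties:
  fixes h :: "'k::field poly"
  assumes p: "CHAR('k) > 0" and h: "h \<noteq> 0"
  shows "rho h \<in> xp_ring" "rho h \<noteq> 0" "rho h dvd h"
    "\<And>s. s \<in> xp_ring \<Longrightarrow> s dvd h \<Longrightarrow> s dvd rho h"
proof -
  obtain r where r: "r \<in> xp_ring" "lead_coeff r = 1" "r dvd h"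
    and max: "\<And>s. s \<in> xp_ring \<Longrightarrow> s dvd h \<Longrightarrow> s dvd r"
    using rho_exists[OF assms] by blast
  have r0: "r \<noteq> 0" using r h by auto
  have "rho h = r" unfolding rho_def
  proof (rule the_equality)
    show "r \<in> xp_ring \<and> lead_coeff r = 1 \<and> r dvd h
      \<and> (\<forall>s\<in>xp_ring. lead_coeff s = 1 \<and> s dvd h \<longrightarrow> degree s \<le> degree r)"
      using r max r0 dvd_imp_degree_le by blast
  next
    fix r'
    assume "r' \<in> xp_ring \<and> lead_coeff r' = 1 \<and> r' dvd h
      \<and> (\<forall>s\<in>xp_ring. lead_coeff s = 1 \<and> s dvd h \<longrightarrow> degree s \<le> degree r')"
    then show "r' = r" using r max by (intro monic_dvd_antisym) auto
  qed
  then show "rho h \<in> xp_ring" "rho h \<noteq> 0" "rho h dvd h"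
    "\<And>s. s \<in> xp_ring \<Longrightarrow> s dvd h \<Longrightarrow> s dvd rho h" using r r0 max by auto
qed

lemma power_char_div_rho:
  fixes h :: "'k::field poly"
  assumes p: "CHAR('k) > 0" and h: "h \<noteq> 0"
  shows "rho h * (h ^ CHAR('k) div rho h) = h ^ CHAR('k)" "h ^ CHAR('k) div rho h \<in> xp_ring"
    "h ^ CHAR('k) div rho h \<noteq> 0"
proof -
  have "rho h dvd h ^ CHAR('k)"
    using dvd_trans[OF rho_properties(3)[OF assms], of "h ^ CHAR('k)"] p by (simp add: dvd_power)
  then show e: "rho h * (h ^ CHAR('k) div rho h) = h ^ CHAR('k)" by simp
  then show "h ^ CHAR('k) div rho h \<in> xp_ring"
    using xp_ring_cancel[OF p rho_properties(1,2)[OF assms]] power_char_xp_ring[OF p] by metis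
  show "h ^ CHAR('k) div rho h \<noteq> 0" using e h by (metis mult_zero_right power_not_zero)
qed

text \<open>If \<open>c = h\<^sup>p\<^sup>-\<^sup>1 w\<close>, then \<open>w/h = c/h\<^sup>p\<close> is a fraction over \<open>\<F>[x\<^sup>p]\<close>. Written in lowest terms as
  \<open>s/r\<close>, it satisfies \<open>h s = r w\<close>, so \<open>r\<close> divides \<open>h\<close> and therefore \<open>\<rho>\<close>.\<close>

lemma power_char_div_rho_dvd:
  fixes h :: "'k::field poly"
  assumes p: "CHAR('k) > 0" and h: "h \<noteq> 0" and c: "c \<in> xp_ring" "h ^ (CHAR('k) - 1) dvd c"
  obtains d where "d \<in> xp_ring" "c = (h ^ CHAR('k) div rho h) * d"
proof -
  have hp0: "h ^ CHAR('k) \<noteq> 0" using h by simp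
  obtain w where w: "c = h ^ (CHAR('k) - 1) * w" using c by auto
  obtain g r s u v where g: "g \<in> xp_ring" "r \<in> xp_ring" "s \<in> xp_ring" "u \<in> xp_ring" "v \<in> xp_ring"
      "c = g * s" "h ^ CHAR('k) = g * r" "u * r + v * s = 1" "g \<noteq> 0"
    using xp_ring_lowest_terms[OF p c(1) power_char_xp_ring[OF p, of h] hp0] by metis
  have hp: "h ^ CHAR('k) = h * h ^ (CHAR('k) - 1)" using p by (metis power_minus_mult mult.commute)
  have r0: "r \<noteq> 0" using g hp0 by auto
  have "g * (h * s) = h * c" using g by (simp add: mult_ac)
  also have "\<dots> = g * (r * w)" using w g(7) hp by (simp add: mult_ac)
  finally have hs: "h * s = r * w" using g by simp
  have "h = h * (u * r + v * s)" using g by simp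
  also have "\<dots> = r * (h * u + v * w)" using hs by (simp add: algebra_simps)
  finally have "r dvd h" by (rule dvdI)
  then have "r dvd rho h" using rho_properties[OF p h] g by auto
  then obtain q where q: "rho h = r * q" by auto
  have q': "q \<in> xp_ring" using xp_ring_cancel[OF p g(2) r0, of q] q rho_properties(1)[OF p h] by simp
  have "rho h * c = rho h * ((h ^ CHAR('k) div rho h) * (q * s))"
    by (simp only: mult.assoc[symmetric] power_char_div_rho(1)[OF p h])
      (simp only: g(6,7) q mult_ac)
  then have "c = (h ^ CHAR('k) div rho h) * (q * s)" using rho_properties(2)[OF p h] by simp
  then show ?thesis using that q' g xp_ring_mult by blast
qed

text \<open>The exponents of \<open>c\<^sub>j x\<^sup>j\<close> are congruent to \<open>j\<close> modulo \<open>p\<close>, so different components do not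
  overlap; this gives their uniqueness.\<close>

lemma coeff_xp_component:
  assumes p: "CHAR('k::field) > 0" and c: "\<And>i. i < CHAR('k) \<Longrightarrow> (c i :: 'k poly) \<in> xp_ring"
    and i: "i < CHAR('k)"
  shows "coeff (\<Sum>j<CHAR('k). c j * monom 1 j) (CHAR('k) * n + i) = coeff (c i) (CHAR('k) * n)"
proof -
  have "coeff (c j * monom 1 j) (CHAR('k) * n + i) = (if j = i then coeff (c i) (CHAR('k) * n) else 0)"
    if j: "j < CHAR('k)" for j
  proof -
    obtain q where q: "c j = xp_poly q" using c[OF j] by (auto simp: xp_ring_def)
    have "coeff (c j * monom 1 j) (CHAR('k) * n + i) =
      (if CHAR('k) * n + i < j then 0 else coeff (c j) (CHAR('k) * n + i - j))"
      by (simp add: coeff_monom_mult mult.commute[of _ "monom 1 j"])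
    moreover have "\<not> CHAR('k) dvd (CHAR('k) * n + i - j)" if "j \<noteq> i" "\<not> CHAR('k) * n + i < j"
    proof
      assume "CHAR('k) dvd (CHAR('k) * n + i - j)"
      then obtain m where "CHAR('k) * n + i - j = CHAR('k) * m" by auto
      then have e: "CHAR('k) * n + i = CHAR('k) * m + j" using that by simp
      have "(CHAR('k) * n + i) mod CHAR('k) = i" "(CHAR('k) * m + j) mod CHAR('k) = j"
        using i \<open>j < CHAR('k)\<close> by simp_all
      then show False using e that by simp
    qed
    ultimately show ?thesis by (auto simp: q coeff_xp_poly[OF p])
  qed
  then have "coeff (\<Sum>j<CHAR('k). c j * monom 1 j) (CHAR('k) * n + i) =
    (\<Sum>j<CHAR('k). if j = i then coeff (c i) (CHAR('k) * n) else 0)"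
    by (simp add: coeff_sum)
  then show ?thesis using i by simp
qed

lemma xp_components_exist:
  assumes p: "CHAR('k::field) > 0"
  shows "\<exists>c. (\<forall>i. c i \<in> xp_ring) \<and> (f :: 'k poly) = (\<Sum>i<CHAR('k). c i * monom 1 i)"
proof (induction f)
  case 0
  show ?case by (intro exI[of _ "\<lambda>_. 0"]) simp
next
  case (pCons a f)
  then obtain c where c: "\<forall>i. c i \<in> xp_ring" "f = (\<Sum>i<CHAR('k). c i * monom 1 i)" by blast
  obtain n where n: "CHAR('k) = Suc n" using p by (cases "CHAR('k)") auto
  \<comment> \<open>Multiplication by \<open>x\<close> shifts the components cyclically; the last one returns with a factor \<open>x\<^sup>p\<close>.\<close>
  define c' where "c' = (\<lambda>i. case i of 0 \<Rightarrow> [:a:] + monom 1 CHAR('k) * c n | Suc j \<Rightarrow> c j)"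
  have m: "monom 1 CHAR('k) \<in> (xp_ring :: 'k poly set)"
    using power_char_xp_ring[OF p, of "monom 1 1"] by (simp add: monom_power)
  have "pCons a f = [:a:] + monom 1 1 * f" by (simp add: monom_altdef)
  also have "monom 1 1 * f = (\<Sum>i<Suc n. c i * monom 1 (Suc i))"
    by (simp only: c n sum_distrib_left) (simp only: mult.left_commute mult_monom plus_1_eq_Suc mult_1)
  also have "[:a:] + \<dots> = (\<Sum>i<CHAR('k). c' i * monom 1 i)"
    unfolding n sum.lessThan_Suc_shift[of "\<lambda>i. c' i * monom 1 i"] sum.lessThan_Suc
    by (simp add: c'_def n monom_0 mult.commute add_ac flip: one_pCons)
  finally have "pCons a f = (\<Sum>i<CHAR('k). c' i * monom 1 i)" .
  moreover have "\<forall>i. c' i \<in> xp_ring"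
    using c m by (auto simp: c'_def split: nat.splits intro!: xp_ring_add xp_ring_mult)
  ultimately show ?case by blast
qed

lemma hcomp_properties:
  fixes h :: "'k::field poly"
  assumes p: "CHAR('k) > 0"
  shows "\<And>i. hcomp h i \<in> xp_ring" "h ^ (CHAR('k) - 1) = (\<Sum>i<CHAR('k). hcomp h i * monom 1 i)"
proof -
  obtain c where c: "\<forall>i. c i \<in> xp_ring" "h ^ (CHAR('k) - 1) = (\<Sum>i<CHAR('k). c i * monom 1 i)"
    using xp_components_exist[OF p] by blast
  let ?c = "\<lambda>i. if i < CHAR('k) then c i else 0"
  have "hcomp h = ?c" unfolding hcomp_def
  proof (rule the_equality)
    show "(\<forall>i<CHAR('k). ?c i \<in> xp_ring) \<and> (\<forall>i\<ge>CHAR('k). ?c i = 0)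
      \<and> h ^ (CHAR('k) - 1) = (\<Sum>i<CHAR('k). ?c i * monom 1 i)"
      using c by auto
  next
    fix d
    assume d: "(\<forall>i<CHAR('k). d i \<in> xp_ring) \<and> (\<forall>i\<ge>CHAR('k). d i = 0)
      \<and> h ^ (CHAR('k) - 1) = (\<Sum>i<CHAR('k). d i * monom 1 i)"
    have "d i = c i" if i: "i < CHAR('k)" for i
    proof (rule poly_eqI)
      fix n
      have e: "coeff (d i) (CHAR('k) * m) = coeff (c i) (CHAR('k) * m)" for m
        using coeff_xp_component[OF p, of d i m] coeff_xp_component[OF p, of c i m] c d i by simp
      obtain q q' where "d i = xp_poly q" "c i = xp_poly q'" using c d i by (auto simp: xp_ring_def) blast
      then show "coeff (d i) n = coeff (c i) n"
        using e[of "n div CHAR('k)"] p by (auto simp: coeff_xp_poly[OF p])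
    qed
    then show "d = ?c" using d by (auto simp: fun_eq_iff)
  qed
  then show "\<And>i. hcomp h i \<in> xp_ring" "h ^ (CHAR('k) - 1) = (\<Sum>i<CHAR('k). hcomp h i * monom 1 i)"
    using c by auto
qed

text \<open>The greatest common divisor is built from a Bezout identity among the preimages of the components
  under the isomorphism \<open>\<F>[t] \<rightarrow> \<F>[x\<^sup>p]\<close>, which also makes it a combination of the components.\<close>

lemma hbar_properties:
  fixes h :: "'k::field poly"
  assumes p: "CHAR('k) > 0" and h: "h \<noteq> 0"
  shows "hbar h \<in> xp_ring" "hbar h \<noteq> 0" "\<And>i. i < CHAR('k) \<Longrightarrow> hbar h dvd hcomp h i"
    "\<exists>a. (\<forall>i. a i \<in> xp_ring) \<and> hbar h = (\<Sum>i<CHAR('k). a i * hcomp h i)"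
proof -
  define q where "q = (\<lambda>i. the_inv xp_poly (hcomp h i))"
  have q: "hcomp h i = xp_poly (q i)" for i
    using hcomp_properties(1)[OF p] by (simp add: q_def xp_poly_the_inv[OF p])
  obtain g0 a where g0: "g0 = (\<Sum>i<CHAR('k). a i * q i)" "\<And>i. i < CHAR('k) \<Longrightarrow> g0 dvd q i"
    using poly_Bezout_family[of "{..<CHAR('k)}" q] by auto
  have "g0 \<noteq> 0"
  proof
    assume "g0 = 0"
    then have "hcomp h i = 0" if "i < CHAR('k)" for i using g0(2)[OF that] q[of i] by auto
    then show False using hcomp_properties(2)[OF p, of h] h by simp
  qed
  then have n0: "xp_poly g0 \<noteq> 0" using xp_poly_eq_iff[OF p, of g0 0] by simp
  define d where "d = inverse (lead_coeff (xp_poly g0))"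
  have d0: "d \<noteq> 0" using n0 by (simp add: d_def)
  define g where "g = smult d (xp_poly g0)"
  have g: "g \<in> xp_ring" "lead_coeff g = 1" "g \<noteq> 0"
    using n0 d0 xp_ring_smult[of "xp_poly g0" d] by (auto simp: g_def d_def)
  have gd: "g dvd hcomp h i" if i: "i < CHAR('k)" for i
  proof -
    obtain e where "q i = g0 * e" using g0(2)[OF i] by auto
    then have "xp_poly g0 dvd hcomp h i" using q by (simp add: xp_poly_mult)
    then show ?thesis using d0 by (simp add: g_def smult_dvd)
  qed
  have "xp_poly (\<Sum>i<CHAR('k). a i * q i) = (\<Sum>i<CHAR('k). xp_poly (a i * q i))"
    by (simp add: xp_poly_def pcompose_sum)
  then have gs: "g = (\<Sum>i<CHAR('k). (smult d (xp_poly (a i))) * hcomp h i)"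
    by (simp add: g_def g0(1) q xp_poly_mult smult_sum_right)
  have gB: "e dvd g" if "\<forall>i<CHAR('k). e dvd hcomp h i" for e
    unfolding gs using that by (intro dvd_sum dvd_mult) auto
  have "hbar h = g" unfolding hbar_def
  proof (rule the_equality)
    show "g \<in> xp_ring \<and> lead_coeff g = 1 \<and> (\<forall>i<CHAR('k). xp_dvd g (hcomp h i))
     \<and> (\<forall>d\<in>xp_ring. (\<forall>i<CHAR('k). xp_dvd d (hcomp h i)) \<longrightarrow> xp_dvd d g)"
      using g gd gB by (simp add: xp_dvd_iff[OF p] hcomp_properties[OF p])
  next
    fix g'
    assume a: "g' \<in> xp_ring \<and> lead_coeff g' = 1 \<and> (\<forall>i<CHAR('k). xp_dvd g' (hcomp h i))
     \<and> (\<forall>d\<in>xp_ring. (\<forall>i<CHAR('k). xp_dvd d (hcomp h i)) \<longrightarrow> xp_dvd d g')"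
    then have "xp_dvd g g'" using g gd by (auto simp: xp_dvd_iff[OF p] hcomp_properties[OF p])
    then have "g dvd g'" by (auto simp: xp_dvd_def)
    moreover have "g' dvd g" using a by (intro gB) (auto simp: xp_dvd_def)
    ultimately show "g' = g" using a g dvd_imp_degree_le[of g g'] by (intro monic_dvd_antisym) auto
  qed
  then show "hbar h \<in> xp_ring" "hbar h \<noteq> 0" "\<And>i. i < CHAR('k) \<Longrightarrow> hbar h dvd hcomp h i"
    "\<exists>a. (\<forall>i. a i \<in> xp_ring) \<and> hbar h = (\<Sum>i<CHAR('k). a i * hcomp h i)"
    using g gd gs by (auto intro!: exI[of _ "\<lambda>i. smult d (xp_poly (a i))"] xp_ring_smult)
qed

lemma rho_hbar_dvd:
  fixes h :: "'k::field poly"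
  assumes p: "CHAR('k) > 0" and h: "h \<noteq> 0"
  shows "rho h * hbar h dvd h ^ CHAR('k)"
proof -
  have "hbar h dvd h ^ (CHAR('k) - 1)"
    unfolding hcomp_properties(2)[OF p, of h]
    by (intro dvd_sum dvd_mult2) (use hbar_properties(3)[OF assms] in auto)
  then have "rho h * hbar h dvd h * h ^ (CHAR('k) - 1)"
    by (intro mult_dvd_mono rho_properties(3)[OF assms])
  then show ?thesis using p by (metis power_minus_mult mult.commute)
qed

section \<open>The derivative of order one less than the characteristic\<close>

text \<open>The coefficients of a \<open>p\<close>-th derivative carry products of \<open>p\<close> consecutive integers, which are
  divisible by \<open>p\<close>.\<close>

lemma higher_pderiv_char:
  fixes f :: "'k::field poly"
  assumes p: "CHAR('k) > 0"
  shows "(pderiv ^^ CHAR('k)) f = 0"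
proof (rule poly_eqI)
  fix n
  have "CHAR('k) dvd fact CHAR('k)" using p by (simp add: dvd_fact)
  also have "(fact CHAR('k) :: nat) dvd pochhammer (Suc n) CHAR('k)"
    using fact_dvd_pochhammer[of "CHAR('k)" "int (Suc n)"]
    by (metis of_nat_fact pochhammer_of_nat of_nat_dvd_iff)
  finally have "of_nat (pochhammer (Suc n) CHAR('k)) = (0::'k)"
    by (simp only: of_nat_eq_0_iff_char_dvd)
  then show "coeff ((pderiv ^^ CHAR('k)) f) n = coeff 0 n"
    by (simp add: coeff_higher_pderiv pochhammer_of_nat[symmetric] del: of_nat_Suc)
qed

lemma higher_pderiv_xp_mult:
  fixes c f :: "'k::field poly"
  assumes p: "CHAR('k) > 0" and c: "c \<in> xp_ring"
  shows "(pderiv ^^ n) (c * f) = c * (pderiv ^^ n) f"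
proof (induction n)
  case (Suc n)
  then show ?case using c by (simp add: pderiv_mult xp_ring_iff_pderiv[OF p])
qed simp

text \<open>On the basis \<open>1, x, \<dots>, x\<^sup>p\<^sup>-\<^sup>1\<close> of \<open>\<F>[x]\<close> over \<open>\<F>[x\<^sup>p]\<close> this operator kills everything but
  \<open>x\<^sup>p\<^sup>-\<^sup>1\<close>, which it sends to \<open>(p-1)!\<close>. Up to that scalar and a
  Frobenius twist it is the Cartier operator.\<close>

definition top_deriv :: "'k::field poly \<Rightarrow> 'k poly" where
  "top_deriv = pderiv ^^ (CHAR('k) - 1)"

lemma top_deriv_smult: "top_deriv (smult c f) = smult c (top_deriv f)"
  and top_deriv_add: "top_deriv (f + g) = top_deriv f + top_deriv g"
  and top_deriv_sum: "top_deriv (sum F I) = (\<Sum>i\<in>I. top_deriv (F i))"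
  by (simp_all add: top_deriv_def higher_pderiv_smult higher_pderiv_add higher_pderiv_sum)

lemma top_deriv_xp_mult:
  fixes c f :: "'k::field poly"
  assumes p: "CHAR('k) > 0" and c: "c \<in> xp_ring"
  shows "top_deriv (c * f) = c * top_deriv f"
  by (simp only: top_deriv_def higher_pderiv_xp_mult[OF assms])

lemma top_deriv_pderiv:
  fixes f :: "'k::field poly"
  assumes p: "CHAR('k) > 0"
  shows "pderiv (top_deriv f) = 0" "top_deriv (pderiv f) = 0"
proof -
  obtain n where n: "CHAR('k) = Suc n" using p by (cases "CHAR('k)") auto
  show "pderiv (top_deriv f) = 0" using higher_pderiv_char[OF p, of f] by (simp add: n top_deriv_def)
  show "top_deriv (pderiv f) = 0" using higher_pderiv_char[OF p, of f] by (simp add: n funpow_swap1 top_deriv_def)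
qed

lemma top_deriv_xp_ring:
  fixes f :: "'k::field poly"
  assumes p: "CHAR('k) > 0"
  shows "top_deriv f \<in> xp_ring"
  by (simp add: xp_ring_iff_pderiv[OF p] top_deriv_pderiv(1)[OF p])

lemma top_deriv_low_degree:
  fixes f :: "'k::field poly"
  assumes "degree f < CHAR('k) - 1"
  shows "top_deriv f = 0"
  using assms by (intro poly_eqI) (simp add: top_deriv_def coeff_higher_pderiv coeff_eq_0)

lemma top_deriv_monom:
  assumes p: "CHAR('k::field) > 0"
  shows "top_deriv (monom 1 (CHAR('k) - 1)) = [:of_nat (fact (CHAR('k) - 1)) :: 'k:]"
proof (rule poly_eqI)
  fix n
  show "coeff (top_deriv (monom 1 (CHAR('k) - 1))) n = coeff [:of_nat (fact (CHAR('k) - 1)) :: 'k:] n"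
    using pochhammer_of_nat[where 'a='k, of 1 "CHAR('k) - 1"]
    by (cases n) (auto simp: top_deriv_def coeff_higher_pderiv pochhammer_fact)
qed

lemma of_nat_fact_neq_0:
  assumes p: "CHAR('k::field) > 0"
  shows "of_nat (fact (CHAR('k) - 1)) \<noteq> (0 :: 'k)"
proof -
  have "prime CHAR('k)" using p by (rule prime_CHAR_semidom)
  then have "\<not> CHAR('k) dvd (fact (CHAR('k) - 1) :: nat)" using p by (simp add: prime_dvd_fact_iff)
  then show ?thesis by (simp only: of_nat_eq_0_iff_char_dvd not_False_eq_True)
qed

text \<open>The operator is \<open>\<F>[x\<^sup>p]\<close>-linear, so it maps \<open>h\<^sup>p\<^sup>-\<^sup>1 g\<close> to a combination of the components of
  \<open>h\<^sup>p\<^sup>-\<^sup>1\<close> with coefficients in \<open>\<F>[x\<^sup>p]\<close>.\<close>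

lemma hbar_dvd_top_deriv:
  fixes h g :: "'k::field poly"
  assumes p: "CHAR('k) > 0" and h: "h \<noteq> 0"
  obtains c where "c \<in> xp_ring" "top_deriv (h ^ (CHAR('k) - 1) * g) = hbar h * c"
proof -
  have "top_deriv (h ^ (CHAR('k) - 1) * g) = (\<Sum>i<CHAR('k). hcomp h i * top_deriv (monom 1 i * g))"
    by (simp only: hcomp_properties(2)[OF p, of h] sum_distrib_right top_deriv_sum mult.assoc
        top_deriv_xp_mult[OF p hcomp_properties(1)[OF p]])
  then have d: "hbar h dvd top_deriv (h ^ (CHAR('k) - 1) * g)"
    using hbar_properties(3)[OF assms] by (auto intro!: dvd_sum dvd_mult2)
  then have "xp_dvd (hbar h) (top_deriv (h ^ (CHAR('k) - 1) * g))"
    using xp_dvd_iff[OF p hbar_properties(1)[OF assms] top_deriv_xp_ring[OF p]] by blast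
  then show ?thesis using that by (auto simp: xp_dvd_def)
qed

text \<open>Multiplication by \<open>x\<^sup>p\<^sup>-\<^sup>1\<^sup>-\<^sup>i\<close> moves the \<open>i\<close>-th component of \<open>h\<^sup>p\<^sup>-\<^sup>1\<close> to the position \<open>x\<^sup>p\<^sup>-\<^sup>1\<close>, where
  the operator sees it. A Bezout identity for \<open>hbar\<close> therefore prescribes \<open>g\<close>.\<close>

lemma hbar_eq_top_deriv:
  fixes h :: "'k::field poly"
  assumes p: "CHAR('k) > 0" and h: "h \<noteq> 0"
  obtains g where "top_deriv (h ^ (CHAR('k) - 1) * g) = hbar h"
proof -
  obtain a where a: "\<And>i. a i \<in> xp_ring" "hbar h = (\<Sum>i<CHAR('k). a i * hcomp h i)"
    using hbar_properties(4)[OF assms] by auto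
  define w where "w = inverse (of_nat (fact (CHAR('k) - 1)) :: 'k)"
  have w: "w * of_nat (fact (CHAR('k) - 1)) = 1" using of_nat_fact_neq_0[OF p] by (simp add: w_def)
  define g where "g = smult w (\<Sum>i<CHAR('k). a i * monom 1 (CHAR('k) - 1 - i))"
  have M: "top_deriv (monom 1 j * monom 1 (CHAR('k) - 1 - i)) =
      (if j = i then [:of_nat (fact (CHAR('k) - 1)) :: 'k:] else 0)"
    if ij: "i < CHAR('k)" "j < CHAR('k)" for i j
  proof -
    consider "j = i" | "j < i" | "i < j" by linarith
    then show ?thesis
    proof cases
      case 1
      then show ?thesis using ij top_deriv_monom[OF p] by (simp add: mult_monom)
    next
      case 2
      have "top_deriv (monom (1::'k) (j + (CHAR('k) - 1 - i))) = 0"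
        by (rule top_deriv_low_degree) (use 2 ij in \<open>simp add: degree_monom_eq\<close>)
      then show ?thesis using 2 by (simp add: mult_monom)
    next
      case 3
      have m: "monom 1 CHAR('k) \<in> (xp_ring :: 'k poly set)"
        using power_char_xp_ring[OF p, of "monom 1 1"] by (simp add: monom_power)
      have "j + (CHAR('k) - 1 - i) = CHAR('k) + (j - i - 1)" using 3 ij by simp
      then have "monom (1::'k) j * monom 1 (CHAR('k) - 1 - i) = monom 1 CHAR('k) * monom 1 (j - i - 1)"
        by (simp add: mult_monom)
      moreover have "top_deriv (monom (1::'k) (j - i - 1)) = 0"
        by (rule top_deriv_low_degree) (use 3 ij in \<open>simp add: degree_monom_eq\<close>)
      ultimately show ?thesis using 3 top_deriv_xp_mult[OF p m] by simp
    qed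
  qed
  have "top_deriv (h ^ (CHAR('k) - 1) * g) =
    smult w (\<Sum>j<CHAR('k). \<Sum>i<CHAR('k). hcomp h j * (a i * top_deriv (monom 1 j * monom 1 (CHAR('k) - 1 - i))))"
  proof -
    have "h ^ (CHAR('k) - 1) * g =
      smult w (\<Sum>j<CHAR('k). \<Sum>i<CHAR('k). hcomp h j * (a i * (monom 1 j * monom 1 (CHAR('k) - 1 - i))))"
      by (simp only: hcomp_properties(2)[OF p, of h] g_def mult_smult_right sum_product)
        (simp only: mult_ac)
    then show ?thesis
      by (simp only: top_deriv_smult top_deriv_sum
         top_deriv_xp_mult[OF p hcomp_properties(1)[OF p]] top_deriv_xp_mult[OF p a(1)])
  qed
  also have "\<dots> = smult w (\<Sum>j<CHAR('k). hcomp h j * (a j * [:of_nat (fact (CHAR('k) - 1)):]))"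
  proof -
    have "(\<Sum>i<CHAR('k). hcomp h j * (a i * top_deriv (monom 1 j * monom 1 (CHAR('k) - 1 - i)))) =
      hcomp h j * (a j * [:of_nat (fact (CHAR('k) - 1)):])" if j: "j < CHAR('k)" for j
    proof -
      have "(\<Sum>i<CHAR('k). hcomp h j * (a i * top_deriv (monom 1 j * monom 1 (CHAR('k) - 1 - i)))) =
        (\<Sum>i<CHAR('k). if i = j then hcomp h j * (a j * [:of_nat (fact (CHAR('k) - 1)):]) else 0)"
        by (intro sum.cong refl) (use j in \<open>auto simp only: M lessThan_iff mult_zero_right split: if_split\<close>)
      then show ?thesis using j by simp
    qed
    then show ?thesis by simp
  qed
  also have "\<dots> = hbar h"
    by (simp only: a(2) smult_sum_right) (simp add: w[unfolded One_nat_def] mult.commute)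
  finally show ?thesis using that by blast
qed

text \<open>A form of the logarithmic derivative identity \<open>(d/dx)\<^sup>p\<^sup>-\<^sup>1(f'/f) = (p-1)! (f'/f)\<^sup>p\<close>. Clearing
  denominators, both sides satisfy the product rule \<open>\<Phi>(f g) = f\<^sup>p \<Phi>(g) + g\<^sup>p \<Phi>(f)\<close>, which allows
  multiplication by \<open>x\<close>; and neither changes when a constant \<open>c\<close> is added to \<open>f\<close>, because
  \<open>(f + c)\<^sup>p\<^sup>-\<^sup>1 f'\<close> and \<open>f\<^sup>p\<^sup>-\<^sup>1 f'\<close> differ by a derivative. So one can build \<open>f\<close> coefficient by
  coefficient.\<close>

lemma top_deriv_log:
  fixes f :: "'k::field poly"
  assumes p: "CHAR('k) > 0"
  shows "top_deriv (f ^ (CHAR('k) - 1) * pderiv f) = smult (of_nat (fact (CHAR('k) - 1))) (pderiv f ^ CHAR('k))"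
proof (induction f)
  case 0
  then show ?case using p by (simp add: top_deriv_def)
next
  case (pCons a f)
  let ?w = "of_nat (fact (CHAR('k) - 1)) :: 'k"
  let ?x = "monom 1 1 :: 'k poly"
  let ?p = "CHAR('k)"
  define u where "u = ?x * f"
  obtain n where n: "?p = Suc n" using p by (cases "?p") auto
  have du: "pderiv u = f + ?x * pderiv f"
    by (simp add: u_def pderiv_mult pderiv_monom monom_0 add.commute flip: one_pCons)
  have "u ^ n * pderiv u = f ^ ?p * (?x ^ n) + ?x ^ ?p * (f ^ n * pderiv f)"
    unfolding du by (simp add: u_def n power_mult_distrib distrib_left distrib_right mult_ac)
  then have "top_deriv (u ^ n * pderiv u) = f ^ ?p * top_deriv (?x ^ n) + ?x ^ ?p * top_deriv (f ^ n * pderiv f)"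
    by (simp only: top_deriv_add top_deriv_xp_mult[OF p power_char_xp_ring[OF p]])
  also have "top_deriv (?x ^ n) = [:?w:]" using top_deriv_monom[OF p] by (simp add: n monom_power)
  also have "top_deriv (f ^ n * pderiv f) = smult ?w (pderiv f ^ ?p)" using pCons.IH by (simp add: n)
  also have "f ^ ?p * [:?w:] + ?x ^ ?p * smult ?w (pderiv f ^ ?p) = smult ?w (f ^ ?p + (?x * pderiv f) ^ ?p)"
    by (simp add: power_mult_distrib smult_add_right mult.commute)
  also have "f ^ ?p + (?x * pderiv f) ^ ?p = pderiv u ^ ?p"
    unfolding du by (rule freshmans_dream[symmetric]) (use prime_CHAR_semidom[where 'a="'k poly"] p in auto)
  finally have U: "top_deriv (u ^ n * pderiv u) = smult ?w (pderiv u ^ ?p)" .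
  have e: "pCons a f = u + [:a:]" by (simp add: u_def monom_altdef)
  \<comment> \<open>The terms below the top of the binomial expansion are derivatives.\<close>
  have low: "top_deriv (of_nat (n choose k) * u ^ k * [:a:] ^ (n - k) * pderiv u) = 0" if "k < n" for k
  proof -
    have k: "of_nat (Suc k) \<noteq> (0::'k)"
      using that n by (auto simp only: of_nat_eq_0_iff_char_dvd dest: dvd_imp_le)
    define c where "c = (of_nat (n choose k) * a ^ (n - k)) / of_nat (Suc k)"
    have "of_nat (n choose k) * u ^ k * [:a:] ^ (n - k) * pderiv u = pderiv (smult c (u ^ Suc k))"
      unfolding pderiv_smult pderiv_power_Suc
      by (simp add: c_def poly_const_pow of_nat_poly mult_ac k del: of_nat_Suc)
    then show ?thesis using top_deriv_pderiv(2)[OF p] by simp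
  qed
  have "(u + [:a:]) ^ n * pderiv u = (\<Sum>k\<le>n. of_nat (n choose k) * u ^ k * [:a:] ^ (n - k) * pderiv u)"
    by (simp add: binomial_ring sum_distrib_right)
  then have "top_deriv ((u + [:a:]) ^ n * pderiv u) =
    (\<Sum>k\<le>n. top_deriv (of_nat (n choose k) * u ^ k * [:a:] ^ (n - k) * pderiv u))"
    by (simp only: top_deriv_sum)
  also have "\<dots> = top_deriv (u ^ n * pderiv u)"
    using low by (simp add: lessThan_Suc_atMost[symmetric])
  finally show ?case using U by (simp add: e n pderiv_add)
qed

section \<open>Modules over the Weyl algebra\<close>

text \<open>A representation of the defining relation by linear operators extends to an action of the Weyl
  algebra. It is used for the action on \<open>\<F>[x,y]\<close> that yields normal forms, and for the action on
  \<open>A\<^sub>1 \<times> A\<^sub>1\<close> that yields derivations.\<close>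

locale weyl_module =
  fixes sc :: "'k::field \<Rightarrow> 'v::ab_group_add \<Rightarrow> 'v" and X Y :: "'v \<Rightarrow> 'v"
  assumes sc_add_left: "sc (c + d) v = sc c v + sc d v"
    and sc_add_right: "sc c (u + v) = sc c u + sc c v"
    and sc_mult: "sc (c * d) v = sc c (sc d v)"
    and sc_one: "sc 1 v = v"
    and X_add: "X (u + v) = X u + X v" and X_sc: "X (sc c v) = sc c (X v)"
    and Y_add: "Y (u + v) = Y u + Y v" and Y_sc: "Y (sc c v) = sc c (Y v)"
    and YX: "Y (X v) = X (Y v) + v"
begin

definition gen_map :: "gen \<Rightarrow> 'v \<Rightarrow> 'v" where
  "gen_map g = (case g of GX \<Rightarrow> X | GY \<Rightarrow> Y)"

definition free_lin :: "'k free_alg \<Rightarrow> 'v \<Rightarrow> 'v" where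
  "free_lin a v = (\<Sum>w\<in>Poly_Mapping.keys a.
     sc (Poly_Mapping.lookup a w) (foldr gen_map (letters w) v))"

lemma sc_zero_left [simp]: "sc 0 v = 0"
  using sc_add_left[of 0 0 v] by simp

lemma sc_zero_right [simp]: "sc c 0 = 0"
  using sc_add_right[of c 0 0] by simp

lemma word_add: "foldr gen_map ws (u + v) = foldr gen_map ws u + foldr gen_map ws v"
  by (induction ws) (auto simp: gen_map_def X_add Y_add split: gen.splits)

lemma word_sc: "foldr gen_map ws (sc c v) = sc c (foldr gen_map ws v)"
  by (induction ws) (auto simp: gen_map_def X_sc Y_sc split: gen.splits)

lemma free_lin_superset:
  assumes "finite S" "Poly_Mapping.keys a \<subseteq> S"
  shows "free_lin a v = (\<Sum>w\<in>S. sc (Poly_Mapping.lookup a w) (foldr gen_map (letters w) v))"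
  unfolding free_lin_def using assms
  by (intro sum.mono_neutral_left) (auto simp: in_keys_iff)

lemma free_lin_add: "free_lin (a + b) v = free_lin a v + free_lin b v"
proof -
  define S where "S = Poly_Mapping.keys a \<union> Poly_Mapping.keys b"
  have "finite S" "Poly_Mapping.keys a \<subseteq> S" "Poly_Mapping.keys b \<subseteq> S"
       "Poly_Mapping.keys (a + b) \<subseteq> S"
    using Poly_Mapping.keys_add[of a b] by (auto simp: S_def)
  then show ?thesis
    by (simp add: free_lin_superset lookup_add sc_add_left sum.distrib)
qed

lemma free_lin_zero [simp]: "free_lin 0 v = 0"
  by (simp add: free_lin_def)

lemma free_lin_diff: "free_lin (a - b) v = free_lin a v - free_lin b v"
  using free_lin_add[of "a - b" b v] by (simp add: algebra_simps)

lemma free_lin_single: "free_lin (Poly_Mapping.single w c) v = sc c (foldr gen_map (letters w) v)"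
  by (cases "c = 0") (auto simp: free_lin_def)

lemma free_lin_arg_add: "free_lin a (u + v) = free_lin a u + free_lin a v"
  by (simp add: free_lin_def word_add sc_add_right sum.distrib)

lemma free_lin_arg_zero [simp]: "free_lin a 0 = 0"
  using free_lin_arg_add[of a 0 0] by simp

lemma free_lin_mult: "free_lin (a * b) v = free_lin a (free_lin b v)"
proof (induction a rule: free_alg_induct)
  case (single w c)
  show ?case
    by (induction b rule: free_alg_induct)
      (simp_all add: distrib_left free_lin_add free_lin_arg_add mult_single free_lin_single plus_word_def
         sc_mult word_sc)
qed (simp_all add: distrib_right free_lin_add)

lemma free_lin_one: "free_lin 1 v = v"
proof -
  have "letters 0 = []" by (simp add: zero_word_def)
  then show ?thesis using free_lin_single[of 0 1 v] by (simp add: sc_one)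
qed

lemma free_lin_weyl_ideal:
  assumes "a \<in> weyl_ideal"
  shows "free_lin a v = 0"
proof -
  define J where "J = {a. \<forall>v. free_lin a v = 0}"
  have "two_sided_ideal J"
    by (auto simp: two_sided_ideal_def J_def free_lin_add free_lin_mult)
  moreover have "free_lin 1 v = v" for v
    by (rule free_lin_one)
  then have "free_gen GY * free_gen GX - free_gen GX * free_gen GY - 1 \<in> J"
    by (auto simp: J_def free_gen_def free_lin_diff free_lin_mult free_lin_single gen_map_def YX sc_one)
  ultimately have "weyl_ideal \<subseteq> J"
    unfolding weyl_ideal_def by (intro hull_minimal) auto
  then show ?thesis using assms by (auto simp: J_def)
qed

definition act :: "'k weyl \<Rightarrow> 'v \<Rightarrow> 'v" where
  "act a = free_lin (rep_weyl a)"

lemma act_abs: "act (abs_weyl a) = free_lin a"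
proof
  fix v
  have "weyl_rel (rep_weyl (abs_weyl a)) a"
    using Quotient3_weyl by (metis Quotient3_rep_abs weyl_rel_refl)
  then have "free_lin (rep_weyl (abs_weyl a) - a) v = 0"
    by (intro free_lin_weyl_ideal) (simp add: weyl_rel_def)
  then show "act (abs_weyl a) v = free_lin a v" by (simp add: act_def free_lin_diff)
qed

lemma act_add: "act (a + b) v = act a v + act b v"
proof (induction a rule: weyl.abs_induct; induction b rule: weyl.abs_induct)
  fix a b :: "'k free_alg"
  show "act (abs_weyl a + abs_weyl b) v = act (abs_weyl a) v + act (abs_weyl b) v"
    by (simp add: plus_weyl.abs_eq act_abs free_lin_add)
qed

lemma act_mult: "act (a * b) v = act a (act b v)"
proof (induction a rule: weyl.abs_induct; induction b rule: weyl.abs_induct)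
  fix a b :: "'k free_alg"
  show "act (abs_weyl a * abs_weyl b) v = act (abs_weyl a) (act (abs_weyl b) v)"
    by (simp add: times_weyl.abs_eq act_abs free_lin_mult)
qed

lemma act_const: "act (weyl_const c) v = sc c v"
  unfolding weyl_const.abs_eq act_abs free_lin_single by (simp add: zero_word_def)

lemma act_x: "act weyl_x v = X v"
  unfolding weyl_x.abs_eq act_abs free_lin_single free_gen_def by (simp add: gen_map_def sc_one)

lemma act_y: "act weyl_y v = Y v"
  unfolding weyl_y.abs_eq act_abs free_lin_single free_gen_def by (simp add: gen_map_def sc_one)

lemma act_one: "act 1 v = v"
  unfolding one_weyl.abs_eq act_abs by (rule free_lin_one)

end

lemma weyl_const_add: "weyl_const (c + d) = weyl_const c + weyl_const d"
  by transfer (simp add: single_add weyl_rel_refl)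

lemma weyl_const_mult: "weyl_const (c * d) = weyl_const c * weyl_const d"
  by transfer (simp add: mult_single weyl_rel_refl)

lemma weyl_const_1 [simp]: "weyl_const 1 = 1"
  by transfer (simp add: weyl_rel_refl)

lemma weyl_const_0 [simp]: "weyl_const 0 = 0"
  by transfer (simp add: weyl_rel_refl)

lemma weyl_const_commute: "weyl_const c * a = a * weyl_const c"
proof -
  have "Poly_Mapping.single 0 c * b = b * Poly_Mapping.single 0 c" for b :: "'a free_alg"
    by (induction b rule: free_alg_induct)
      (simp_all add: mult_single distrib_left distrib_right mult.commute)
  then show ?thesis by transfer (rule weyl_rel_refl)
qed

lemma weyl_induct [case_names one const x y add]:
  fixes a :: "'k::field weyl"
  assumes one: "P 1" and c: "\<And>c a. P a \<Longrightarrow> P (weyl_const c * a)"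
    and x: "\<And>a. P a \<Longrightarrow> P (weyl_x * a)" and y: "\<And>a. P a \<Longrightarrow> P (weyl_y * a)"
    and add: "\<And>a b. P a \<Longrightarrow> P b \<Longrightarrow> P (a + b)"
  shows "P a"
proof (induction a rule: weyl.abs_induct)
  fix a :: "'k free_alg"
  show "P (abs_weyl a)"
  proof (induction a rule: free_alg_induct)
    case zero
    have "P (weyl_const 0 * 1)" using one c by blast
    then show ?case by (simp add: zero_weyl.abs_eq[symmetric])
  next
    case (add a b)
    then show ?case using assms(5) by (simp add: plus_weyl.abs_eq[symmetric])
  next
    case (single w c)
    have "P (abs_weyl (Poly_Mapping.single (Wd ws) 1))" for ws
    proof (induction ws)
      case Nil
      show ?case using one by (simp add: one_weyl.abs_eq zero_word_def flip: single_one)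
    next
      case (Cons g ws)
      have "abs_weyl (Poly_Mapping.single (Wd (g # ws)) 1 :: 'k free_alg) =
        abs_weyl (free_gen g) * abs_weyl (Poly_Mapping.single (Wd ws) 1)"
        by (simp add: times_weyl.abs_eq free_gen_def mult_single plus_word_def)
      then show ?case using Cons x y by (cases g) (simp_all add: weyl_x.abs_eq weyl_y.abs_eq)
    qed
    from this[of "letters w"] have "P (weyl_const c * abs_weyl (Poly_Mapping.single w 1))"
      using assms(2) by simp
    then show ?case by (simp add: times_weyl.abs_eq weyl_const.abs_eq mult_single)
  qed
qed

section \<open>Polynomials in the Weyl algebra\<close>

lemma weyl_poly_0 [simp]: "weyl_poly 0 = 0"
  by (simp add: weyl_poly_def)

lemma weyl_poly_pCons: "weyl_poly (pCons c f) = weyl_const c + weyl_x * weyl_poly f"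
proof (cases "f = 0")
  case True
  then show ?thesis by (simp add: weyl_poly_def)
next
  case False
  then show ?thesis
    by (simp add: weyl_poly_def sum.atMost_Suc_shift sum_distrib_left power_Suc mult.assoc[symmetric]
        weyl_const_commute[of _ weyl_x] del: sum.atMost_Suc)
qed

lemma weyl_poly_add: "weyl_poly (f + g) = weyl_poly f + weyl_poly g"
  by (induction f g rule: poly_induct2) (simp_all add: weyl_poly_pCons weyl_const_add algebra_simps)

lemma weyl_poly_const [simp]: "weyl_poly [:c:] = weyl_const c"
  by (simp add: weyl_poly_pCons)

lemma weyl_poly_1 [simp]: "weyl_poly 1 = 1"
  by (simp add: one_pCons)

lemma weyl_poly_smult: "weyl_poly (smult c f) = weyl_const c * weyl_poly f"
  by (induction f) (simp_all add: weyl_poly_pCons weyl_const_mult distrib_left mult.assoc[symmetric] weyl_const_commute[of _ weyl_x])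

lemma weyl_poly_mult: "weyl_poly (f * g) = weyl_poly f * weyl_poly g"
  by (induction f) (simp_all add: weyl_poly_pCons weyl_poly_add weyl_poly_smult distrib_right mult.assoc)

lemma weyl_poly_power: "weyl_poly (f ^ n) = weyl_poly f ^ n"
  by (induction n) (simp_all add: weyl_poly_mult)

lemma weyl_poly_x: "weyl_poly (monom 1 1) = weyl_x"
  by (simp add: monom_altdef weyl_poly_pCons)

lemma weyl_y_poly: "weyl_y * weyl_poly f = weyl_poly f * weyl_y + weyl_poly (pderiv f)"
proof (induction f)
  case 0
  show ?case by simp
next
  case (pCons c f)
  have yx: "weyl_y * weyl_x = weyl_x * weyl_y + 1" using weyl_relation by (simp add: algebra_simps)
  have "weyl_y * weyl_poly (pCons c f) = weyl_const c * weyl_y + (weyl_y * weyl_x) * weyl_poly f"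
    by (simp add: weyl_poly_pCons distrib_left mult.assoc weyl_const_commute)
  also have "\<dots> = weyl_const c * weyl_y + weyl_x * (weyl_y * weyl_poly f) + weyl_poly f"
    by (simp add: yx algebra_simps)
  also have "\<dots> = weyl_poly (pCons c f) * weyl_y + weyl_poly (pderiv (pCons c f))"
    by (simp add: pCons.IH weyl_poly_pCons pderiv_pCons weyl_poly_add algebra_simps)
  finally show ?case .
qed

section \<open>The normal form\<close>

text \<open>The action by multiplication by \<open>x\<close> and by \<open>d/dx\<close> plus multiplication by \<open>y\<close> is left multiplication
  of \<open>A\<^sub>1\<close> on elements written with powers of \<open>y\<close> on the right. Unlike the action on \<open>\<F>[x]\<close>, where \<open>y\<^sup>p\<close> is zero,
  it is faithful in positive characteristic.\<close>

interpretation nf: weyl_module "\<lambda>c. smult [:c:]" "smult [:0, 1:]" "\<lambda>P. map_poly pderiv P + pCons 0 P"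
  by unfold_locales
    (auto intro!: poly_eqI simp: coeff_map_poly pderiv_add pderiv_smult pderiv_mult pderiv_pCons
      algebra_simps coeff_pCons split: nat.splits)

text \<open>The outer variable of the result stands for \<open>y\<close>, the inner one for \<open>x\<close>.\<close>

definition nf :: "'k::field weyl \<Rightarrow> 'k poly poly" where
  "nf a = nf.act a 1"

abbreviation cf :: "'k::field weyl \<Rightarrow> nat \<Rightarrow> 'k poly" where
  "cf a j \<equiv> coeff (nf a) j"

lemma nf_add: "nf (a + b) = nf a + nf b"
  and nf_1: "nf 1 = 1"
  and nf_x_mult: "nf (weyl_x * a) = smult [:0, 1:] (nf a)"
  and nf_y_mult: "nf (weyl_y * a) = map_poly pderiv (nf a) + pCons 0 (nf a)"
  and nf_const_mult: "nf (weyl_const c * a) = smult [:c:] (nf a)"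
  by (simp_all add: nf_def nf.act_add nf.act_one nf.act_mult nf.act_x nf.act_y nf.act_const)

lemma nf_0 [simp]: "nf 0 = 0"
  using nf_const_mult[of 0 0] by simp

lemma nf_uminus: "nf (- a) = - nf a"
  using nf_add[of a "- a"] by (simp add: eq_neg_iff_add_eq_0 add.commute)

lemma nf_diff: "nf (a - b) = nf a - nf b"
  using nf_add[of a "- b"] by (simp add: nf_uminus)

lemma nf_sum: "nf (sum F I) = (\<Sum>i\<in>I. nf (F i))"
  by (induction I rule: infinite_finite_induct) (simp_all add: nf_add)

lemma nf_poly_mult: "nf (weyl_poly f * a) = smult f (nf a)"
proof (induction f)
  case 0
  show ?case by simp
next
  case (pCons c f)
  have "nf (weyl_poly (pCons c f) * a) = smult [:c:] (nf a) + smult [:0, 1:] (smult f (nf a))"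
    by (simp add: weyl_poly_pCons distrib_right mult.assoc nf_add nf_const_mult nf_x_mult pCons.IH)
  also have "\<dots> = smult (pCons c f) (nf a)"
    by (simp add: smult_add_left[symmetric])
  finally show ?case .
qed

lemma nf_mult_y: "nf (a * weyl_y) = pCons 0 (nf a)"
proof (induction a rule: weyl_induct)
  case one
  show ?case using nf_y_mult[of 1] by (simp add: nf_1 map_poly_pCons pderiv_pCons one_pCons)
next
  case (y a)
  then show ?case by (simp add: mult.assoc nf_y_mult map_poly_pCons)
qed (simp_all add: mult.assoc nf_const_mult nf_x_mult distrib_right nf_add)

definition of_nf :: "'k::field poly poly \<Rightarrow> 'k weyl" where
  "of_nf P = fold_coeffs (\<lambda>f a. weyl_poly f + a * weyl_y) P 0"

lemma of_nf_0 [simp]: "of_nf 0 = 0"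
  by (simp add: of_nf_def)

lemma of_nf_pCons: "of_nf (pCons f P) = weyl_poly f + of_nf P * weyl_y"
  by (cases "f = 0 \<and> P = 0") (auto simp: of_nf_def)

lemma nf_of_nf [simp]: "nf (of_nf P) = P"
proof (induction P)
  case (pCons f P)
  have "nf (weyl_poly f) = [:f:]" using nf_poly_mult[of f 1] by (simp add: nf_1)
  then show ?case by (simp add: of_nf_pCons nf_add nf_mult_y pCons)
qed simp

lemma of_nf_add: "of_nf (P + Q) = of_nf P + of_nf Q"
  by (induction P Q rule: poly_induct2) (simp_all add: of_nf_pCons weyl_poly_add algebra_simps)

lemma of_nf_smult: "of_nf (smult f P) = weyl_poly f * of_nf P"
  by (induction P) (simp_all add: of_nf_pCons weyl_poly_mult distrib_left mult.assoc)

lemma of_nf_y: "of_nf (map_poly pderiv P + pCons 0 P) = weyl_y * of_nf P"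
  by (induction P)
    (simp_all add: map_poly_pCons of_nf_pCons of_nf_add weyl_y_poly algebra_simps)

lemma of_nf_nf [simp]: "of_nf (nf a) = a"
proof (induction a rule: weyl_induct)
  case one
  show ?case by (simp add: nf_1 one_pCons of_nf_pCons)
next
  case (x a)
  then show ?case using weyl_poly_x by (simp add: nf_x_mult of_nf_smult weyl_poly_pCons)
next
  case (y a)
  then show ?case by (simp only: nf_y_mult of_nf_y)
qed (simp_all add: nf_const_mult of_nf_smult nf_add of_nf_add)

lemma nf_eq_iff: "nf a = nf b \<longleftrightarrow> a = b"
  by (metis of_nf_nf)

lemma weyl_eqI: "(\<And>j. cf a j = cf b j) \<Longrightarrow> a = b"
  by (metis nf_eq_iff poly_eqI)

lemma weyl_expand: "a = (\<Sum>j\<le>degree (nf a). weyl_poly (cf a j) * weyl_y ^ j)"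
proof -
  have nfm: "nf (weyl_poly f * weyl_y ^ j) = monom f j" for f :: "'a poly" and j
  proof (induction j)
    case 0
    show ?case using nf_poly_mult[of f 1] by (simp add: nf_1 monom_0)
  next
    case (Suc j)
    then show ?case
      using nf_mult_y[of "weyl_poly f * weyl_y ^ j"]
      by (simp add: power_Suc2 mult.assoc[symmetric] monom_Suc del: power_Suc)
  qed
  show ?thesis
    by (subst nf_eq_iff[symmetric]) (simp add: nf_sum nfm poly_as_sum_of_monoms)
qed

lemma cf_y_mult: "cf (weyl_y * a) j = pderiv (cf a j) + (if j = 0 then 0 else cf a (j - 1))"
  by (simp add: nf_y_mult coeff_map_poly coeff_pCons split: nat.splits)

lemma cf_mult_y: "cf (a * weyl_y) j = (if j = 0 then 0 else cf a (j - 1))"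
  by (simp add: nf_mult_y coeff_pCons split: nat.splits)

lemma cf_mult_y_power: "cf (a * weyl_y ^ n) j = (if j < n then 0 else cf a (j - n))"
proof (induction n arbitrary: j)
  case (Suc n)
  have "a * weyl_y ^ Suc n = (a * weyl_y ^ n) * weyl_y" by (simp add: power_Suc2 mult.assoc del: power_Suc)
  then have "cf (a * weyl_y ^ Suc n) j = (if j = 0 then 0 else cf (a * weyl_y ^ n) (j - 1))"
    by (simp only: cf_mult_y)
  then show ?case by (auto simp: Suc.IH)
qed simp

lemma cf_poly_mult: "cf (weyl_poly f * a) j = f * cf a j"
  by (simp add: nf_poly_mult)

lemma cf_poly: "cf (weyl_poly f) j = (if j = 0 then f else 0)"
  using cf_poly_mult[of f 1 j] by (simp add: nf_1)

lemma cf_monomial: "cf (weyl_poly f * weyl_y ^ n) j = (if j = n then f else 0)"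
  by (auto simp: cf_mult_y_power cf_poly)

text \<open>The Leibniz rule \<open>y\<^sup>n f = \<Sum>\<^sub>i (n choose i) f\<^sup>(\<^sup>n\<^sup>-\<^sup>i\<^sup>) y\<^sup>i\<close>.\<close>

lemma cf_y_power_poly:
  "cf (weyl_y ^ n * weyl_poly f) i = of_nat (n choose i) * (pderiv ^^ (n - i)) f"
proof (induction n arbitrary: i)
  case 0
  show ?case by (cases i) (simp_all add: cf_poly)
next
  case (Suc n)
  have d: "pderiv (of_nat m * u) = of_nat m * pderiv u" for m and u :: "'a poly"
    by (simp add: pderiv_mult)
  show ?case
  proof (cases i)
    case 0
    then show ?thesis by (simp add: mult.assoc cf_y_mult Suc.IH d)
  next
    case (Suc j)
    show ?thesis
    proof (cases "j < n")
      case True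
      then have "n - j = Suc (n - Suc j)" by simp
      then show ?thesis using Suc
        by (simp add: mult.assoc cf_y_mult Suc.IH d algebra_simps)
    next
      case False
      then show ?thesis using Suc
        by (cases "j = n") (simp_all add: mult.assoc cf_y_mult Suc.IH d binomial_eq_0)
    qed
  qed
qed

lemma cf_mult_poly:
  "cf (a * weyl_poly f) i =
    (\<Sum>j\<le>degree (nf a). cf a j * (of_nat (j choose i) * (pderiv ^^ (j - i)) f))"
proof -
  have "a * weyl_poly f = (\<Sum>j\<le>degree (nf a). weyl_poly (cf a j) * (weyl_y ^ j * weyl_poly f))"
    by (subst weyl_expand[of a]) (simp add: sum_distrib_right mult.assoc)
  then show ?thesis
    by (simp add: nf_sum coeff_sum cf_poly_mult cf_y_power_poly)
qed

text \<open>Together with the formula for \<open>weyl_x * a\<close> this identifies \<open>[a,x]\<close> with the derivative of the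
  normal form in \<open>y\<close>.\<close>

lemma nf_mult_x: "nf (a * weyl_x) = smult [:0, 1:] (nf a) + pderiv (nf a)"
proof (induction a rule: weyl_induct)
  case one
  show ?case using nf_x_mult[of 1] by (simp add: nf_1)
next
  case (y a)
  have "map_poly pderiv (pderiv P) = pderiv (map_poly pderiv P)" for P :: "'a poly poly"
    by (intro poly_eqI) (simp add: coeff_map_poly coeff_pderiv pderiv_mult pderiv_add)
  moreover have "map_poly pderiv (smult f P + Q) = smult (pderiv f) P + smult f (map_poly pderiv P) + map_poly pderiv Q"
    for f and P Q :: "'a poly poly"
    by (intro poly_eqI) (simp add: coeff_map_poly pderiv_mult pderiv_add algebra_simps)
  ultimately show ?case using y
    by (simp add: mult.assoc nf_y_mult pderiv_add pderiv_pCons smult_add_right one_pCons[symmetric])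
next
  case (const c a)
  then show ?case by (simp add: mult.assoc nf_const_mult pderiv_smult smult_add_right mult.commute)
next
  case (x a)
  then show ?case by (simp add: mult.assoc nf_x_mult pderiv_smult smult_add_right mult.commute)
qed (simp_all add: mult.assoc distrib_right nf_add pderiv_add smult_add_right)

section \<open>Derivations of the Weyl algebra\<close>

definition weyl_derivation :: "('k::field weyl \<Rightarrow> 'k weyl) \<Rightarrow> bool" where
  "weyl_derivation d \<longleftrightarrow> (\<forall>a b. d (a + b) = d a + d b) \<and> (\<forall>a b. d (a * b) = d a * b + a * d b)
     \<and> (\<forall>c. d (weyl_const c) = 0)"

text \<open>A derivation \<open>d\<close> amounts to the module structure \<open>a (b, c) = (a b, a c + d(a) b)\<close> on
  \<open>A\<^sub>1 \<times> A\<^sub>1\<close>, and the hypothesis is the defining relation for the corresponding operators.\<close>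

lemma weyl_derivation_exists:
  fixes u v :: "'k::field weyl"
  assumes rel: "(v * weyl_x - weyl_x * v) + (weyl_y * u - u * weyl_y) = 0"
  obtains d where "weyl_derivation d" "d weyl_x = u" "d weyl_y = v"
proof -
  have c: "a * (weyl_const c * b) = weyl_const c * (a * b)" for a b :: "'k weyl" and c
    by (metis weyl_const_commute mult.assoc)
  have yx: "weyl_y * (weyl_x * a) = weyl_x * (weyl_y * a) + (a :: 'k weyl)" for a
  proof -
    have "(weyl_y * weyl_x - weyl_x * weyl_y) * a = a" by (simp add: weyl_relation)
    then show ?thesis by (simp add: algebra_simps)
  qed
  define sc :: "'k \<Rightarrow> 'k weyl \<times> 'k weyl \<Rightarrow> 'k weyl \<times> 'k weyl"
    where "sc = (\<lambda>c w. (weyl_const c * fst w, weyl_const c * snd w))"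
  define X :: "'k weyl \<times> 'k weyl \<Rightarrow> 'k weyl \<times> 'k weyl"
    where "X = (\<lambda>w. (weyl_x * fst w, weyl_x * snd w + u * fst w))"
  define Y :: "'k weyl \<times> 'k weyl \<Rightarrow> 'k weyl \<times> 'k weyl"
    where "Y = (\<lambda>w. (weyl_y * fst w, weyl_y * snd w + v * fst w))"
  interpret D: weyl_module sc X Y
  proof
    fix w :: "'k weyl \<times> 'k weyl"
    have "((v * weyl_x - weyl_x * v) + (weyl_y * u - u * weyl_y)) * fst w = 0" by (simp add: rel)
    then show "Y (X w) = X (Y w) + w"
      by (cases w) (simp add: X_def Y_def yx algebra_simps)
  qed (auto simp: sc_def X_def Y_def weyl_const_add weyl_const_mult algebra_simps
      c[of weyl_x] c[of weyl_y] c[of u] c[of v])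
  \<comment> \<open>The orbit of \<open>(1, 0)\<close> consists of the pairs \<open>(a, d a)\<close>.\<close>
  define d where "d = (\<lambda>a. snd (D.act a (1, 0)))"
  have comp: "fst (sc c w) = weyl_const c * fst w" "snd (sc c w) = weyl_const c * snd w"
    "fst (X w) = weyl_x * fst w" "snd (X w) = weyl_x * snd w + u * fst w"
    "fst (Y w) = weyl_y * fst w" "snd (Y w) = weyl_y * snd w + v * fst w" for c w
    by (simp_all add: sc_def X_def Y_def)
  note D_act = D.act_one D.act_mult D.act_const D.act_x D.act_y D.act_add comp
  have fst_act: "fst (D.act a w) = a * fst w" for a w
    by (induction a arbitrary: w rule: weyl_induct) (simp_all add: D_act distrib_right mult.assoc)
  have d: "d 1 = 0" "d (weyl_const c * a) = weyl_const c * d a" "d (weyl_x * a) = weyl_x * d a + u * a"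
    "d (weyl_y * a) = weyl_y * d a + v * a" "d (a + b) = d a + d b" for a b c
    by (simp_all add: d_def D_act fst_act)
  have snd_act: "snd (D.act a w) = a * snd w + d a * fst w" for a w
    by (induction a arbitrary: w rule: weyl_induct)
      (simp_all add: d D_act fst_act algebra_simps)
  have "d (a * b) = d a * b + a * d b" for a b
  proof -
    have "d (a * b) = snd (D.act a (D.act b (1, 0)))" by (simp add: d_def D.act_mult)
    also have "\<dots> = a * d b + d a * b" by (simp only: snd_act fst_act) simp
    finally show ?thesis by (simp add: add.commute)
  qed
  moreover have "d (weyl_const c) = 0" for c using d(2)[of c 1] by (simp add: d(1))
  ultimately have "weyl_derivation d" unfolding weyl_derivation_def using d(5) by blast
  moreover have "d weyl_x = u" "d weyl_y = v" by (simp_all add: d_def D_act)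
  ultimately show ?thesis using that by blast
qed

section \<open>Iterated commutators and powers\<close>

definition ad :: "'a::ring_1 \<Rightarrow> 'a \<Rightarrow> 'a" where
  "ad u a = u * a - a * u"

text \<open>Moving all factors \<open>u\<close> in \<open>\<Sum> u\<^sup>i (D u) u\<^sup>j\<close> to the right produces the iterated commutators.\<close>

lemma leibniz_power:
  fixes D :: "'a::ring_1 \<Rightarrow> 'a"
  assumes D1: "D 1 = 0" and DS: "\<And>n. D (u ^ Suc n) = D u * u ^ n + u * D (u ^ n)"
  shows "D (u ^ n) = (\<Sum>k<n. of_nat (n choose Suc k) * ((ad u ^^ k) (D u) * u ^ (n - Suc k)))"
proof (induction n)
  case 0
  show ?case by (simp add: D1)
next
  case (Suc n)
  define B where "B = (\<lambda>k. (ad u ^^ k) (D u))"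
  have nat_comm: "u * (of_nat m * a) = of_nat m * (u * a)" for m a
    by (metis mult.assoc mult_of_nat_commute)
  have step: "u * (B k * u ^ (n - Suc k)) = B (Suc k) * u ^ (n - Suc k) + B k * u ^ (n - k)" if "k < n" for k
  proof -
    have "n - k = Suc (n - Suc k)" using that by simp
    then show ?thesis by (simp add: B_def ad_def algebra_simps)
  qed
  have "u * D (u ^ n) = (\<Sum>k<n. of_nat (n choose Suc k) * (u * (B k * u ^ (n - Suc k))))"
    by (simp add: Suc.IH B_def sum_distrib_left nat_comm)
  also have "\<dots> = (\<Sum>k<n. of_nat (n choose Suc k) * (B (Suc k) * u ^ (n - Suc k)))
      + (\<Sum>k<n. of_nat (n choose Suc k) * (B k * u ^ (n - k)))"
    by (simp add: step distrib_left sum.distrib)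
  finally have "D (u ^ Suc n) = (B 0 * u ^ n + (\<Sum>k<n. of_nat (n choose Suc k) * (B (Suc k) * u ^ (n - Suc k))))
      + (\<Sum>k<n. of_nat (n choose Suc k) * (B k * u ^ (n - k)))"
    unfolding DS by (simp add: B_def)
  also have "B 0 * u ^ n + (\<Sum>k<n. of_nat (n choose Suc k) * (B (Suc k) * u ^ (n - Suc k))) =
      (\<Sum>k<Suc n. of_nat (n choose k) * (B k * u ^ (n - k)))"
    by (simp add: sum.lessThan_Suc_shift del: sum.lessThan_Suc)
  also have "(\<Sum>k<n. of_nat (n choose Suc k) * (B k * u ^ (n - k))) =
      (\<Sum>k<Suc n. of_nat (n choose Suc k) * (B k * u ^ (n - k)))"
    by (simp add: binomial_eq_0)
  finally show ?case
    by (simp add: B_def sum.distrib[symmetric] distrib_right[symmetric] del: sum.lessThan_Suc)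
qed

lemma of_nat_weyl: "of_nat n = (weyl_const (of_nat n) :: 'k::field weyl)"
  by (induction n) (simp_all add: weyl_const_add)

text \<open>All binomial coefficients but the last vanish modulo \<open>p\<close>.\<close>

lemma leibniz_power_char:
  fixes D :: "'k::field weyl \<Rightarrow> 'k weyl"
  assumes p: "CHAR('k) > 0"
    and D: "D 1 = 0" "\<And>n. D (u ^ Suc n) = D u * u ^ n + u * D (u ^ n)"
  shows "D (u ^ CHAR('k)) = (ad u ^^ (CHAR('k) - 1)) (D u)"
proof -
  let ?t = "\<lambda>k. of_nat (CHAR('k) choose Suc k) * ((ad u ^^ k) (D u) * u ^ (CHAR('k) - Suc k))"
  obtain n where n: "CHAR('k) = Suc n" using p by (cases "CHAR('k)") auto
  have "?t k = 0" if "k < n" for k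
  proof -
    have "CHAR('k) dvd (CHAR('k) choose Suc k)"
      using that n prime_CHAR_semidom[OF p] by (intro dvd_choose_prime) auto
    then have "of_nat (CHAR('k) choose Suc k) = (0 :: 'k)" by (simp only: of_nat_eq_0_iff_char_dvd)
    then have "of_nat (CHAR('k) choose Suc k) = (0 :: 'k weyl)" by (simp only: of_nat_weyl weyl_const_0)
    then show ?thesis by simp
  qed
  then have "(\<Sum>k<Suc n. ?t k) = ?t n" by simp
  then show ?thesis unfolding leibniz_power[OF D] by (simp add: n)
qed

lemma cf_add: "cf (a + b) j = cf a j + cf b j"
  and cf_diff: "cf (a - b) j = cf a j - cf b j"
  and cf_0 [simp]: "cf 0 j = 0"
  by (simp_all add: nf_add nf_diff)

lemma cf_ad_y: "cf ((ad weyl_y ^^ n) a) j = (pderiv ^^ n) (cf a j)"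
  by (induction n arbitrary: a j) (simp_all add: ad_def cf_diff cf_y_mult cf_mult_y)

lemma nf_ad_x: "nf (ad weyl_x a) = - pderiv (nf a)"
  by (simp add: ad_def nf_diff nf_x_mult nf_mult_x)

lemma cf_ad_x: "cf ((ad weyl_x ^^ n) a) j = (- 1) ^ n * (pochhammer (of_nat (Suc j)) n * cf a (j + n))"
proof -
  have "nf ((ad weyl_x ^^ n) a) = smult ((- 1) ^ n) ((pderiv ^^ n) (nf a))"
    by (induction n) (simp_all add: nf_ad_x pderiv_smult pderiv_minus)
  then show ?thesis by (simp add: coeff_higher_pderiv)
qed

lemma cf_mult_poly_bounded:
  assumes "\<And>j. j > N \<Longrightarrow> cf a j = 0"
  shows "cf (a * weyl_poly f) i = (\<Sum>j\<le>N. cf a j * (of_nat (j choose i) * (pderiv ^^ (j - i)) f))"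
proof -
  let ?t = "\<lambda>j. cf a j * (of_nat (j choose i) * (pderiv ^^ (j - i)) f)"
  have "sum ?t {..degree (nf a)} = sum ?t {..max N (degree (nf a))}"
    by (intro sum.mono_neutral_left) (auto simp: coeff_eq_0)
  also have "\<dots> = sum ?t {..N}"
    by (intro sum.mono_neutral_right) (use assms in auto)
  finally show ?thesis by (simp add: cf_mult_poly)
qed

text \<open>Commuting with a polynomial lowers the degree in \<open>y\<close>, by the Leibniz rule.\<close>

lemma cf_ad_poly_step:
  assumes "\<And>j. j > Suc n \<Longrightarrow> cf a j = 0"
  shows "j > n \<Longrightarrow> cf (ad (weyl_poly f) a) j = 0"
    "cf (ad (weyl_poly f) a) n = - (of_nat (Suc n) * (pderiv f * cf a (Suc n)))"
proof -
  note c = cf_mult_poly_bounded[where f = f, OF assms]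
  have z: "(\<Sum>l\<le>n. cf a l * (of_nat (l choose j) * (pderiv ^^ (l - j)) f)) = 0" if "j > n" for j
    using that by (intro sum.neutral) (auto simp: binomial_eq_0)
  show "cf (ad (weyl_poly f) a) j = 0" if j: "j > n"
  proof (cases "j = Suc n")
    case True
    then show ?thesis using z[of "Suc n"] by (simp add: ad_def cf_diff cf_poly_mult c mult.commute)
  next
    case False
    then have "j > Suc n" using j by simp
    then show ?thesis using z[OF j] assms by (simp add: ad_def cf_diff cf_poly_mult c binomial_eq_0)
  qed
  have "(\<Sum>l\<le>n. cf a l * (of_nat (l choose n) * (pderiv ^^ (l - n)) f)) = cf a n * f"
  proof (cases n)
    case (Suc m)
    have "(\<Sum>l\<le>m. cf a l * (of_nat (l choose n) * (pderiv ^^ (l - n)) f)) = 0"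
      using Suc by (intro sum.neutral) (auto simp: binomial_eq_0)
    then show ?thesis using Suc by simp
  qed simp
  then show "cf (ad (weyl_poly f) a) n = - (of_nat (Suc n) * (pderiv f * cf a (Suc n)))"
    by (simp add: ad_def cf_diff cf_poly_mult c algebra_simps)
qed

lemma cf_ad_poly_power:
  assumes "\<And>j. j > n \<Longrightarrow> cf a j = 0"
  shows "(ad (weyl_poly f) ^^ n) a = weyl_poly ((- 1) ^ n * (of_nat (fact n) * (pderiv f ^ n * cf a n)))"
  using assms
proof (induction n arbitrary: a)
  case 0
  then show ?case by (intro weyl_eqI) (auto simp: cf_poly)
next
  case (Suc n)
  have "(ad (weyl_poly f) ^^ Suc n) a = (ad (weyl_poly f) ^^ n) (ad (weyl_poly f) a)"
    by (simp add: funpow_swap1)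
  also have "\<dots> = weyl_poly ((- 1) ^ n * (of_nat (fact n) * (pderiv f ^ n * cf (ad (weyl_poly f) a) n)))"
    by (rule Suc.IH) (use cf_ad_poly_step(1)[OF Suc.prems] in blast)
  also have "cf (ad (weyl_poly f) a) n = - (of_nat (Suc n) * (pderiv f * cf a (Suc n)))"
    by (rule cf_ad_poly_step(2)[OF Suc.prems])
  also have "(- 1) ^ n * (of_nat (fact n) * (pderiv f ^ n * - (of_nat (Suc n) * (pderiv f * cf a (Suc n))))) =
      (- 1) ^ Suc n * ((of_nat (fact n) * of_nat (Suc n)) * (pderiv f ^ Suc n * cf a (Suc n)))"
    by (simp add: mult_ac del: of_nat_Suc)
  also have "of_nat (fact n) * of_nat (Suc n) = (of_nat (fact (Suc n)) :: 'a poly)"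
    by (simp only: fact_Suc of_nat_mult of_nat_id mult.commute)
  finally show ?case .
qed

section \<open>The algebra \<open>A\<^sub>h\<close> in normal form\<close>

lemma dvd_higher_pderiv:
  fixes f h :: "'k::field poly"
  assumes "h ^ m dvd f"
  shows "h ^ (m - n) dvd (pderiv ^^ n) f"
proof (induction n)
  case 0
  then show ?case using assms by simp
next
  case (Suc n)
  have "h ^ (k - 1) dvd pderiv g" if "h ^ k dvd g" for k and g :: "'k poly"
  proof (cases k)
    case (Suc l)
    from that obtain u where "g = h ^ Suc l * u" using Suc by auto
    then have "pderiv g = h ^ l * (h * pderiv u + smult (of_nat (Suc l)) (u * pderiv h))"
      by (simp add: pderiv_mult pderiv_power_Suc algebra_simps del: of_nat_Suc power_Suc) (simp add: algebra_simps)
    then show ?thesis using Suc by simp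
  qed simp
  from this[OF Suc.IH] show ?case by simp
qed

lemma subalgebra_hull: "subalgebra \<kappa> (subalgebra \<kappa> hull S)"
  by (rule hull_in) (unfold subalgebra_def, blast)

lemma A_h_subalgebra: "subalgebra weyl_const (A_h h)"
  unfolding A_h_def by (rule subalgebra_hull)

lemma A_h_const: "weyl_const c \<in> A_h h"
  and A_h_add: "a \<in> A_h h \<Longrightarrow> b \<in> A_h h \<Longrightarrow> a + b \<in> A_h h"
  and A_h_mult: "a \<in> A_h h \<Longrightarrow> b \<in> A_h h \<Longrightarrow> a * b \<in> A_h h"
  using A_h_subalgebra[of h] unfolding subalgebra_def by blast+

lemma A_h_x: "weyl_x \<in> A_h h" and A_h_yhat: "yhat h \<in> A_h h"
  unfolding A_h_def by (rule hull_inc, simp)+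

lemma A_h_0: "0 \<in> A_h h" and A_h_1: "1 \<in> A_h h"
  using A_h_const[of 0 h] A_h_const[of 1 h] by simp_all

lemma A_h_uminus: "a \<in> A_h h \<Longrightarrow> - a \<in> A_h h"
proof -
  assume "a \<in> A_h h"
  then have "weyl_const (- 1) * a \<in> A_h h" by (intro A_h_mult A_h_const)
  moreover have "weyl_const (- 1 :: 'a) = - 1"
    using weyl_const_add[of "1 :: 'a" "-1"] by (simp add: eq_neg_iff_add_eq_0 add.commute)
  ultimately show ?thesis by simp
qed

lemma A_h_diff: "a \<in> A_h h \<Longrightarrow> b \<in> A_h h \<Longrightarrow> a - b \<in> A_h h"
  using A_h_add[of a h "- b"] A_h_uminus[of b h] by simp

lemma A_h_sum: "(\<And>i. i \<in> I \<Longrightarrow> F i \<in> A_h h) \<Longrightarrow> sum F I \<in> A_h h"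
  by (induction I rule: infinite_finite_induct) (auto intro: A_h_0 A_h_add)

lemma A_h_power: "a \<in> A_h h \<Longrightarrow> a ^ n \<in> A_h h"
  by (induction n) (auto intro: A_h_1 A_h_mult)

lemma A_h_poly: "weyl_poly f \<in> A_h h"
  by (induction f) (auto simp: weyl_poly_pCons intro: A_h_0 A_h_add A_h_mult A_h_const A_h_x)

text \<open>Moving one \<open>y\<close> past \<open>h\<^sup>j\<^sup>+\<^sup>1\<close> splits off a factor \<open>yhat\<close> from \<open>h\<^sup>j\<^sup>+\<^sup>1 y\<^sup>j\<^sup>+\<^sup>1\<close>, up to a multiple of
  \<open>h\<^sup>j y\<^sup>j\<close>.\<close>

lemma A_h_monomial: "weyl_poly (h ^ j) * weyl_y ^ j \<in> A_h h"
proof (induction j)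
  case 0
  show ?case by (simp add: A_h_1)
next
  case (Suc j)
  have "weyl_y * weyl_poly (h ^ Suc j) = weyl_poly (h ^ Suc j) * weyl_y + weyl_poly (pderiv (h ^ Suc j))"
    by (rule weyl_y_poly)
  then have "weyl_poly (h ^ Suc j) * weyl_y ^ Suc j =
      weyl_y * weyl_poly (h ^ Suc j) * weyl_y ^ j - weyl_poly (pderiv (h ^ Suc j)) * weyl_y ^ j"
    by (simp add: algebra_simps)
  also have "weyl_y * weyl_poly (h ^ Suc j) * weyl_y ^ j = yhat h * (weyl_poly (h ^ j) * weyl_y ^ j)"
    by (simp add: yhat_def weyl_poly_mult mult.assoc)
  also have "weyl_poly (pderiv (h ^ Suc j)) * weyl_y ^ j =
      weyl_poly (smult (of_nat (Suc j)) (pderiv h)) * (weyl_poly (h ^ j) * weyl_y ^ j)"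
    by (simp add: pderiv_power_Suc weyl_poly_mult[symmetric] mult.assoc[symmetric] mult.commute[of "pderiv h"]
        del: power_Suc of_nat_Suc)
  finally show ?case using Suc by (simp only: A_h_diff A_h_mult A_h_yhat A_h_poly)
qed

text \<open>The elements on the right are closed under products, since an \<open>l\<close>-fold derivative loses at most
  \<open>l\<close> factors \<open>h\<close>, while the Leibniz rule lowers the power of \<open>y\<close> by the same \<open>l\<close>.\<close>

lemma A_h_iff: "a \<in> A_h h \<longleftrightarrow> (\<forall>j. h ^ j dvd cf a j)"
proof
  assume "\<forall>j. h ^ j dvd cf a j"
  then have "\<forall>j. \<exists>u. cf a j = u * h ^ j" by (metis dvdE mult.commute)
  then obtain u where u: "\<And>j. cf a j = u j * h ^ j" by metis
  have "a = (\<Sum>j\<le>degree (nf a). weyl_poly (u j) * (weyl_poly (h ^ j) * weyl_y ^ j))"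
    by (subst weyl_expand) (simp add: u weyl_poly_mult mult.assoc)
  also have "\<dots> \<in> A_h h" by (intro A_h_sum A_h_mult A_h_poly A_h_monomial)
  finally show "a \<in> A_h h" .
next
  define S where "S = {a. \<forall>j. h ^ j dvd cf a j}"
  have S: "a * b \<in> S" if a: "a \<in> S" and b: "b \<in> S" for a b
  proof -
    have "a * b = (\<Sum>j\<le>degree (nf b). a * weyl_poly (cf b j) * weyl_y ^ j)"
      by (subst weyl_expand[of b]) (simp add: sum_distrib_left mult.assoc)
    moreover have "h ^ i dvd cf (a * weyl_poly (cf b j) * weyl_y ^ j) i" for i j
    proof (cases "i < j")
      case False
      have "h ^ i dvd cf a l * (of_nat (l choose (i - j)) * (pderiv ^^ (l - (i - j))) (cf b j))" for l
      proof (cases "l < i - j")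
        case False
        have "h ^ (j - (l - (i - j))) dvd (pderiv ^^ (l - (i - j))) (cf b j)"
          by (rule dvd_higher_pderiv) (use b in \<open>auto simp: S_def\<close>)
        moreover have "h ^ l dvd cf a l" using a by (simp add: S_def)
        ultimately have "h ^ l * h ^ (j - (l - (i - j))) dvd
            cf a l * (of_nat (l choose (i - j)) * (pderiv ^^ (l - (i - j))) (cf b j))"
          by (intro mult_dvd_mono dvd_mult)
        moreover have "h ^ i dvd h ^ l * h ^ (j - (l - (i - j)))"
          unfolding power_add[symmetric] by (rule le_imp_power_dvd) (use False \<open>\<not> i < j\<close> in simp)
        ultimately show ?thesis by (rule dvd_trans[rotated])
      qed (simp add: binomial_eq_0)
      then show ?thesis using False by (simp add: cf_mult_y_power cf_mult_poly dvd_sum)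
    qed (simp add: cf_mult_y_power)
    ultimately show ?thesis by (simp add: S_def nf_sum coeff_sum dvd_sum)
  qed
  have "weyl_const c \<in> S" for c
    using cf_poly[of "[:c:]"] by (simp add: S_def)
  moreover have "a + b \<in> S" if "a \<in> S" "b \<in> S" for a b
    using that by (auto simp: S_def cf_add)
  ultimately have "subalgebra weyl_const S" using S by (auto simp: subalgebra_def)
  moreover have "weyl_x \<in> S" by (simp add: S_def cf_poly[of "monom 1 1", unfolded weyl_poly_x])
  moreover have "yhat h \<in> S"
    by (auto simp: S_def yhat_def cf_y_mult cf_poly le_Suc_eq)
  ultimately have "A_h h \<subseteq> S" unfolding A_h_def by (intro hull_minimal) auto
  moreover assume "a \<in> A_h h"
  ultimately show "\<forall>j. h ^ j dvd cf a j" by (auto simp: S_def)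
qed

section \<open>Central elements\<close>

definition central :: "'a::ring_1 \<Rightarrow> bool" where
  "central a \<longleftrightarrow> (\<forall>b. a * b = b * a)"

lemma commutes_x_iff:
  assumes "CHAR('k::field) > 0"
  shows "(a :: 'k weyl) * weyl_x = weyl_x * a \<longleftrightarrow> (\<forall>j. \<not> CHAR('k) dvd j \<longrightarrow> cf a j = 0)"
proof -
  have "a * weyl_x = weyl_x * a \<longleftrightarrow> pderiv (nf a) = 0"
    by (subst nf_eq_iff[symmetric]) (simp add: nf_mult_x nf_x_mult)
  also have "\<dots> \<longleftrightarrow> (\<forall>j. of_nat (Suc j) * cf a (Suc j) = 0)"
    by (simp add: poly_eq_iff[of "pderiv (nf a)"] coeff_pderiv del: of_nat_Suc)
  also have "\<dots> \<longleftrightarrow> (\<forall>j. \<not> CHAR('k) dvd Suc j \<longrightarrow> cf a (Suc j) = 0)"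
    by (simp only: mult_eq_0_iff of_nat_eq_0_iff_char_dvd semiring_char_poly) blast
  also have "\<dots> \<longleftrightarrow> (\<forall>j. \<not> CHAR('k) dvd j \<longrightarrow> cf a j = 0)"
    by (metis dvd_0_right not0_implies_Suc)
  finally show ?thesis .
qed

lemma commutes_y_iff: "a * weyl_y = weyl_y * a \<longleftrightarrow> (\<forall>j. pderiv (cf a j) = 0)"
  by (subst nf_eq_iff[symmetric]) (simp add: nf_mult_y nf_y_mult poly_eq_iff[of "map_poly pderiv (nf a)"] coeff_map_poly)

lemma centralI:
  assumes "a * weyl_x = weyl_x * a" "a * weyl_y = weyl_y * a"
  shows "central a"
proof -
  have "a * b = b * a" for b
    by (induction b rule: weyl_induct)
      (auto simp: distrib_left distrib_right mult.assoc weyl_const_commute[of _ a, symmetric],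
        (metis assms mult.assoc weyl_const_commute)+)
  then show ?thesis by (simp add: central_def)
qed

lemma central_iff:
  assumes "CHAR('k::field) > 0"
  shows "central (a :: 'k weyl) \<longleftrightarrow>
    (\<forall>j. cf a j \<in> xp_ring) \<and> (\<forall>j. \<not> CHAR('k) dvd j \<longrightarrow> cf a j = 0)"
proof -
  have "central a \<longleftrightarrow> a * weyl_x = weyl_x * a \<and> a * weyl_y = weyl_y * a"
    using centralI by (auto simp: central_def)
  then show ?thesis
    by (auto simp: commutes_x_iff[OF assms] commutes_y_iff xp_ring_iff_pderiv[OF assms])
qed

lemma central_commute: "central a \<Longrightarrow> a * b = b * a"
  by (simp add: central_def)

lemma central_mult: "central a \<Longrightarrow> central b \<Longrightarrow> central (a * b)"
  and central_add: "central a \<Longrightarrow> central b \<Longrightarrow> central (a + b)"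
  unfolding central_def by (metis mult.assoc) (simp add: algebra_simps)

lemma central_xp_poly:
  assumes "CHAR('k::field) > 0" "(f :: 'k poly) \<in> xp_ring"
  shows "central (weyl_poly f)"
  using assms by (auto simp: central_iff cf_poly)

lemma weyl_poly_left_cancel:
  assumes "weyl_poly f * a = weyl_poly f * b" "f \<noteq> 0"
  shows "a = b"
proof (rule weyl_eqI)
  fix j
  have "f * cf a j = f * cf b j" using assms(1) cf_poly_mult by metis
  then show "cf a j = cf b j" using assms(2) by simp
qed

text \<open>Multiplying by \<open>f\<^sup>p\<^sup>-\<^sup>1\<close> turns the right factor \<open>f\<close> into the central factor \<open>f\<^sup>p\<close>, which can be
  cancelled on the left.\<close>

lemma weyl_poly_right_cancel:
  fixes f :: "'k::field poly"
  assumes p: "CHAR('k) > 0" and e: "a * weyl_poly f = b * weyl_poly f" and f: "f \<noteq> 0"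
  shows "a = b"
proof -
  have fp: "weyl_poly (f ^ CHAR('k)) = weyl_poly f * weyl_poly (f ^ (CHAR('k) - 1))"
    using p by (metis weyl_poly_mult power_minus_mult mult.commute)
  have "a * weyl_poly (f ^ CHAR('k)) = b * weyl_poly (f ^ CHAR('k))"
    unfolding fp mult.assoc[symmetric] e ..
  then have "weyl_poly (f ^ CHAR('k)) * a = weyl_poly (f ^ CHAR('k)) * b"
    using central_commute[OF central_xp_poly[OF p power_char_xp_ring[OF p]]] by metis
  then show ?thesis by (rule weyl_poly_left_cancel) (use f in simp)
qed

text \<open>An element commuting with \<open>x\<close> commutes with \<open>h\<close>; if it also commutes with \<open>yhat\<close>, the factor \<open>h\<close> of
  \<open>yhat = y h\<close> can be cancelled. So it is central in all of \<open>A\<^sub>1\<close>.\<close>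

lemma centre_A_h:
  fixes h :: "'k::field poly"
  assumes p: "CHAR('k) > 0" and h: "h \<noteq> 0"
  shows "centre (A_h h) = {a \<in> A_h h. central a}"
proof (intro equalityI subsetI)
  fix a
  assume a: "a \<in> centre (A_h h)"
  then have aA: "a \<in> A_h h" and comm: "\<And>b. b \<in> A_h h \<Longrightarrow> a * b = b * a"
    by (auto simp: centre_def)
  have "(a * weyl_y) * weyl_poly h = a * yhat h" by (simp add: yhat_def mult.assoc)
  also have "\<dots> = weyl_y * (weyl_poly h * a)" using comm[OF A_h_yhat] by (simp add: yhat_def mult.assoc)
  also have "\<dots> = (weyl_y * a) * weyl_poly h" using comm[OF A_h_poly[of h]] by (simp add: mult.assoc)
  finally have "a * weyl_y = weyl_y * a" by (rule weyl_poly_right_cancel[OF p _ h])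
  then show "a \<in> {a \<in> A_h h. central a}" using aA comm[OF A_h_x] by (auto intro: centralI)
qed (auto simp: centre_def central_def)

section \<open>The centre as a polynomial ring\<close>

lemma sum_coeff_pCons:
  fixes \<kappa> :: "'b::zero \<Rightarrow> 'a::ring_1"
  assumes "\<kappa> 0 = 0"
  shows "(\<Sum>i\<le>degree (pCons c q). \<kappa> (coeff (pCons c q) i) * w ^ i) =
    \<kappa> c + (\<Sum>i\<le>degree q. \<kappa> (coeff q i) * w ^ i) * w"
proof (cases "q = 0")
  case True
  then show ?thesis using assms by simp
next
  case False
  then show ?thesis
    by (simp add: sum.atMost_Suc_shift sum_distrib_right power_Suc2 mult.assoc del: sum.atMost_Suc power_Suc)
qed

lemma weyl_poly_monom: "weyl_poly (monom 1 n) = weyl_x ^ n"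
proof -
  have "monom 1 n = monom (1::'a) 1 ^ n" by (simp add: monom_power)
  then show ?thesis by (simp only: weyl_poly_power weyl_poly_x)
qed

lemma weyl_poly_xp_poly:
  fixes q :: "'k::field poly"
  shows "weyl_poly (xp_poly q) = (\<Sum>i\<le>degree q. weyl_const (coeff q i) * (weyl_x ^ CHAR('k)) ^ i)"
proof (induction q)
  case (pCons c q)
  have "xp_poly (pCons c q) = [:c:] + xp_poly q * monom 1 CHAR('k)"
    by (simp add: xp_poly_def pcompose_pCons mult.commute)
  then show ?case
    by (simp only: sum_coeff_pCons[where \<kappa> = weyl_const, OF weyl_const_0] weyl_poly_add weyl_poly_mult
        weyl_poly_monom weyl_poly_const pCons.IH)
qed simp

lemma ident_altdef: "ident h P = (\<Sum>j\<le>degree P. weyl_poly (xp_poly (coeff P j)) * z_h h ^ j)"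
  by (simp only: ident_def weyl_poly_xp_poly sum_distrib_right)

lemma ident_pCons: "ident h (pCons q P) = weyl_poly (xp_poly q) + ident h P * z_h h"
  unfolding ident_altdef by (rule sum_coeff_pCons) simp

lemma ident_0 [simp]: "ident h 0 = 0"
  by (simp add: ident_def)

lemma ident_const: "ident h [:q:] = weyl_poly (xp_poly q)"
  by (simp add: ident_pCons)

lemma ident_1 [simp]: "ident h 1 = 1"
  using ident_const[of h 1] by (simp add: one_pCons)

lemma ident_add: "ident h (P + Q) = ident h P + ident h Q"
  by (induction P Q rule: poly_induct2) (simp_all add: ident_pCons xp_poly_add weyl_poly_add algebra_simps)

lemma ident_smult: "ident h (smult q P) = weyl_poly (xp_poly q) * ident h P"
  by (induction P) (simp_all add: ident_pCons xp_poly_mult weyl_poly_mult distrib_left mult.assoc)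

lemma z_h_altdef: "z_h h = weyl_poly (h ^ CHAR('k)) * weyl_y ^ CHAR('k)" for h :: "'k::field poly"
  by (simp add: z_h_def weyl_poly_power)

lemma z_h_in_A_h: "z_h h \<in> A_h h"
  unfolding z_h_altdef by (rule A_h_monomial)

context
  fixes h :: "'k::field poly"
  assumes p: "CHAR('k) > 0" and h: "h \<noteq> 0"
begin

lemma central_z_h: "central (z_h h)"
  unfolding z_h_altdef central_iff[OF p] cf_monomial using power_char_xp_ring[OF p] by auto

lemma central_power_char: "central (weyl_poly (f ^ CHAR('k) :: 'k poly))"
  by (rule central_xp_poly[OF p power_char_xp_ring[OF p]])

lemma ident_mult: "ident h (P * Q) = ident h P * ident h Q"
proof (induction P)
  case (pCons a P)
  have "ident h P * z_h h * ident h Q = ident h P * ident h Q * z_h h"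
    using central_commute[OF central_z_h] by (simp add: mult.assoc)
  then show ?case by (simp add: ident_add ident_smult ident_pCons pCons.IH distrib_right)
qed simp

lemma cf_ident: "cf (ident h P) j = (if CHAR('k) dvd j then xp_poly (coeff P (j div CHAR('k))) * h ^ j else 0)"
proof (induction P arbitrary: j)
  case (pCons q P)
  have "ident h P * z_h h = weyl_poly (h ^ CHAR('k)) * (ident h P * weyl_y ^ CHAR('k))"
    using central_commute[OF central_power_char[of h], of "ident h P"]
    by (simp add: z_h_altdef mult.assoc[symmetric])
  then have e: "cf (ident h (pCons q P)) j = (if j = 0 then xp_poly q else 0) +
      h ^ CHAR('k) * (if j < CHAR('k) then 0 else cf (ident h P) (j - CHAR('k)))"
    by (simp add: ident_pCons cf_add cf_poly cf_poly_mult cf_mult_y_power)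
  show ?case
  proof (cases "j < CHAR('k)")
    case True
    then show ?thesis unfolding e by (auto dest: dvd_imp_le)
  next
    case False
    then obtain m where m: "j = CHAR('k) + m" using le_Suc_ex not_less by blast
    then show ?thesis unfolding e using p by (simp add: pCons.IH power_add mult_ac)
  qed
qed simp

lemma ident_inj: "inj (ident h)"
proof (rule injI)
  fix P Q
  assume e: "ident h P = ident h Q"
  show "P = Q"
  proof (rule poly_eqI)
    fix j
    have "cf (ident h P) (CHAR('k) * j) = cf (ident h Q) (CHAR('k) * j)" using e by simp
    then show "coeff P j = coeff Q j" using p h by (simp add: cf_ident xp_poly_eq_iff[OF p])
  qed
qed

lemma ident_eq_iff: "ident h P = ident h Q \<longleftrightarrow> P = Q"
  using ident_inj by (auto dest: injD)

lemma central_ident: "central (ident h P)"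
  by (induction P)
    (auto simp: ident_pCons central_def[of 0] intro!: central_add central_mult central_z_h central_xp_poly[OF p])

lemma ident_in_A_h: "ident h P \<in> A_h h"
  by (induction P) (auto simp: ident_pCons intro!: A_h_0 A_h_add A_h_mult A_h_poly z_h_in_A_h)

text \<open>How membership in \<open>Z f\<close> is recognised from coefficients.\<close>

lemma ident_multipleE:
  assumes "\<And>j. cf a j \<noteq> 0 \<Longrightarrow> CHAR('k) dvd j" and "\<And>j. \<exists>q\<in>xp_ring. cf a (CHAR('k) * j) = q * h ^ (CHAR('k) * j) * f"
  obtains P where "a = weyl_poly f * ident h P"
proof -
  obtain q where q: "\<And>j. q j \<in> xp_ring" "\<And>j. cf a (CHAR('k) * j) = q j * h ^ (CHAR('k) * j) * f"
    using assms(2) by metis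
  define P where "P = (\<Sum>j\<le>degree (nf a). monom (the_inv xp_poly (q j)) j)"
  have P: "coeff P j = (if j \<le> degree (nf a) then the_inv xp_poly (q j) else 0)" for j
    by (simp add: P_def coeff_sum)
  have "a = weyl_poly f * ident h P"
  proof (rule weyl_eqI)
    fix j
    show "cf a j = cf (weyl_poly f * ident h P) j"
    proof (cases "CHAR('k) dvd j")
      case True
      then obtain m where m: "j = CHAR('k) * m" by auto
      show ?thesis
      proof (cases "m \<le> degree (nf a)")
        case True
        then show ?thesis using m p q(2)[of m]
          by (simp add: cf_poly_mult cf_ident P xp_poly_the_inv[OF p q(1)] mult_ac)
      next
        case False
        then have "degree (nf a) < m" by simp
        also have "m \<le> CHAR('k) * m" using p by simp
        finally have "cf a j = 0" using m by (simp add: coeff_eq_0)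
        then show ?thesis using m p False by (simp add: cf_poly_mult cf_ident P)
      qed
    next
      case False
      then show ?thesis using assms(1)[of j] by (auto simp: cf_poly_mult cf_ident)
    qed
  qed
  then show ?thesis using that by blast
qed

text \<open>A central element has coefficients in \<open>\<F>[x\<^sup>p]\<close> and only powers of \<open>y\<^sup>p\<close>. If it lies in \<open>A\<^sub>h\<close>, its
  coefficient at \<open>y\<^sup>p\<^sup>m\<close> is divisible by \<open>h\<^sup>p\<^sup>m\<close>, and the quotient is again in \<open>\<F>[x\<^sup>p]\<close>.\<close>

lemma centre_eq_range: "centre (A_h h) = range (ident h)"
proof (intro equalityI subsetI)
  fix a
  assume "a \<in> centre (A_h h)"
  then have a: "a \<in> A_h h" "\<And>j. cf a j \<in> xp_ring" "\<And>j. \<not> CHAR('k) dvd j \<Longrightarrow> cf a j = 0"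
    by (auto simp: centre_A_h[OF p h] central_iff[OF p])
  have q: "\<exists>q\<in>xp_ring. cf a (CHAR('k) * j) = q * h ^ (CHAR('k) * j) * 1" for j
  proof -
    have "h ^ (CHAR('k) * j) dvd cf a (CHAR('k) * j)" using a(1) by (simp add: A_h_iff)
    then have "xp_dvd (h ^ (CHAR('k) * j)) (cf a (CHAR('k) * j))"
      using a(2) xp_ring_power[OF power_char_xp_ring[OF p, of h], of j]
      by (simp add: xp_dvd_iff[OF p] power_mult)
    then show ?thesis by (auto simp: xp_dvd_def mult.commute)
  qed
  obtain P where "a = weyl_poly 1 * ident h P" by (rule ident_multipleE[OF _ q]) (use a(3) in blast)
  then show "a \<in> range (ident h)" by simp
next
  fix a
  assume "a \<in> range (ident h)"
  then show "a \<in> centre (A_h h)" using ident_in_A_h central_ident by (auto simp: centre_A_h[OF p h])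
qed

lemma ident_algebra_iso: "algebra_iso const12 UNIV weyl_const (centre (A_h h)) (ident h)"
  unfolding algebra_iso_def
  by (auto simp: bij_betw_def ident_inj centre_eq_range ident_add ident_mult const12_def ident_const)

lemma inv_ident [simp]: "inv (ident h) (ident h P) = P"
  by (rule inv_f_f[OF ident_inj])

lemma ident_t2: "ident h [:0, 1:] = z_h h"
  by (simp add: ident_pCons)

lemma ident_t1: "ident h [:[:0, 1:]:] = weyl_x ^ CHAR('k)"
  by (simp add: ident_const xp_poly_def pcompose_pCons weyl_poly_monom)

lemma ident_in_t1: "f \<in> xp_ring \<Longrightarrow> ident h (in_t1 f) = weyl_poly f"
  by (simp add: in_t1_def ident_const xp_poly_the_inv[OF p])

end

section \<open>Constructing derivations of \<open>A\<^sub>h\<close>\<close>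

lemma weyl_derivationD:
  assumes "weyl_derivation d"
  shows "d (a + b) = d a + d b" "d (a * b) = d a * b + a * d b" "d (weyl_const c) = 0"
  using assms by (auto simp: weyl_derivation_def)

lemma weyl_derivation_0:
  assumes "weyl_derivation d"
  shows "d 0 = 0" "d 1 = 0"
  using weyl_derivationD(3)[OF assms, of 0] weyl_derivationD(3)[OF assms, of 1] by simp_all

lemma derivationsD:
  assumes "D \<in> derivations \<kappa> A"
  shows "a \<in> A \<Longrightarrow> D a \<in> A" "a \<notin> A \<Longrightarrow> D a = 0"
    "a \<in> A \<Longrightarrow> b \<in> A \<Longrightarrow> D (a + b) = D a + D b"
    "a \<in> A \<Longrightarrow> D (\<kappa> c * a) = \<kappa> c * D a"
    "a \<in> A \<Longrightarrow> b \<in> A \<Longrightarrow> D (a * b) = D a * b + a * D b"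
  using assms by (auto simp: derivations_def)

lemma A_h_induct [consumes 1, case_names const x yhat add mult]:
  assumes "a \<in> A_h h" and "\<And>c. P (weyl_const c)" "P weyl_x" "P (yhat h)"
    and "\<And>a b. a \<in> A_h h \<Longrightarrow> b \<in> A_h h \<Longrightarrow> P a \<Longrightarrow> P b \<Longrightarrow> P (a + b)"
    and "\<And>a b. a \<in> A_h h \<Longrightarrow> b \<in> A_h h \<Longrightarrow> P a \<Longrightarrow> P b \<Longrightarrow> P (a * b)"
  shows "P a"
proof -
  define S where "S = {a \<in> A_h h. P a}"
  have "subalgebra weyl_const S" unfolding subalgebra_def S_def
    using assms(2,5,6) by (auto intro: A_h_const A_h_add A_h_mult)
  moreover have "{weyl_x, yhat h} \<subseteq> S" using assms(3,4) by (auto simp: S_def A_h_x A_h_yhat)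
  ultimately have "A_h h \<subseteq> S" unfolding A_h_def by (intro hull_minimal)
  then show ?thesis using assms(1) by (auto simp: S_def)
qed

text \<open>A way to obtain derivations of \<open>A\<^sub>h\<close> that need not extend to \<open>A\<^sub>1\<close>: take one of \<open>A\<^sub>1\<close> whose values on
  the generators of \<open>A\<^sub>h\<close> are divisible by a central polynomial \<open>q\<close>, and divide by \<open>q\<close>.\<close>

lemma derivation_divided:
  fixes h q :: "'k::field poly"
  assumes d: "weyl_derivation d" and q: "central (weyl_poly q)" "q \<noteq> 0"
    and u: "u \<in> A_h h" "d weyl_x = weyl_poly q * u" and v: "v \<in> A_h h" "d (yhat h) = weyl_poly q * v"
  obtains D where "D \<in> derivations weyl_const (A_h h)" "\<And>a. a \<in> A_h h \<Longrightarrow> weyl_poly q * D a = d a"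
proof -
  note comm = central_commute[OF q(1), symmetric]
  have "\<exists>b\<in>A_h h. d a = weyl_poly q * b" if "a \<in> A_h h" for a
    using that
  proof (induction a rule: A_h_induct)
    case (const c)
    show ?case using A_h_0 by (auto simp: weyl_derivationD[OF d] intro!: bexI[of _ 0])
  next
    case (add a b)
    then obtain a' b' where "a' \<in> A_h h" "d a = weyl_poly q * a'" "b' \<in> A_h h" "d b = weyl_poly q * b'" by blast
    then show ?case
      by (intro bexI[of _ "a' + b'"]) (auto simp: weyl_derivationD[OF d] distrib_left intro: A_h_add)
  next
    case (mult a b)
    then obtain a' b' where "a' \<in> A_h h" "d a = weyl_poly q * a'" "b' \<in> A_h h" "d b = weyl_poly q * b'" by blast
    then show ?case using mult.hyps
      by (intro bexI[of _ "a' * b + a * b'"])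
        (auto simp: weyl_derivationD[OF d] distrib_left mult.assoc[symmetric] comm intro: A_h_add A_h_mult)
  qed (use u v in auto)
  then obtain e where e: "\<And>a. a \<in> A_h h \<Longrightarrow> e a \<in> A_h h" "\<And>a. a \<in> A_h h \<Longrightarrow> d a = weyl_poly q * e a"
    by metis
  have cancel: "a = b" if "weyl_poly q * a = weyl_poly q * b" for a b
    using weyl_poly_left_cancel[OF that q(2)] .
  define D where "D = restrict0 (A_h h) e"
  have D: "D a = e a" if "a \<in> A_h h" for a using that by (simp add: D_def restrict0_def)
  have "D \<in> derivations weyl_const (A_h h)" unfolding derivations_def mem_Collect_eq
  proof (intro conjI ballI allI impI)
    fix a b assume ab: "a \<in> A_h h" "b \<in> A_h h"
    show "D (a + b) = D a + D b"
      by (rule cancel) (use ab in \<open>simp add: D A_h_add distrib_left e(2)[symmetric] weyl_derivationD[OF d]\<close>)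
    show "D (a * b) = D a * b + a * D b"
    proof (rule cancel)
      have "weyl_poly q * D (a * b) = d a * b + a * d b"
        using ab by (simp add: D A_h_mult e(2)[symmetric] weyl_derivationD[OF d])
      also have "a * d b = weyl_poly q * (a * D b)"
        using ab by (simp add: D e(2)) (simp only: mult.assoc[symmetric] comm)
      finally show "weyl_poly q * D (a * b) = weyl_poly q * (D a * b + a * D b)"
        using ab by (simp add: D e(2) distrib_left mult.assoc)
    qed
  next
    fix a c assume a: "a \<in> A_h h"
    show "D (weyl_const c * a) = weyl_const c * D a"
    proof (rule cancel)
      have "weyl_poly q * D (weyl_const c * a) = weyl_const c * d a"
        using a by (simp add: D A_h_mult A_h_const e(2)[symmetric] weyl_derivationD[OF d])
      then show "weyl_poly q * D (weyl_const c * a) = weyl_poly q * (weyl_const c * D a)"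
        using a by (simp add: D e(2)) (simp only: mult.assoc[symmetric] comm)
    qed
  qed (auto simp: D_def restrict0_def e(1))
  then show ?thesis using that D e by metis
qed

lemma derivations_combine:
  assumes A: "A = A_h h" and D: "D \<in> derivations weyl_const A" and E: "E \<in> derivations weyl_const A" and z: "z \<in> centre A"
  shows "(\<lambda>a. D a + z * E a) \<in> derivations weyl_const A"
proof -
  have zA: "z \<in> A" and zc: "\<And>a. a \<in> A \<Longrightarrow> z * a = a * z" using z by (auto simp: centre_def)
  have zl: "a * (z * b) = z * (a * b)" if "a \<in> A" for a b using zc[OF that] by (metis mult.assoc)
  show ?thesis unfolding derivations_def mem_Collect_eq
    using derivationsD[OF D] derivationsD[OF E] zA A
    by (auto simp: A_h_add A_h_mult A_h_const zl algebra_simps)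
qed

lemma derivations_zero: "(\<lambda>_. 0) \<in> derivations weyl_const (A_h h)"
  by (auto simp: derivations_def A_h_0)

lemma derivations_power:
  assumes D: "D \<in> derivations weyl_const (A_h h)" and u: "u \<in> A_h h"
  shows "D 1 = 0" "D (u ^ Suc n) = D u * u ^ n + u * D (u ^ n)"
proof -
  show "D 1 = 0" using derivationsD(5)[OF D A_h_1 A_h_1] by simp
  show "D (u ^ Suc n) = D u * u ^ n + u * D (u ^ n)"
    using derivationsD(5)[OF D u A_h_power[OF u]] by simp
qed

lemma derivations_const:
  assumes D: "D \<in> derivations weyl_const (A_h h)"
  shows "D (weyl_const c) = 0"
  using derivationsD(4)[OF D A_h_1, of c] derivations_power(1)[OF D A_h_1] by simp

lemma derivations_centre:
  assumes D: "D \<in> derivations weyl_const (A_h h)" and z: "z \<in> centre (A_h h)"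
  shows "D z \<in> centre (A_h h)"
proof -
  have zA: "z \<in> A_h h" and zc: "\<And>a. a \<in> A_h h \<Longrightarrow> z * a = a * z" using z by (auto simp: centre_def)
  have "D z * a = a * D z" if a: "a \<in> A_h h" for a
  proof -
    have "D z * a + z * D a = D a * z + a * D z"
      using arg_cong[OF zc[OF a], of D] derivationsD(5)[OF D] a zA by simp
    then show ?thesis using zc[OF derivationsD(1)[OF D a]] by (simp add: add.commute)
  qed
  then show ?thesis using derivationsD(1)[OF D zA] by (simp add: centre_def)
qed

lemma weyl_derivation_poly:
  assumes d: "weyl_derivation d" and "d weyl_x = 0"
  shows "d (weyl_poly f) = 0"
  by (induction f) (use assms in \<open>simp_all add: weyl_poly_pCons weyl_derivationD[OF d] weyl_derivation_0[OF d]\<close>)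

lemma commutes_x_poly:
  assumes "a * weyl_x = weyl_x * a"
  shows "a * weyl_poly f = weyl_poly f * a"
proof (induction f)
  case (pCons c f)
  have "a * (weyl_x * weyl_poly f) = weyl_x * weyl_poly f * a"
    using pCons.IH assms by (metis mult.assoc)
  then show ?case by (simp add: weyl_poly_pCons distrib_left distrib_right weyl_const_commute)
qed simp

context
  fixes h :: "'k::field poly"
  assumes p: "CHAR('k) > 0" and h: "h \<noteq> 0"
begin

lemma power_char_pred: "f ^ CHAR('k) = f * f ^ (CHAR('k) - 1)" for f :: "'b::monoid_mult"
  using p by (simp add: power_eq_if)

lemma weyl_derivation_power_char:
  fixes d :: "'k weyl \<Rightarrow> 'k weyl"
  assumes d: "weyl_derivation d"
  shows "d (u ^ CHAR('k)) = (ad u ^^ (CHAR('k) - 1)) (d u)"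
  by (rule leibniz_power_char[OF p]) (simp_all add: weyl_derivationD[OF d] weyl_derivation_0[OF d])

lemma derivations_power_char:
  assumes D: "D \<in> derivations weyl_const (A_h h)" and u: "u \<in> A_h h"
  shows "D (u ^ CHAR('k)) = (ad u ^^ (CHAR('k) - 1)) (D u)"
  by (rule leibniz_power_char[OF p derivations_power[OF D u]])

text \<open>The derivation \<open>x \<mapsto> 0\<close>, \<open>yhat \<mapsto> g\<close>, with \<open>g\<close> chosen so that \<open>(d/dx)\<^sup>p\<^sup>-\<^sup>1(h\<^sup>p\<^sup>-\<^sup>1 g) = hbar\<close>. On \<open>y\<close> it
  would have to be \<open>g/h\<close>; its multiple by \<open>h\<^sup>p\<close> is a derivation of \<open>A\<^sub>1\<close>.\<close>

lemma derivation_zh_exists: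
  obtains D where "D \<in> derivations weyl_const (A_h h)" "D (weyl_x ^ CHAR('k)) = 0"
    "D (z_h h) = weyl_poly (hbar h)"
proof -
  obtain g where g: "top_deriv (h ^ (CHAR('k) - 1) * g) = hbar h"
    using hbar_eq_top_deriv[OF p h] by blast
  let ?H = "weyl_poly (h ^ CHAR('k))"
  have H: "central ?H" by (rule central_power_char[OF p h])
  define v where "v = weyl_poly (h ^ (CHAR('k) - 1) * g)"
  have "v * weyl_x = weyl_x * v" unfolding v_def using weyl_poly_commutes_x by blast
  then obtain d where d: "weyl_derivation d" "d weyl_x = 0" "d weyl_y = v"
    using weyl_derivation_exists[of v 0] by auto
  have yh: "d (yhat h) = ?H * weyl_poly g"
    unfolding yhat_def
    by (simp add: weyl_derivationD[OF d(1)] weyl_derivation_poly[OF d(1,2)] d(3) v_def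
        weyl_poly_mult[symmetric] power_char_pred[of h] mult_ac)
  obtain D where D: "D \<in> derivations weyl_const (A_h h)" "\<And>a. a \<in> A_h h \<Longrightarrow> ?H * D a = d a"
    using derivation_divided[OF d(1) H _ A_h_0 _ A_h_poly yh] h d(2) by auto
  have hp0: "h ^ CHAR('k) \<noteq> 0" using h by simp
  note cancel = weyl_poly_left_cancel[OF _ hp0]
  have "D weyl_x = 0" using cancel[of "D weyl_x" 0] D(2)[OF A_h_x] d by simp
  then have "D (weyl_x ^ CHAR('k)) = 0"
    unfolding derivations_power_char[OF D(1) A_h_x] by (intro weyl_eqI) (simp add: cf_ad_x)
  moreover have "D (z_h h) = weyl_poly (hbar h)"
  proof (rule cancel)
    have "?H * D (z_h h) = ?H * (ad weyl_y ^^ (CHAR('k) - 1)) v"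
      unfolding D(2)[OF z_h_in_A_h]
      by (simp add: z_h_altdef weyl_derivationD[OF d(1)] weyl_derivation_poly[OF d(1,2)]
          weyl_derivation_power_char[OF d(1)] d(3))
    also have "(ad weyl_y ^^ (CHAR('k) - 1)) v = weyl_poly (hbar h)"
      by (rule weyl_eqI) (simp add: cf_ad_y v_def cf_poly g[unfolded top_deriv_def One_nat_def])
    finally show "?H * D (z_h h) = ?H * weyl_poly (hbar h)" .
  qed
  ultimately show ?thesis using that D(1) by blast
qed

text \<open>Let \<open>E\<close> be the derivation \<open>x \<mapsto> y\<^sup>p\<^sup>-\<^sup>1\<close>, \<open>y \<mapsto> 0\<close> of \<open>A\<^sub>1\<close>. It satisfies \<open>E(x\<^sup>p) = w\<close> with
  \<open>w = (-1)\<^sup>p\<^sup>-\<^sup>1 (p-1)!\<close>, so \<open>w\<^sup>-\<^sup>1 (h\<^sup>p/\<rho>) E\<close> has the right value on \<open>x\<^sup>p\<close>. What has to be checked is that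
  it maps \<open>x\<close> and \<open>yhat\<close> into \<open>A\<^sub>h\<close> and that its value on \<open>z\<^sub>h\<close> is a multiple of \<open>hbar\<close>.\<close>

lemma derivation_xp_exists:
  obtains D c where "D \<in> derivations weyl_const (A_h h)"
    "D (weyl_x ^ CHAR('k)) = weyl_poly (h ^ CHAR('k) div rho h)"
    "c \<in> xp_ring" "D (z_h h) = weyl_poly (hbar h * c) * z_h h"
proof -
  let ?n = "CHAR('k) - 1"
  define w where "w = (- 1) ^ ?n * (of_nat (fact ?n) :: 'k)"
  have w0: "w \<noteq> 0" unfolding w_def using of_nat_fact_neq_0[OF p] by simp
  obtain E :: "'k weyl \<Rightarrow> 'k weyl" where E: "weyl_derivation E" "E weyl_x = weyl_y ^ ?n" "E weyl_y = 0"
    using weyl_derivation_exists[of 0 "weyl_y ^ ?n"] by (auto simp: power_commutes)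
  have cfE: "j > ?n \<Longrightarrow> cf (E (weyl_poly f)) j = 0" "cf (E (weyl_poly f)) ?n = pderiv f" for f j
  proof (induction f arbitrary: j)
    case (pCons c f)
    have e: "E (weyl_poly (pCons c f)) = weyl_y ^ ?n * weyl_poly f + weyl_x * E (weyl_poly f)"
      by (simp add: weyl_poly_pCons weyl_derivationD[OF E(1)] E(2))
    have x: "cf (weyl_x * a) j = monom 1 1 * cf a j" for a :: "'k weyl" and j
      using cf_poly_mult[of "monom 1 1" a j] unfolding weyl_poly_x .
    {
      case 1
      then show ?case using pCons.IH(1) by (simp add: e cf_add cf_y_power_poly x binomial_eq_0)
    next
      case 2
      show ?case using pCons.IH(2) by (simp add: e cf_add cf_y_power_poly x pderiv_pCons monom_altdef)
    }
  qed (simp_all add: weyl_derivation_0[OF E(1)])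
  have Ep: "E (weyl_poly f ^ CHAR('k)) = weyl_poly (smult w (pderiv f ^ CHAR('k)))" for f
  proof -
    have "E (weyl_poly f ^ CHAR('k)) = weyl_poly ((- 1) ^ ?n * (of_nat (fact ?n) * (pderiv f ^ ?n * pderiv f)))"
      unfolding weyl_derivation_power_char[OF E(1)]
      by (subst cf_ad_poly_power) (simp_all only: cfE)
    also have "(- 1) ^ ?n * (of_nat (fact ?n) * (pderiv f ^ ?n * pderiv f)) = smult w (pderiv f ^ CHAR('k))"
    proof -
      have "(- 1 :: 'k poly) ^ ?n = [:(- 1) ^ ?n:]"
        using poly_const_pow[of "- 1 :: 'k" ?n] by (simp add: one_pCons)
      then show ?thesis
        unfolding power_char_pred[of "pderiv f"] w_def of_nat_poly by (simp add: mult.commute)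
    qed
    finally show ?thesis .
  qed
  define r where "r = h ^ CHAR('k) div rho h"
  obtain k where k: "h = rho h * k" using rho_properties(3)[OF p h] by auto
  have dh: "pderiv h = rho h * pderiv k"
    using rho_properties(1)[OF p h] by (subst k) (simp add: pderiv_mult xp_ring_iff_pderiv[OF p])
  have rk: "r = k * h ^ ?n"
  proof -
    have "rho h * r = rho h * (k * h ^ ?n)"
      unfolding r_def power_char_div_rho(1)[OF p h] power_char_pred[of h] by (subst k) (simp add: mult.assoc)
    then show ?thesis using rho_properties(2)[OF p h] by simp
  qed
  define c where "c = smult (inverse w) r"
  have cz: "central (weyl_poly c)"
    using power_char_div_rho(2)[OF p h] by (intro central_xp_poly[OF p]) (simp add: c_def r_def xp_ring_smult)
  define d where "d = (\<lambda>a. weyl_poly c * E a)"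
  have cl: "a * (weyl_poly c * b) = weyl_poly c * (a * b)" for a b
    using central_commute[OF cz] by (metis mult.assoc)
  have d: "weyl_derivation d" unfolding weyl_derivation_def d_def
    by (auto simp: weyl_derivationD[OF E(1)] distrib_left mult.assoc cl)
  have u: "d weyl_x \<in> A_h h"
  proof -
    have "h ^ ?n dvd c" by (simp add: c_def rk smult_dvd_iff dvd_smult)
    then show ?thesis by (auto simp: A_h_iff d_def E(2) cf_monomial)
  qed
  have v: "d (yhat h) \<in> A_h h"
  proof -
    define a where "a = weyl_poly c * E (weyl_poly h)"
    have e: "d (yhat h) = weyl_y * a"
      by (simp add: d_def yhat_def weyl_derivationD[OF E(1)] E(3) cl a_def)
    have a: "h ^ Suc j dvd cf a j" for j
    proof -
      \<comment> \<open>Only the coefficient at \<open>y\<^sup>p\<^sup>-\<^sup>1\<close> is critical: there the missing factor \<open>h\<close> comes from \<open>h' = \<rho> (h/\<rho>)'\<close>.\<close>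
      consider "j < ?n" | "j = ?n" | "j > ?n" by linarith
      then show ?thesis
      proof cases
        case 1
        have "h ^ Suc j dvd h ^ ?n" using 1 by (intro le_imp_power_dvd) simp
        then show ?thesis by (simp add: a_def cf_poly_mult c_def rk dvd_smult dvd_mult dvd_mult2 del: power_Suc)
      next
        case 2
        have "r * pderiv h = h * h ^ ?n * pderiv k"
          unfolding rk dh by (subst (2) k) (simp add: mult_ac)
        then have "h ^ Suc ?n dvd r * pderiv h" by simp
        then show ?thesis by (simp add: 2 a_def cf_poly_mult c_def cfE(2)[unfolded One_nat_def] dvd_smult del: power_Suc)
      next
        case 3
        then show ?thesis by (simp add: a_def cf_poly_mult cfE(1))
      qed
    qed
    have "h ^ j dvd cf (weyl_y * a) j" for j
    proof -
      have "h ^ j dvd pderiv (cf a j)" using dvd_higher_pderiv[OF a[of j], of 1] by simp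
      moreover have "j \<noteq> 0 \<Longrightarrow> h ^ j dvd cf a (j - 1)" using a[of "j - 1"] by simp
      ultimately show ?thesis by (auto simp: cf_y_mult)
    qed
    then show ?thesis by (simp add: A_h_iff e)
  qed
  obtain D where D: "D \<in> derivations weyl_const (A_h h)" "\<And>a. a \<in> A_h h \<Longrightarrow> D a = d a"
    using derivation_divided[OF d _ _ u _ v, of 1] by (auto simp: central_def)
  have "D (weyl_x ^ CHAR('k)) = weyl_poly c * weyl_poly (smult w 1)"
    using Ep[of "monom 1 1"] unfolding D(2)[OF A_h_power[OF A_h_x]] d_def weyl_poly_x
    by (simp add: pderiv_monom monom_0 flip: one_pCons)
  also have "\<dots> = weyl_poly r" by (simp only: weyl_poly_mult[symmetric]) (simp add: c_def w0)
  finally have D1: "D (weyl_x ^ CHAR('k)) = weyl_poly r" .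
  obtain e where e: "e \<in> xp_ring" "top_deriv (h ^ ?n * pderiv k) = hbar h * e"
    using hbar_dvd_top_deriv[OF p h] by blast
  define e' where "e' = smult (inverse (of_nat (fact ?n))) e"
  have e': "pderiv h ^ CHAR('k) = rho h * (hbar h * e')"
  proof -
    have "smult (of_nat (fact ?n)) (pderiv h ^ CHAR('k)) = top_deriv (h ^ ?n * pderiv h)"
      by (rule top_deriv_log[OF p, symmetric])
    also have "h ^ ?n * pderiv h = rho h * (h ^ ?n * pderiv k)"
      by (simp only: dh mult.left_commute)
    also have "top_deriv \<dots> = rho h * (hbar h * e)"
      by (simp only: top_deriv_xp_mult[OF p rho_properties(1)[OF p h]] e(2))
    finally have "smult (inverse (of_nat (fact ?n))) (smult (of_nat (fact ?n)) (pderiv h ^ CHAR('k))) =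
        smult (inverse (of_nat (fact ?n))) (rho h * (hbar h * e))" by simp
    then show ?thesis using of_nat_fact_neq_0[OF p] by (simp add: e'_def)
  qed
  have "E (weyl_y ^ CHAR('k)) = 0"
    unfolding weyl_derivation_power_char[OF E(1)] E(3) by (intro weyl_eqI) (simp add: cf_ad_y)
  then have "D (z_h h) = weyl_poly (c * smult w (pderiv h ^ CHAR('k))) * weyl_y ^ CHAR('k)"
    unfolding D(2)[OF z_h_in_A_h]
    by (simp only: d_def z_h_def weyl_derivationD(2)[OF E(1)] Ep weyl_poly_mult mult.assoc mult_zero_right add_0_right)
  also have "c * smult w (pderiv h ^ CHAR('k)) = hbar h * e' * h ^ CHAR('k)"
  proof -
    have "c * smult w (pderiv h ^ CHAR('k)) = (rho h * r) * (hbar h * e')"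
      using w0 by (simp add: c_def e' mult_ac)
    then show ?thesis by (simp add: r_def power_char_div_rho(1)[OF p h] mult_ac)
  qed
  finally have "D (z_h h) = weyl_poly (hbar h * e') * z_h h"
    by (simp add: z_h_altdef weyl_poly_mult mult.assoc)
  moreover have "e' \<in> xp_ring" using e(1) by (simp add: e'_def xp_ring_smult)
  ultimately show ?thesis using that D(1) D1 unfolding r_def by blast
qed

end

section \<open>The values of a derivation on the generators of the centre\<close>

lemma A_h_derivation_eqI:
  assumes "a \<in> A_h h" and c: "\<And>c. F (weyl_const c) = G (weyl_const c)" and x: "F weyl_x = G weyl_x"
    and y: "F (yhat h) = G (yhat h)"
    and F: "\<And>a b. a \<in> A_h h \<Longrightarrow> b \<in> A_h h \<Longrightarrow> F (a + b) = F a + F b \<and> F (a * b) = F a * b + a * F b"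
    and G: "\<And>a b. a \<in> A_h h \<Longrightarrow> b \<in> A_h h \<Longrightarrow> G (a + b) = G a + G b \<and> G (a * b) = G a * b + a * G b"
  shows "F a = (G a :: 'k::field weyl)"
  using assms(1) by (induction a rule: A_h_induct) (simp_all add: c x y F G)

text \<open>All terms of the Leibniz rule other than the leading one involve coefficients of \<open>w\<close> of index
  above \<open>i\<close>.\<close>

lemma cf_mult_poly_diff_dvd:
  assumes "\<And>l. l > i \<Longrightarrow> q dvd cf w l"
  shows "q dvd cf (w * weyl_poly f) i - f * cf w i"
proof -
  let ?t = "\<lambda>j. cf w j * (of_nat (j choose i) * (pderiv ^^ (j - i)) f)"
  define N where "N = max i (degree (nf w))"
  have "cf (w * weyl_poly f) i = (\<Sum>j\<le>N. ?t j)"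
    by (rule cf_mult_poly_bounded) (simp add: N_def coeff_eq_0)
  also have "\<dots> = ?t i + (\<Sum>j\<in>{..N} - {i}. ?t j)"
    by (rule sum.remove) (auto simp: N_def)
  finally have "cf (w * weyl_poly f) i - f * cf w i = (\<Sum>j\<in>{..N} - {i}. ?t j)" by (simp add: mult.commute)
  also have "q dvd \<dots>"
  proof (rule dvd_sum)
    fix j assume "j \<in> {..N} - {i}"
    then consider "j < i" | "j > i" by fastforce
    then show "q dvd ?t j" by cases (auto simp: binomial_eq_0 intro: assms dvd_mult2)
  qed
  finally show ?thesis .
qed

context
  fixes h :: "'k::field poly"
  assumes p: "CHAR('k) > 0" and h: "h \<noteq> 0"
begin

lemma xp_power_in_centre: "weyl_x ^ CHAR('k) \<in> centre (A_h h)"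
  unfolding ident_t1[OF p h, symmetric] centre_eq_range[OF p h] by simp

text \<open>The coefficient of \<open>D(x\<^sup>p)\<close> at \<open>y\<^sup>p\<^sup>m\<close> is a scalar multiple of that of \<open>D x\<close> at \<open>y\<^sup>p\<^sup>m\<^sup>+\<^sup>p\<^sup>-\<^sup>1\<close>, hence
  divisible by \<open>h\<^sup>p\<^sup>m\<^sup>+\<^sup>p\<^sup>-\<^sup>1\<close>.\<close>

lemma derivations_xp:
  assumes D: "D \<in> derivations weyl_const (A_h h)"
  obtains P where "D (weyl_x ^ CHAR('k)) = weyl_poly (h ^ CHAR('k) div rho h) * ident h P"
proof -
  define c where "c = D (weyl_x ^ CHAR('k))"
  let ?n = "CHAR('k) - 1"
  have cc: "c \<in> centre (A_h h)" unfolding c_def by (rule derivations_centre[OF D xp_power_in_centre])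
  then have c: "\<And>j. cf c j \<in> xp_ring" "\<And>j. cf c j \<noteq> 0 \<Longrightarrow> CHAR('k) dvd j"
    by (auto simp: centre_A_h[OF p h] central_iff[OF p])
  have a: "h ^ j dvd cf (D weyl_x) j" for j
    using derivationsD(1)[OF D A_h_x] by (simp add: A_h_iff)
  have q: "\<exists>q\<in>xp_ring. cf c (CHAR('k) * j) = q * h ^ (CHAR('k) * j) * (h ^ CHAR('k) div rho h)" for j
  proof -
    have "h ^ (CHAR('k) * j + ?n) dvd cf c (CHAR('k) * j)"
      unfolding c_def derivations_power_char[OF p h D A_h_x] cf_ad_x by (intro dvd_mult a)
    then obtain u where u: "cf c (CHAR('k) * j) = h ^ (CHAR('k) * j) * (h ^ ?n * u)"
      by (metis dvdE power_add mult.assoc)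
    have hj: "h ^ (CHAR('k) * j) \<in> xp_ring" "h ^ (CHAR('k) * j) \<noteq> 0"
      using xp_ring_power[OF power_char_xp_ring[OF p, of h], of j] h by (simp_all add: power_mult)
    have "h ^ ?n * u \<in> xp_ring"
      using xp_ring_cancel[OF p hj] c(1)[of "CHAR('k) * j"] u by metis
    then obtain d where "d \<in> xp_ring" "h ^ ?n * u = (h ^ CHAR('k) div rho h) * d"
      using power_char_div_rho_dvd[OF p h] by (metis dvd_triv_left)
    then show ?thesis using u by (intro bexI[of _ d]) (simp_all add: mult_ac)
  qed
  show ?thesis by (rule ident_multipleE[OF p h c(2) q]) (simp_all add: that c_def)
qed

text \<open>Since \<open>[-,x]\<close> is the derivative in \<open>y\<close>, one integrates coefficientwise, which is possible when
  no exponent \<open>p m - 1\<close> occurs. The factor \<open>h\<close> pays for the raised power of \<open>y\<close>.\<close>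

lemma commutator_x_primitive:
  assumes a: "a \<in> A_h h" and z: "\<And>j. CHAR('k) dvd Suc j \<Longrightarrow> cf a j = 0"
  obtains w where "w \<in> A_h h" "w * weyl_x - weyl_x * w = weyl_poly h * a" "\<And>j. CHAR('k) dvd j \<Longrightarrow> cf w j = 0"
proof -
  define W where "W = (\<Sum>j\<le>degree (nf a). monom (smult (inverse (of_nat (Suc j))) (h * cf a j)) (Suc j))"
  have W: "coeff W (Suc j) = smult (inverse (of_nat (Suc j))) (h * cf a j)" for j
    by (cases "j \<le> degree (nf a)") (simp_all add: W_def coeff_sum coeff_eq_0 del: of_nat_Suc)
  have W0: "coeff W 0 = 0" by (simp add: W_def coeff_sum)
  define w where "w = of_nf W"
  have cfw: "cf w 0 = 0" "cf w (Suc j) = smult (inverse (of_nat (Suc j))) (h * cf a j)" for j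
    by (simp_all add: w_def W W0 del: of_nat_Suc)
  have "h ^ j dvd cf w j" for j
    using a by (cases j) (auto simp: cfw A_h_iff dvd_smult mult_dvd_mono simp del: of_nat_Suc)
  then have "w \<in> A_h h" by (simp add: A_h_iff)
  moreover have "w * weyl_x - weyl_x * w = weyl_poly h * a"
  proof (rule weyl_eqI)
    fix j
    have "cf (w * weyl_x - weyl_x * w) j = of_nat (Suc j) * cf w (Suc j)"
      by (simp add: nf_diff nf_mult_x nf_x_mult coeff_pderiv del: of_nat_Suc)
    also have "\<dots> = h * cf a j"
    proof (cases "CHAR('k) dvd Suc j")
      case True
      then show ?thesis by (simp add: z cfw)
    next
      case False
      then have "of_nat (Suc j) \<noteq> (0::'k)" by (simp only: of_nat_eq_0_iff_char_dvd not_False_eq_True)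
      then show ?thesis by (simp add: cfw of_nat_poly del: of_nat_Suc)
    qed
    finally show "cf (w * weyl_x - weyl_x * w) j = cf (weyl_poly h * a) j" by (simp add: cf_poly_mult)
  qed
  moreover have "cf w j = 0" if "CHAR('k) dvd j" for j
    using that by (cases j) (auto simp: cfw z simp del: of_nat_Suc)
  ultimately show ?thesis using that by blast
qed

text \<open>Since \<open>D(x\<^sup>p) = 0\<close>, the element \<open>h D x\<close> is a commutator \<open>[w,x]\<close> with \<open>w \<in> A\<^sub>h\<close>. So
  \<open>D' = h\<^sup>p D - [h\<^sup>p\<^sup>-\<^sup>1 w, -]\<close> kills \<open>x\<close> and agrees with \<open>h\<^sup>p D\<close> on the centre. Then \<open>g' = D' yhat\<close> commutes
  with \<open>x\<close>, and it turns out to be divisible by \<open>h\<^sup>p\<close> in \<open>A\<^sub>h\<close>, say \<open>g' = h\<^sup>p g\<close>. Up to a factor \<open>h\<^sup>p\<close>, \<open>D'\<close> is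
  the restriction of the derivation \<open>x \<mapsto> 0\<close>, \<open>y \<mapsto> h\<^sup>p\<^sup>-\<^sup>1 g'\<close> of \<open>A\<^sub>1\<close>, which computes \<open>D(z\<^sub>h)\<close> coefficientwise
  as \<open>(d/dx)\<^sup>p\<^sup>-\<^sup>1(h\<^sup>p\<^sup>-\<^sup>1 g)\<close>.\<close>

lemma derivations_zh_special:
  assumes D: "D \<in> derivations weyl_const (A_h h)" and D0: "D (weyl_x ^ CHAR('k)) = 0"
  obtains P where "D (z_h h) = weyl_poly (hbar h) * ident h P"
proof -
  let ?n = "CHAR('k) - 1"
  let ?H = "weyl_poly (h ^ CHAR('k))"
  have hp0: "h ^ CHAR('k) \<noteq> 0" using h by simp
  have H: "central ?H" by (rule central_power_char[OF p h])
  note Hc = central_commute[OF H]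
  define a where "a = D weyl_x"
  have aA: "a \<in> A_h h" unfolding a_def by (rule derivationsD(1)[OF D A_h_x])
  have az: "cf a j = 0" if "CHAR('k) dvd Suc j" for j
  proof -
    \<comment> \<open>Up to a product of \<open>p - 1\<close> consecutive integers, which is prime to \<open>p\<close>, the coefficient of \<open>a\<close> at \<open>y\<^sup>p\<^sup>m\<^sup>-\<^sup>1\<close> is one of \<open>D(x\<^sup>p)\<close>.\<close>
    from that obtain m where m: "Suc j = CHAR('k) * m" by auto
    then obtain i where "m = Suc i" by (cases m) auto
    with m p have i: "j = CHAR('k) * i + ?n" by (simp add: algebra_simps)
    have "(- 1) ^ ?n * (pochhammer (of_nat (Suc (CHAR('k) * i))) ?n * cf a j) = cf (D (weyl_x ^ CHAR('k))) (CHAR('k) * i)"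
      unfolding derivations_power_char[OF p h D A_h_x] cf_ad_x a_def i ..
    moreover have "pochhammer (of_nat (Suc (CHAR('k) * i))) ?n \<noteq> (0 :: 'k poly)"
    proof -
      have "\<not> CHAR('k) dvd pochhammer (Suc (CHAR('k) * i)) ?n"
      proof
        assume "CHAR('k) dvd pochhammer (Suc (CHAR('k) * i)) ?n"
        then obtain l where l: "l < ?n" "CHAR('k) dvd Suc (CHAR('k) * i) + l"
          using prime_CHAR_semidom[OF p] by (auto simp: pochhammer_prod prime_dvd_prod_iff)
        then have "CHAR('k) dvd Suc l"
          by (metis add_Suc add_Suc_right dvd_add_right_iff dvd_triv_left)
        then have "CHAR('k) \<le> Suc l" by (rule dvd_imp_le) simp
        then show False using l by simp
      qed
      then have "of_nat (pochhammer (Suc (CHAR('k) * i)) ?n) \<noteq> (0 :: 'k poly)"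
        by (simp only: of_nat_eq_0_iff_char_dvd semiring_char_poly not_False_eq_True)
      then show ?thesis by (simp only: pochhammer_of_nat not_False_eq_True)
    qed
    ultimately show ?thesis using D0 by simp
  qed
  obtain w where w: "w \<in> A_h h" "w * weyl_x - weyl_x * w = weyl_poly h * a"
    and wz: "\<And>j. CHAR('k) dvd j \<Longrightarrow> cf w j = 0"
    using commutator_x_primitive[OF aA az] by blast
  have wd: "h ^ j dvd cf w j" for j using w(1) by (simp add: A_h_iff)
  define w' where "w' = weyl_poly (h ^ ?n) * w"
  have w': "w' \<in> A_h h" unfolding w'_def by (intro A_h_mult A_h_poly w)
  define D' where "D' = (\<lambda>b. ?H * D b - (w' * b - b * w'))"
  have D'_add: "D' (b + c) = D' b + D' c" and D'_mult: "D' (b * c) = D' b * c + b * D' c"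
    if "b \<in> A_h h" "c \<in> A_h h" for b c
  proof -
    show "D' (b + c) = D' b + D' c"
      by (simp add: D'_def derivationsD(3)[OF D that] algebra_simps)
    have "?H * (b * D c) = b * (?H * D c)" using Hc by (metis mult.assoc)
    then show "D' (b * c) = D' b * c + b * D' c"
      by (simp add: D'_def derivationsD(5)[OF D that] algebra_simps)
  qed
  have D'_const: "D' (weyl_const c) = 0" for c
    by (simp add: D'_def derivations_const[OF D] weyl_const_commute)
  have D'_x: "D' weyl_x = 0"
  proof -
    have "w' * weyl_x - weyl_x * w' = weyl_poly (h ^ ?n) * (w * weyl_x - weyl_x * w)"
      using weyl_poly_commutes_x[of "h ^ ?n"] by (simp add: w'_def right_diff_distrib mult.assoc[symmetric])
    also have "\<dots> = ?H * a"
      by (simp add: w(2) power_char_pred[OF p h, of h] weyl_poly_mult[symmetric] mult.assoc[symmetric] mult.commute)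
    finally show ?thesis by (simp add: D'_def a_def)
  qed
  have D'_A: "D' b \<in> A_h h" if "b \<in> A_h h" for b
    unfolding D'_def by (intro A_h_diff A_h_mult A_h_poly w' that derivationsD(1)[OF D])
  have D'_poly: "D' (weyl_poly f) = 0" for f
  proof (induction f)
    case (pCons c f)
    then show ?case
      by (simp add: weyl_poly_pCons D'_add D'_mult A_h_const A_h_x A_h_poly A_h_mult D'_const D'_x)
  qed (use D'_const[of 0] in simp)
  define g' where "g' = D' (yhat h)"
  have g'x: "g' * weyl_x = weyl_x * g'"
  proof -
    have "yhat h * weyl_x = weyl_x * yhat h + weyl_poly h" using yhat_relation[of h] by (simp add: algebra_simps)
    from arg_cong[OF this, of D'] show ?thesis
      by (simp add: D'_add D'_mult A_h_yhat A_h_x A_h_poly A_h_mult D'_x D'_poly g'_def)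
  qed
  then have g'z: "cf g' j = 0" if "\<not> CHAR('k) dvd j" for j
    using that by (simp add: commutes_x_iff[OF p])
  have g'd: "h ^ (CHAR('k) + j) dvd cf g' j" for j
  proof (cases "CHAR('k) dvd j")
    case False
    then show ?thesis by (simp add: g'z)
  next
    case True
    have pj: "h ^ (CHAR('k) + j) = h ^ ?n * h ^ Suc j"
      using power_char_pred[OF p h, of h] by (simp add: power_add mult_ac)
    have c0: "cf w j = 0" by (rule wz[OF True])
    have "yhat h * w' = weyl_y * (?H * w)"
      by (simp add: yhat_def w'_def power_char_pred[OF p h, of h] weyl_poly_mult mult.assoc)
    \<comment> \<open>The contributions \<open>h\<^sup>p w\<^sub>j\<^sub>-\<^sub>1\<close> to \<open>yhat w'\<close> and \<open>w' yhat\<close> need not be divisible by \<open>h\<^sup>p\<^sup>+\<^sup>j\<close>, but they cancel.\<close>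
    then have e1: "cf (yhat h * w') j = (if j = 0 then 0 else h ^ ?n * (h * cf w (j - 1)))"
      using power_char_pred[OF p h, of h] by (simp add: cf_y_mult cf_poly_mult c0 mult_ac)
    have "w' * yhat h = weyl_poly (h ^ ?n) * (w * weyl_poly h * weyl_y + w * weyl_poly (pderiv h))"
      by (simp add: w'_def yhat_def weyl_y_poly distrib_left mult.assoc)
    then have e2: "cf (w' * yhat h) j = h ^ ?n * ((if j = 0 then 0 else cf (w * weyl_poly h) (j - 1))
        + cf (w * weyl_poly (pderiv h)) j)"
      by (simp add: cf_poly_mult cf_add cf_mult_y)
    have g1: "h ^ Suc j dvd cf w l" if "l > j" for l
      using that by (intro dvd_trans[OF _ wd[of l]] le_imp_power_dvd) simp
    have d1: "h ^ Suc j dvd cf (w * weyl_poly (pderiv h)) j"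
      using cf_mult_poly_diff_dvd[of j "h ^ Suc j" w "pderiv h", OF g1] c0 by simp
    have d2: "h ^ Suc j dvd cf (w * weyl_poly h) (j - 1) - h * cf w (j - 1)" if "j \<noteq> 0"
    proof (rule cf_mult_poly_diff_dvd)
      fix l assume "l > j - 1"
      then show "h ^ Suc j dvd cf w l" using g1[of l] c0 by (cases "l = j") auto
    qed
    have "cf g' j = h ^ CHAR('k) * cf (D (yhat h)) j + (cf (yhat h * w') j - cf (w' * yhat h) j)"
      by (simp add: g'_def D'_def cf_diff cf_poly_mult)
    also have "cf (yhat h * w') j - cf (w' * yhat h) j =
        h ^ ?n * - ((if j = 0 then 0 else cf (w * weyl_poly h) (j - 1) - h * cf w (j - 1))
          + cf (w * weyl_poly (pderiv h)) j)"
      unfolding e1 e2 by (simp add: algebra_simps)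
    finally have e3: "cf g' j = h ^ CHAR('k) * cf (D (yhat h)) j +
        h ^ ?n * - ((if j = 0 then 0 else cf (w * weyl_poly h) (j - 1) - h * cf w (j - 1))
          + cf (w * weyl_poly (pderiv h)) j)" .
    have "h ^ j dvd cf (D (yhat h)) j" using derivationsD(1)[OF D A_h_yhat] by (simp add: A_h_iff)
    then have "h ^ (CHAR('k) + j) dvd h ^ CHAR('k) * cf (D (yhat h)) j" by (simp add: power_add mult_dvd_mono)
    moreover have "h ^ (CHAR('k) + j) dvd h ^ ?n * - ((if j = 0 then 0 else cf (w * weyl_poly h) (j - 1) - h * cf w (j - 1))
          + cf (w * weyl_poly (pderiv h)) j)"
      unfolding pj by (intro mult_dvd_mono dvd_refl) (use d1 d2 in \<open>auto simp del: power_Suc intro!: dvd_add\<close>)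
    ultimately show ?thesis unfolding e3 by (rule dvd_add)
  qed
  define g where "g = of_nf (map_poly (\<lambda>q. q div h ^ CHAR('k)) (nf g'))"
  have cfg: "cf g' j = h ^ CHAR('k) * cf g j" for j
  proof -
    have "h ^ CHAR('k) dvd cf g' j" using g'd[of j] by (auto simp: power_add elim: dvd_mult_left)
    then show ?thesis by (simp add: g_def coeff_map_poly)
  qed
  have gd: "h ^ j dvd cf g j" for j
    using g'd[of j] h by (simp add: cfg power_add)
  have gz: "cf g j = 0" if "\<not> CHAR('k) dvd j" for j
    using g'z[OF that] h by (simp add: cfg)
  define v where "v = weyl_poly (h ^ ?n) * g'"
  have "v * weyl_x = weyl_poly (h ^ ?n) * (weyl_x * g')" by (simp only: v_def mult.assoc g'x)
  also have "\<dots> = weyl_x * v"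
    by (simp only: v_def mult.assoc[symmetric] weyl_poly_commutes_x)
  finally have "v * weyl_x = weyl_x * v" .
  then obtain G where G: "weyl_derivation G" "G weyl_x = 0" "G weyl_y = v"
    using weyl_derivation_exists[of v 0] by auto
  have "G b = ?H * D' b" if "b \<in> A_h h" for b
    using that
  proof (rule A_h_derivation_eqI)
    have "G (yhat h) = v * weyl_poly h"
      by (simp add: yhat_def weyl_derivationD[OF G(1)] G(3) weyl_derivation_poly[OF G(1,2)])
    also have "\<dots> = ?H * g'"
      by (simp add: v_def mult.assoc commutes_x_poly[OF g'x] power_char_pred[OF p h, of h])
        (simp add: weyl_poly_mult[symmetric] mult.assoc[symmetric] mult.commute)
    finally show "G (yhat h) = ?H * D' (yhat h)" by (simp add: g'_def)
  next
    fix b c assume bc: "b \<in> A_h h" "c \<in> A_h h"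
    have "?H * (b * D' c) = b * (?H * D' c)" using Hc by (metis mult.assoc)
    then show "?H * D' (b + c) = ?H * D' b + ?H * D' c \<and> ?H * D' (b * c) = ?H * D' b * c + b * (?H * D' c)"
      by (simp add: D'_add[OF bc] D'_mult[OF bc] distrib_left mult.assoc)
  qed (simp_all add: weyl_derivationD[OF G(1)] D'_const D'_x G(2))
  from this[OF z_h_in_A_h] have "?H * D' (z_h h) = G (z_h h)" by simp
  also have "\<dots> = ?H * (ad weyl_y ^^ ?n) v"
    by (simp add: z_h_altdef weyl_derivationD[OF G(1)] weyl_derivation_poly[OF G(1,2)]
          weyl_derivation_power_char[OF p h G(1)] G(3))
  finally have Dz: "D' (z_h h) = (ad weyl_y ^^ ?n) v" by (rule weyl_poly_left_cancel[OF _ hp0])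
  have "D' (z_h h) = ?H * D (z_h h)"
    using central_commute[OF central_z_h[OF p h]] by (simp add: D'_def)
  with Dz have e: "?H * D (z_h h) = (ad weyl_y ^^ ?n) v" by simp
  have cfD: "cf (D (z_h h)) j = top_deriv (h ^ ?n * cf g j)" for j
  proof -
    have "h ^ CHAR('k) * cf (D (z_h h)) j = cf (?H * D (z_h h)) j" by (simp add: cf_poly_mult)
    also have "\<dots> = top_deriv (h ^ CHAR('k) * (h ^ ?n * cf g j))"
      unfolding e by (simp add: cf_ad_y v_def cf_poly_mult cfg top_deriv_def mult_ac)
    also have "\<dots> = h ^ CHAR('k) * top_deriv (h ^ ?n * cf g j)"
      by (rule top_deriv_xp_mult[OF p power_char_xp_ring[OF p]])
    finally show ?thesis using h by simp
  qed
  have q: "\<exists>q\<in>xp_ring. cf (D (z_h h)) (CHAR('k) * j) = q * h ^ (CHAR('k) * j) * hbar h" for j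
  proof -
    obtain u where u: "cf g (CHAR('k) * j) = h ^ (CHAR('k) * j) * u" using gd by (metis dvdE)
    obtain c where c: "c \<in> xp_ring" "top_deriv (h ^ ?n * u) = hbar h * c"
      using hbar_dvd_top_deriv[OF p h] by blast
    have hj: "h ^ (CHAR('k) * j) \<in> xp_ring"
      using xp_ring_power[OF power_char_xp_ring[OF p, of h], of j] by (simp add: power_mult)
    have "cf (D (z_h h)) (CHAR('k) * j) = top_deriv (h ^ (CHAR('k) * j) * (h ^ ?n * u))"
      by (simp only: cfD u mult.left_commute)
    also have "\<dots> = h ^ (CHAR('k) * j) * (hbar h * c)"
      by (simp only: top_deriv_xp_mult[OF p hj] c(2))
    finally show ?thesis using c(1) by (intro bexI[of _ c]) (simp_all add: mult_ac)
  qed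
  have z: "CHAR('k) dvd j" if "cf (D (z_h h)) j \<noteq> 0" for j
    using that gz[of j] by (cases "CHAR('k) dvd j") (simp_all add: cfD top_deriv_def)
  show ?thesis by (rule ident_multipleE[OF p h z q]) (use that in auto)
qed

lemma derivations_on_centre:
  assumes D: "D \<in> derivations weyl_const (A_h h)"
  obtains P Q where "D (weyl_x ^ CHAR('k)) = weyl_poly (h ^ CHAR('k) div rho h) * ident h P"
    "D (z_h h) = weyl_poly (hbar h) * ident h Q"
proof -
  obtain P where P: "D (weyl_x ^ CHAR('k)) = weyl_poly (h ^ CHAR('k) div rho h) * ident h P"
    using derivations_xp[OF D] .
  obtain E c where E: "E \<in> derivations weyl_const (A_h h)"
    "E (weyl_x ^ CHAR('k)) = weyl_poly (h ^ CHAR('k) div rho h)"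
    "c \<in> xp_ring" "E (z_h h) = weyl_poly (hbar h * c) * z_h h"
    using derivation_xp_exists[OF p h] .
  have "ident h (- P) \<in> centre (A_h h)" by (simp add: centre_eq_range[OF p h])
  then have D0: "(\<lambda>a. D a + ident h (- P) * E a) \<in> derivations weyl_const (A_h h)"
    by (rule derivations_combine[OF refl D E(1)])
  have neg: "ident h (- P) = - ident h P"
    using ident_add[of h P "- P"] by (simp add: eq_neg_iff_add_eq_0 add.commute)
  obtain R where R: "D (z_h h) + ident h (- P) * E (z_h h) = weyl_poly (hbar h) * ident h R"
    by (rule derivations_zh_special[OF D0])
      (simp_all add: P E(2) neg central_commute[OF central_ident[OF p h]])
  obtain c' where c': "c = xp_poly c'" using E(3) by (auto simp: xp_ring_def)
  have "ident h P * (weyl_poly (hbar h * c) * z_h h) = weyl_poly (hbar h) * ident h (P * smult c' [:0, 1:])"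
    using central_commute[OF central_ident[OF p h], of P "weyl_poly (hbar h)"]
    by (simp add: weyl_poly_mult ident_mult[OF p h] ident_smult ident_t2[OF p h] c' mult.assoc[symmetric] del: smult_pCons mult_smult_right)
  then have "D (z_h h) = weyl_poly (hbar h) * ident h (R + P * smult c' [:0, 1:])"
    using R by (simp add: E(4) neg ident_add distrib_left algebra_simps del: smult_pCons mult_smult_right)
  then show ?thesis using that P by blast
qed

end

section \<open>Derivations of the polynomial ring in two variables\<close>

lemma d_t1_pCons: "d_t1 (pCons q P) = pCons (pderiv q) (d_t1 P)"
  by (simp add: d_t1_def map_poly_pCons)

lemma d_t1_0 [simp]: "d_t1 0 = 0"
  by (simp add: d_t1_def)

lemma d_t1_add: "d_t1 (P + Q) = d_t1 P + d_t1 Q"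
  by (intro poly_eqI) (simp add: d_t1_def coeff_map_poly pderiv_add)

lemma d_t1_smult: "d_t1 (smult q P) = smult (pderiv q) P + smult q (d_t1 P)"
  by (intro poly_eqI) (simp add: d_t1_def coeff_map_poly pderiv_mult algebra_simps)

lemma d_t1_mult: "d_t1 (P * Q) = d_t1 P * Q + P * d_t1 Q"
  by (induction P) (simp_all add: d_t1_pCons d_t1_add d_t1_smult algebra_simps)

lemma d_t1_d_t2: "d_t1 (d_t2 P) = d_t2 (d_t1 P)"
  by (intro poly_eqI) (simp add: d_t1_def d_t2_def coeff_map_poly coeff_pderiv pderiv_mult pderiv_add)

lemma d_t2_in_t1 [simp]: "d_t2 (in_t1 f) = 0"
  by (simp add: d_t2_def in_t1_def)

lemma d_t2_mult: "d_t2 (P * Q) = d_t2 P * Q + P * d_t2 Q"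
  by (simp add: d_t2_def pderiv_mult mult.commute)

lemma const12_derivations: "d_t1 (const12 c) = 0" "d_t2 (const12 c) = 0"
  by (simp_all add: const12_def d_t1_pCons d_t2_def)

lemma poly_derivationD:
  assumes D: "D \<in> derivations const12 UNIV"
  shows "D (P + Q) = D P + D Q" "D (P * Q) = D P * Q + P * D Q" "D (const12 c) = 0" "D 0 = 0"
proof -
  show add: "D (P + Q) = D P + D Q" for P Q using derivationsD(3)[OF D] by blast
  show mult: "D (P * Q) = D P * Q + P * D Q" for P Q using derivationsD(5)[OF D] by blast
  have "D 0 = D 0 + D 0" using add[of 0 0] by (simp only: add_0_left)
  then show "D 0 = 0" by (simp only: add_cancel_right_right)
  have "D 1 = D 1 + D 1" using mult[of 1 1] by (simp only: mult_1_left mult_1_right)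
  then have "D 1 = 0" by (simp only: add_cancel_right_right)
  then show "D (const12 c) = 0" using derivationsD(4)[OF D UNIV_I, of c 1] by simp
qed

text \<open>The chain rule: a derivation of \<open>\<F>[t\<^sub>1,t\<^sub>2]\<close> is determined by its values on \<open>t\<^sub>1\<close> and \<open>t\<^sub>2\<close>.\<close>

lemma bivariate_derivation:
  assumes D: "D \<in> derivations const12 UNIV"
  shows "D P = D [:[:0, 1:]:] * d_t1 P + D [:0, 1:] * d_t2 P"
proof -
  note D' = poly_derivationD[OF D]
  note D0 = D'(4) and Dc = D'(3)[unfolded const12_def]
  have q: "D [:q:] = D [:[:0, 1:]:] * [:pderiv q:]" for q
  proof (induction q)
    case 0
    show ?case by (simp add: D0)
  next
    case (pCons c q)
    have "[:pCons c q:] = [:[:c:]:] + [:[:0, 1:]:] * [:q:]" by simp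
    then have "D [:pCons c q:] = D [:[:0, 1:]:] * [:q:] + [:[:0, 1:]:] * D [:q:]"
      by (simp only: D'(1,2) Dc add_0_left)
    also have "\<dots> = D [:[:0, 1:]:] * ([:q:] + [:[:0, 1:]:] * [:pderiv q:])"
      by (simp only: pCons.IH distrib_left mult.left_commute)
    finally show ?case by (simp add: pderiv_pCons)
  qed
  have rearrange: "u * a + (v * P + t * (u * X + v * Y)) = u * (a + t * X) + v * (P + t * Y)"
    for u a v P t X Y :: "'a poly poly"
    by (simp add: algebra_simps)
  show ?thesis
  proof (induction P)
    case 0
    show ?case by (simp add: D0 d_t2_def)
  next
    case (pCons q P)
    have e: "pCons q P = [:q:] + [:0, 1:] * P" by simp
    have "D (pCons q P) = D [:q:] + (D [:0, 1:] * P + [:0, 1:] * D P)"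
      by (subst e) (simp only: D'(1,2))
    also have "\<dots> = D [:[:0, 1:]:] * ([:pderiv q:] + [:0, 1:] * d_t1 P) + D [:0, 1:] * (P + [:0, 1:] * d_t2 P)"
      unfolding q[of q] pCons.IH by (rule rearrange)
    finally show ?case by (simp add: d_t1_pCons d_t2_def pderiv_pCons)
  qed
qed

lemma bivariate_derivationI: "(\<lambda>P. A * d_t1 P + B * d_t2 P) \<in> derivations const12 UNIV"
  unfolding derivations_def
  by (auto simp: d_t1_add d_t1_mult d_t2_mult const12_derivations algebra_simps) (simp add: d_t2_def pderiv_add algebra_simps)

lemma bivariate_derivation_t:
  "d_t1 [:[:0, 1:]:] = 1" "d_t2 [:[:0, 1:]:] = 0" "d_t1 [:0, 1:] = 0" "d_t2 [:0, 1:] = 1"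
  by (simp_all add: d_t1_pCons d_t2_def pderiv_pCons one_pCons)

lemma lie_derivation:
  assumes D: "D \<in> derivations const12 UNIV" and E: "E \<in> derivations const12 UNIV"
  shows "lie D E \<in> derivations const12 UNIV"
  unfolding derivations_def mem_Collect_eq lie_def
  by (intro conjI ballI allI impI)
    (simp_all add: poly_derivationD[OF D] poly_derivationD[OF E] right_diff_distrib left_diff_distrib algebra_simps)

section \<open>The image of the restriction map\<close>

text \<open>The inverse of \<open>transport\<close>: the derivation of \<open>\<F>[t\<^sub>1,t\<^sub>2]\<close> that corresponds to the restriction
  of \<open>D\<close> to the centre.\<close>

definition induced :: "'k::field poly \<Rightarrow> ('k weyl \<Rightarrow> 'k weyl) \<Rightarrow> 'k poly poly \<Rightarrow> 'k poly poly" where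
  "induced h D = (\<lambda>P. inv (ident h) (D (ident h P)))"

definition witt_span :: "'k::field poly \<Rightarrow> ('k poly poly \<Rightarrow> 'k poly poly) set" where
  "witt_span h = {\<lambda>P. A * d1 h P + B * d2 h P | A B. True}"

context
  fixes h :: "'k::field poly"
  assumes p: "CHAR('k) > 0" and h: "h \<noteq> 0"
begin

abbreviation (input) "r1 \<equiv> in_t1 (h ^ CHAR('k) div rho h)"
abbreviation (input) "b2 \<equiv> in_t1 (hbar h)"

lemma ident_r1: "ident h r1 = weyl_poly (h ^ CHAR('k) div rho h)"
  by (rule ident_in_t1[OF p h power_char_div_rho(2)[OF p h]])

lemma ident_b2: "ident h b2 = weyl_poly (hbar h)"
  by (rule ident_in_t1[OF p h hbar_properties(1)[OF p h]])

lemma r1_nonzero: "r1 \<noteq> 0"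
  using ident_r1 power_char_div_rho(3)[OF p h] cf_poly[of "h ^ CHAR('k) div rho h" 0] by auto

lemma b2_nonzero: "b2 \<noteq> 0"
  using ident_b2 hbar_properties(2)[OF p h] cf_poly[of "hbar h" 0] by auto

text \<open>The quotient appearing in the bracket formula is exact.\<close>

lemma r1_factor: "r1 = in_t1 (h ^ CHAR('k) div (rho h * hbar h)) * b2"
proof -
  define q where "q = h ^ CHAR('k) div (rho h * hbar h)"
  have "rho h * hbar h \<noteq> 0" using rho_properties(2)[OF p h] hbar_properties(2)[OF p h] by simp
  moreover have "rho h * hbar h * q = h ^ CHAR('k)" unfolding q_def using rho_hbar_dvd[OF p h] by simp
  moreover have "rho h * hbar h \<in> xp_ring" by (intro xp_ring_mult rho_properties(1)[OF p h] hbar_properties(1)[OF p h])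
  ultimately have q: "q \<in> xp_ring" using xp_ring_cancel[OF p] power_char_xp_ring[OF p, of h] by metis
  have "rho h * (h ^ CHAR('k) div rho h) = rho h * (q * hbar h)"
    unfolding power_char_div_rho(1)[OF p h] using \<open>rho h * hbar h * q = h ^ CHAR('k)\<close> by (simp add: mult_ac)
  then have e: "h ^ CHAR('k) div rho h = q * hbar h" using rho_properties(2)[OF p h] by simp
  have "ident h r1 = ident h (in_t1 q * b2)"
    unfolding ident_r1 ident_mult[OF p h] ident_b2 ident_in_t1[OF p h q] by (simp add: e weyl_poly_mult)
  then show ?thesis by (simp add: ident_eq_iff[OF p h] q_def)
qed

text \<open>In this form closure under the Lie bracket can be tested on \<open>t\<^sub>1\<close> and \<open>t\<^sub>2\<close> only.\<close>

lemma witt_span_iff: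
  "D \<in> witt_span h \<longleftrightarrow> D \<in> derivations const12 UNIV \<and> r1 dvd D [:[:0, 1:]:] \<and> b2 dvd D [:0, 1:]"
proof
  assume "D \<in> witt_span h"
  then obtain A B where D: "D = (\<lambda>P. (A * r1) * d_t1 P + (B * b2) * d_t2 P)"
    by (auto simp: witt_span_def d1_def d2_def fsmult_def mult.assoc)
  show "D \<in> derivations const12 UNIV \<and> r1 dvd D [:[:0, 1:]:] \<and> b2 dvd D [:0, 1:]"
    using bivariate_derivationI[of "A * r1" "B * b2"] unfolding D by (simp add: bivariate_derivation_t)
next
  assume D: "D \<in> derivations const12 UNIV \<and> r1 dvd D [:[:0, 1:]:] \<and> b2 dvd D [:0, 1:]"
  then obtain A B where AB: "D [:[:0, 1:]:] = r1 * A" "D [:0, 1:] = b2 * B" by (auto elim!: dvdE)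
  have "D = (\<lambda>P. A * d1 h P + B * d2 h P)"
    using bivariate_derivation[OF conjunct1[OF D]] unfolding AB
    by (simp add: fun_eq_iff d1_def d2_def fsmult_def mult_ac)
  then show "D \<in> witt_span h" by (auto simp: witt_span_def)
qed

lemma lie_d1_d2:
  "lie (d1 h) (d2 h) = fsmult (d_t1 b2 * in_t1 (h ^ CHAR('k) div (rho h * hbar h))) (d2 h)"
proof
  fix P
  have "lie (d1 h) (d2 h) P = d_t1 b2 * (r1 * d_t2 P)"
    by (simp add: lie_def d1_def d2_def fsmult_def d_t1_mult d_t2_mult d_t1_d_t2 algebra_simps)
  also have "\<dots> = fsmult (d_t1 b2 * in_t1 (h ^ CHAR('k) div (rho h * hbar h))) (d2 h) P"
    by (subst r1_factor) (simp add: d2_def fsmult_def mult_ac)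
  finally show "lie (d1 h) (d2 h) P = fsmult (d_t1 b2 * in_t1 (h ^ CHAR('k) div (rho h * hbar h))) (d2 h) P" .
qed

text \<open>A derivation \<open>F\<close> of the span maps a polynomial in \<open>t\<^sub>1\<close> to a multiple of \<open>F t\<^sub>1\<close>, hence of \<open>h\<^sup>p/\<rho>\<close>, and
  \<open>hbar\<close> divides \<open>h\<^sup>p/\<rho>\<close>. So \<open>h\<^sup>p/\<rho>\<close> and \<open>hbar\<close> generate ideals stable under \<open>F\<close>.\<close>

lemma lie_witt_span:
  assumes D: "D \<in> witt_span h" and E: "E \<in> witt_span h"
  shows "lie D E \<in> witt_span h"
proof -
  have Dd: "D \<in> derivations const12 UNIV" and Ed: "E \<in> derivations const12 UNIV"
    using D E by (auto simp: witt_span_iff)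
  have "b2 dvd r1" by (subst r1_factor) simp
  have f: "r1 dvd F r1" "b2 dvd F b2" if "F \<in> witt_span h" for F
  proof -
    have F: "F \<in> derivations const12 UNIV" "r1 dvd F [:[:0, 1:]:]"
      using that by (auto simp: witt_span_iff)
    show "r1 dvd F r1" "b2 dvd F b2"
      using F(2) dvd_trans[OF \<open>b2 dvd r1\<close> F(2)]
      by (simp_all add: bivariate_derivation[OF F(1), of r1] bivariate_derivation[OF F(1), of b2])
  qed
  have key: "q dvd D (E t) - E (D t)" if q: "q dvd D t" "q dvd E t" "q dvd D q" "q dvd E q" for q t
  proof -
    obtain a b where ab: "D t = q * a" "E t = q * b" using q by (auto elim!: dvdE)
    show ?thesis unfolding ab derivationsD(5)[OF Dd UNIV_I UNIV_I] derivationsD(5)[OF Ed UNIV_I UNIV_I]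
      using q by auto
  qed
  show ?thesis
    using D E f[OF D] f[OF E] lie_derivation[OF Dd Ed] by (auto simp: witt_span_iff lie_def intro!: key)
qed

lemma witt_span_submodule: "submodule UNIV (derivations const12 UNIV) (witt_span h)"
proof -
  have "(\<lambda>P. F P + G P) \<in> witt_span h" if "F \<in> witt_span h" "G \<in> witt_span h" for F G
  proof -
    from that obtain A B A' B' where "F = (\<lambda>P. A * d1 h P + B * d2 h P)" "G = (\<lambda>P. A' * d1 h P + B' * d2 h P)"
      by (auto simp: witt_span_def)
    then have "(\<lambda>P. F P + G P) = (\<lambda>P. (A + A') * d1 h P + (B + B') * d2 h P)"
      by (simp add: fun_eq_iff algebra_simps)
    then show ?thesis unfolding witt_span_def by blast
  qed
  moreover have "fsmult z F \<in> witt_span h" if "F \<in> witt_span h" for F z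
  proof -
    from that obtain A B where "F = (\<lambda>P. A * d1 h P + B * d2 h P)" by (auto simp: witt_span_def)
    then have "fsmult z F = (\<lambda>P. (z * A) * d1 h P + (z * B) * d2 h P)"
      by (simp add: fun_eq_iff fsmult_def algebra_simps)
    then show ?thesis unfolding witt_span_def by blast
  qed
  moreover have "(\<lambda>_. 0) \<in> witt_span h"
    unfolding witt_span_def by (rule CollectI, intro exI[of _ 0]) simp
  ultimately show ?thesis by (auto simp: submodule_def witt_span_iff)
qed

lemma witt_subalgebra_gen_eq: "witt_subalgebra_gen {d1 h, d2 h} = witt_span h"
proof (intro equalityI)
  have "d1 h \<in> witt_span h" unfolding witt_span_def
    by (rule CollectI, rule exI[of _ 1], rule exI[of _ 0]) simp
  moreover have "d2 h \<in> witt_span h" unfolding witt_span_def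
    by (rule CollectI, rule exI[of _ 0], rule exI[of _ 1]) simp
  ultimately show "witt_subalgebra_gen {d1 h, d2 h} \<subseteq> witt_span h"
    unfolding witt_subalgebra_gen_def using witt_span_submodule lie_witt_span by (intro hull_minimal) auto
  show "witt_span h \<subseteq> witt_subalgebra_gen {d1 h, d2 h}"
  proof
    fix F assume "F \<in> witt_span h"
    then obtain A B where F: "F = (\<lambda>P. fsmult A (d1 h) P + fsmult B (d2 h) P)"
      by (auto simp: witt_span_def fsmult_def)
    have "F \<in> L" if L: "submodule UNIV (derivations const12 UNIV) L" "{d1 h, d2 h} \<subseteq> L" for L
    proof -
      have "fsmult A (d1 h) \<in> L" "fsmult B (d2 h) \<in> L" using L by (auto simp: submodule_def)
      then show ?thesis unfolding F using L(1) unfolding submodule_def by blast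
    qed
    then show "F \<in> witt_subalgebra_gen {d1 h, d2 h}"
      unfolding witt_subalgebra_gen_def hull_def by blast
  qed
qed

lemma transport_ident [simp]: "transport h D (ident h P) = ident h (D P)"
  by (simp add: transport_def restrict0_def centre_eq_range[OF p h] inv_ident[OF p h])

lemma transport_outside: "a \<notin> centre (A_h h) \<Longrightarrow> transport h D a = 0"
  by (simp add: transport_def restrict0_def)

text \<open>Maps on the centre are functions on all of \<open>A\<^sub>1\<close> that vanish elsewhere.\<close>

lemma eq_on_centreI:
  assumes "\<And>P. F (ident h P) = G (ident h P)" "\<And>a. a \<notin> centre (A_h h) \<Longrightarrow> F a = 0"
    "\<And>a. a \<notin> centre (A_h h) \<Longrightarrow> G a = (0 :: 'k weyl)"
  shows "F = G"
proof
  fix a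
  show "F a = G a" using assms by (cases "a \<in> centre (A_h h)") (auto simp: centre_eq_range[OF p h])
qed

lemma transport_inj: "transport h D = transport h E \<longleftrightarrow> D = E"
proof
  assume e: "transport h D = transport h E"
  have "ident h (D P) = ident h (E P)" for P
    using fun_cong[OF e, of "ident h P"] by simp
  then show "D = E" by (auto simp: ident_eq_iff[OF p h])
qed simp

lemma transport_add: "transport h (\<lambda>P. D P + E P) = (\<lambda>a. transport h D a + transport h E a)"
  by (rule eq_on_centreI) (simp_all add: transport_outside ident_add)

lemma transport_fsmult: "transport h (fsmult A D) = fsmult (ident h A) (transport h D)"
  by (rule eq_on_centreI) (simp_all add: transport_outside fsmult_def ident_mult[OF p h])

lemma transport_lie:
  assumes "D 0 = 0" "E 0 = 0"
  shows "transport h (lie D E) = lie (transport h D) (transport h E)"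
proof (rule eq_on_centreI)
  fix P
  have diff: "ident h (P - Q) = ident h P - ident h Q" for P Q
    using ident_add[of h "P - Q" Q] by simp
  show "transport h (lie D E) (ident h P) = lie (transport h D) (transport h E) (ident h P)"
    by (simp add: lie_def diff)
next
  fix a assume "a \<notin> centre (A_h h)"
  then show "lie (transport h D) (transport h E) a = 0"
    using transport_ident[of D 0] transport_ident[of E 0] assms by (simp add: lie_def transport_outside)
qed (rule transport_outside)

lemma transport_derivation:
  assumes D: "D \<in> derivations const12 UNIV"
  shows "transport h D \<in> derivations weyl_const (centre (A_h h))"
proof -
  note D' = poly_derivationD[OF D]
  have c: "weyl_const c = ident h (const12 c)" for c by (simp add: const12_def ident_const)
  have add: "transport h D (ident h P + ident h Q) = ident h (D P) + ident h (D Q)" for P Q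
    unfolding ident_add[symmetric] transport_ident D' ..
  have mult: "transport h D (ident h P * ident h Q) = ident h (D P) * ident h Q + ident h P * ident h (D Q)" for P Q
    unfolding ident_mult[OF p h, symmetric] ident_add[symmetric] transport_ident D' ..
  have "ident h (D (const12 c)) = 0" for c by (simp add: D')
  then show ?thesis unfolding derivations_def
    by (auto simp: centre_eq_range[OF p h] c transport_outside[unfolded centre_eq_range[OF p h]] add mult)
qed

lemma induced:
  assumes D: "D \<in> derivations weyl_const (A_h h)"
  shows "ident h (induced h D P) = D (ident h P)" "Res (A_h h) D = transport h (induced h D)"
    "induced h D \<in> derivations const12 UNIV" "induced h D \<in> witt_span h"
proof -
  have i: "ident h (induced h D P) = D (ident h P)" for P
  proof -
    have "D (ident h P) \<in> range (ident h)"
      using derivations_centre[OF D, of "ident h P"] by (simp add: centre_eq_range[OF p h])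
    then show ?thesis by (simp add: induced_def f_inv_into_f)
  qed
  show "ident h (induced h D P) = D (ident h P)" by (rule i)
  show "Res (A_h h) D = transport h (induced h D)"
    by (rule eq_on_centreI) (simp_all add: i Res_def restrict0_def transport_outside centre_eq_range[OF p h])
  note A = ident_in_A_h[OF p h]
  have c: "ident h (const12 c) = weyl_const c" for c by (simp add: const12_def ident_const)
  show d: "induced h D \<in> derivations const12 UNIV" unfolding derivations_def
    by (auto simp: ident_eq_iff[OF p h, symmetric] i ident_add ident_mult[OF p h] c
        derivationsD(3,4,5)[OF D] A)
  obtain P Q where PQ: "D (weyl_x ^ CHAR('k)) = weyl_poly (h ^ CHAR('k) div rho h) * ident h P"
    "D (z_h h) = weyl_poly (hbar h) * ident h Q"
    using derivations_on_centre[OF p h D] .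
  have "ident h (induced h D [:[:0, 1:]:]) = ident h (r1 * P)"
    by (simp only: i ident_t1[OF p h] PQ(1) ident_mult[OF p h] ident_r1)
  moreover have "ident h (induced h D [:0, 1:]) = ident h (b2 * Q)"
    by (simp only: i ident_t2[OF p h] PQ(2) ident_mult[OF p h] ident_b2)
  ultimately show "induced h D \<in> witt_span h" by (simp only: witt_span_iff ident_eq_iff[OF p h] d) simp
qed

text \<open>One inclusion is the computation of the values of derivations on \<open>x\<^sup>p\<close> and \<open>z\<^sub>h\<close>. For the other,
  central combinations of the two constructed derivations suffice; the one with \<open>x\<^sup>p \<mapsto> h\<^sup>p/\<rho>\<close> need not
  kill \<open>z\<^sub>h\<close>, which is corrected by a multiple of the other.\<close>

lemma image_Res: "Res (A_h h) ` derivations weyl_const (A_h h) = transport h ` witt_span h"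
proof (intro equalityI subsetI)
  fix F assume "F \<in> Res (A_h h) ` derivations weyl_const (A_h h)"
  then obtain D where D: "D \<in> derivations weyl_const (A_h h)" "F = Res (A_h h) D" by blast
  then show "F \<in> transport h ` witt_span h" using induced(2,4)[OF D(1)] by simp
next
  fix F assume "F \<in> transport h ` witt_span h"
  then obtain A B where F: "F = transport h (\<lambda>P. A * d1 h P + B * d2 h P)" by (auto simp: witt_span_def)
  obtain E1 where E1: "E1 \<in> derivations weyl_const (A_h h)"
    "E1 (weyl_x ^ CHAR('k)) = weyl_poly (h ^ CHAR('k) div rho h)"
    using derivation_xp_exists[OF p h] by metis
  obtain E2 where E2: "E2 \<in> derivations weyl_const (A_h h)" "E2 (weyl_x ^ CHAR('k)) = 0"
    "E2 (z_h h) = weyl_poly (hbar h)"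
    using derivation_zh_exists[OF p h] by metis
  obtain C where C: "induced h E1 [:0, 1:] = b2 * C" using induced(4)[OF E1(1)] by (auto simp: witt_span_iff elim: dvdE)
  have i1: "induced h E1 [:[:0, 1:]:] = r1" and i2: "induced h E2 [:[:0, 1:]:] = 0" "induced h E2 [:0, 1:] = b2"
    by (simp_all add: ident_eq_iff[OF p h, symmetric] induced(1)[OF E1(1)] induced(1)[OF E2(1)]
        ident_t1[OF p h] ident_t2[OF p h] E1 E2 ident_r1 ident_b2)
  \<comment> \<open>The summand \<open>- A C\<close> removes the contribution of \<open>E1\<close> to the value on \<open>z\<^sub>h\<close>.\<close>
  define D where "D = (\<lambda>a. (0 + ident h A * E1 a) + ident h (B - A * C) * E2 a)"
  have Z: "ident h P \<in> centre (A_h h)" for P by (simp add: centre_eq_range[OF p h])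
  have D: "D \<in> derivations weyl_const (A_h h)" unfolding D_def
    by (intro derivations_combine[OF refl _ E2(1) Z] derivations_combine[OF refl _ E1(1) Z] derivations_zero)
  have "induced h D = (\<lambda>P. A * d1 h P + B * d2 h P)"
  proof
    fix P
    have e: "induced h D P = A * induced h E1 P + (B - A * C) * induced h E2 P" for P
      unfolding ident_eq_iff[OF p h, symmetric] ident_add ident_mult[OF p h]
        induced(1)[OF D] induced(1)[OF E1(1)] induced(1)[OF E2(1)] by (simp add: D_def)
    show "induced h D P = A * d1 h P + B * d2 h P"
      unfolding e bivariate_derivation[OF induced(3)[OF E1(1)], of P] bivariate_derivation[OF induced(3)[OF E2(1)], of P]
        i1 i2 C by (simp add: d1_def d2_def fsmult_def algebra_simps)
  qed
  then have "F = Res (A_h h) D" using F induced(2)[OF D] by simp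
  then show "F \<in> Res (A_h h) ` derivations weyl_const (A_h h)" using D by blast
qed

lemma image_Res_submodule:
  "submodule (centre (A_h h)) (derivations weyl_const (centre (A_h h))) (transport h ` witt_span h)"
proof -
  have S: "F \<in> witt_span h \<Longrightarrow> F \<in> derivations const12 UNIV" "(\<lambda>_. 0) \<in> witt_span h"
    "F \<in> witt_span h \<Longrightarrow> G \<in> witt_span h \<Longrightarrow> (\<lambda>P. F P + G P) \<in> witt_span h"
    "F \<in> witt_span h \<Longrightarrow> fsmult A F \<in> witt_span h" for F G A
    using witt_span_submodule by (auto simp: submodule_def)
  have "transport h (\<lambda>_. 0) = (\<lambda>_. 0)"
    by (rule eq_on_centreI) (simp_all add: transport_outside)
  then have zero: "(\<lambda>_. 0) \<in> transport h ` witt_span h" using S(2) by (metis imageI)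
  have add: "(\<lambda>a. F a + G a) \<in> transport h ` witt_span h"
    if FG: "F \<in> transport h ` witt_span h" "G \<in> transport h ` witt_span h" for F G
  proof -
    obtain D where D: "D \<in> witt_span h" "F = transport h D" using FG(1) by blast
    obtain E where E: "E \<in> witt_span h" "G = transport h E" using FG(2) by blast
    show ?thesis unfolding D(2) E(2) transport_add[symmetric] by (intro imageI S(3) D(1) E(1))
  qed
  have smult: "fsmult z F \<in> transport h ` witt_span h"
    if zF: "z \<in> centre (A_h h)" "F \<in> transport h ` witt_span h" for z F
  proof -
    obtain A where A: "z = ident h A" using zF(1) by (auto simp: centre_eq_range[OF p h])
    obtain D where D: "D \<in> witt_span h" "F = transport h D" using zF(2) by blast
    show ?thesis unfolding A D(2) transport_fsmult[symmetric] by (intro imageI S(4) D(1))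
  qed
  show ?thesis unfolding submodule_def
    using zero add smult S(1) transport_derivation by auto
qed

lemma image_Res_free_basis:
  "free_basis (centre (A_h h)) (transport h ` witt_span h) {transport h (d1 h), transport h (d2 h)}"
  "card {transport h (d1 h), transport h (d2 h)} = 2"
proof -
  let ?e1 = "transport h (d1 h)" and ?e2 = "transport h (d2 h)"
  have t: "d1 h [:[:0, 1:]:] = r1" "d2 h [:[:0, 1:]:] = 0" "d1 h [:0, 1:] = 0" "d2 h [:0, 1:] = b2"
    by (simp_all add: d1_def d2_def fsmult_def bivariate_derivation_t)
  have "d1 h \<noteq> d2 h" using t r1_nonzero by metis
  then have ne: "?e1 \<noteq> ?e2" by (simp add: transport_inj)
  then show "card {?e1, ?e2} = 2" by simp
  have sum: "(\<lambda>a. \<Sum>b\<in>{?e1, ?e2}. fsmult (c b) b a) = transport h (\<lambda>P. A * d1 h P + B * d2 h P)"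
    if "c ?e1 = ident h A" "c ?e2 = ident h B" for c A B
    using that ne transport_add[of "fsmult A (d1 h)" "fsmult B (d2 h)"]
    by (simp add: transport_fsmult) (simp add: fsmult_def)
  have mem: "?e1 \<in> transport h ` witt_span h" "?e2 \<in> transport h ` witt_span h"
    by (intro imageI, subst witt_subalgebra_gen_eq[symmetric], unfold witt_subalgebra_gen_def, rule hull_inc, simp)+
  show "free_basis (centre (A_h h)) (transport h ` witt_span h) {?e1, ?e2}"
    unfolding free_basis_def
  proof (intro conjI ballI allI impI)
    show "{?e1, ?e2} \<subseteq> transport h ` witt_span h" using mem by simp
  next
    fix D assume "D \<in> transport h ` witt_span h"
    then obtain A B where D: "D = transport h (\<lambda>P. A * d1 h P + B * d2 h P)" by (auto simp: witt_span_def)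
    define c where "c = (\<lambda>b. if b = ?e1 then ident h A else ident h B)"
    have "D = (\<lambda>a. \<Sum>b\<in>{?e1, ?e2}. fsmult (c b) b a)"
      unfolding D by (rule sum[symmetric]) (use ne in \<open>auto simp: c_def\<close>)
    moreover have "\<forall>b\<in>{?e1, ?e2}. c b \<in> centre (A_h h)" by (auto simp: c_def centre_eq_range[OF p h])
    ultimately show "\<exists>c. (\<forall>b\<in>{?e1, ?e2}. c b \<in> centre (A_h h)) \<and> D = (\<lambda>a. \<Sum>b\<in>{?e1, ?e2}. fsmult (c b) b a)"
      by blast
  next
    fix c b
    assume c: "(\<forall>b\<in>{?e1, ?e2}. c b \<in> centre (A_h h)) \<and> (\<lambda>a. \<Sum>b\<in>{?e1, ?e2}. fsmult (c b) b a) = (\<lambda>_. 0)"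
      and b: "b \<in> {?e1, ?e2}"
    obtain A B where AB: "c ?e1 = ident h A" "c ?e2 = ident h B" using c by (auto simp: centre_eq_range[OF p h])
    have "transport h (\<lambda>P. A * d1 h P + B * d2 h P) = (\<lambda>_. 0)" using sum[OF AB] c by simp
    from fun_cong[OF this] have "ident h (A * d1 h P + B * d2 h P) = ident h 0" for P
      using transport_ident[of "\<lambda>P. A * d1 h P + B * d2 h P" P] by simp
    then have "A * d1 h P + B * d2 h P = 0" for P by (simp only: ident_eq_iff[OF p h])
    from this[of "[:[:0, 1:]:]"] this[of "[:0, 1:]"] have "A = 0" "B = 0"
      using r1_nonzero b2_nonzero by (simp_all add: t del: mult_pCons_left mult_pCons_right)
    then show "c b = 0" using b AB by auto
  qed simp
qed

lemma image_Res_bar: "Res_bar (A_h h) ` HH1 weyl_const (A_h h) = Res (A_h h) ` derivations weyl_const (A_h h)"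
proof -
  let ?R = "{(D, E). D \<in> derivations weyl_const (A_h h) \<and> E \<in> derivations weyl_const (A_h h)
     \<and> (\<lambda>a. D a - E a) \<in> inner_derivations (A_h h)}"
  have "HH1 weyl_const (A_h h) = (\<lambda>D. ?R `` {D}) ` derivations weyl_const (A_h h)"
    unfolding HH1_def quotient_def by blast
  then have "Res_bar (A_h h) ` HH1 weyl_const (A_h h) =
      (\<lambda>D. Res_bar (A_h h) (?R `` {D})) ` derivations weyl_const (A_h h)"
    by (simp only: image_image)
  also have "\<dots> = Res (A_h h) ` derivations weyl_const (A_h h)"
    by (intro image_cong refl Res_bar_class A_h_0)
  finally show ?thesis .
qed

lemma transport_lie_iso: "lie_iso const12 (witt_span h) weyl_const (transport h ` witt_span h) (transport h)"
proof -
  have "D 0 = 0" if "D \<in> witt_span h" for D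
    using that by (auto simp: witt_span_def d1_def d2_def fsmult_def d_t2_def)
  then show ?thesis
    unfolding lie_iso_def bij_betw_def
    by (auto simp: inj_on_def transport_inj transport_add transport_fsmult transport_lie
        const12_def ident_const)
qed

end

theorem theorem6p17:
  fixes h :: "'k::field poly"
  assumes "CHAR('k) > 0" and "h \<noteq> 0"
  shows
    \<comment> \<open>part (a)\<close>
    "(let A = A_h h; Z = centre A;
          imRes = Res A ` derivations weyl_const A;
          e1 = fsmult (weyl_poly (h ^ CHAR('k) div rho h)) (d_xp h);
          e2 = fsmult (weyl_poly (hbar h)) (d_zh h)
      in imRes = Res_bar A ` HH1 weyl_const A
       \<and> submodule Z (derivations weyl_const Z) imRes
       \<and> free_basis Z imRes {e1, e2} \<and> card {e1, e2} = 2)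
     \<comment> \<open>part (b)\<close>
   \<and> algebra_iso const12 UNIV weyl_const (centre (A_h h)) (ident h)
   \<and> lie_iso const12 (witt_subalgebra_gen {d1 h, d2 h})
             weyl_const (Res (A_h h) ` derivations weyl_const (A_h h)) (transport h)
   \<and> lie (d1 h) (d2 h)
       = fsmult (d_t1 (in_t1 (hbar h)) * in_t1 (h ^ CHAR('k) div (rho h * hbar h))) (d2 h)"
proof -
  note a = assms
  have e: "fsmult (weyl_poly (h ^ CHAR('k) div rho h)) (d_xp h) = transport h (d1 h)"
    "fsmult (weyl_poly (hbar h)) (d_zh h) = transport h (d2 h)"
    by (simp_all add: d1_def d2_def d_xp_def d_zh_def transport_fsmult[OF a] ident_r1[OF a] ident_b2[OF a])
  show ?thesis
    unfolding Let_def e image_Res_bar[OF a] unfolding image_Res[OF a] witt_subalgebra_gen_eq[OF a]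
    using image_Res_submodule[OF a] image_Res_free_basis[OF a] ident_algebra_iso[OF a]
      transport_lie_iso[OF a] lie_d1_d2[OF a] by simp
qed

end
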